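(* Let $a_n\to\infty$, let $t=t_n$ be determined by $m(t)=a_n$, and write $s=s(t)$, $\mu_3=\mu_3(t)$. Let $\bar\pi^{a_n}(x)=s\,\pi^{a_n}(sx+a_n)$ be the normalized density of $\pi^{a_n}$, let $\bar\pi_n^{a_n}$ be the $n$-fold convolution of $\bar\pi^{a_n}$ with itself, and let $\rho_n(x)=\sqrt n\,\bar\pi_n^{a_n}(\sqrt n\,x)$. Then, as $n\to\infty$, uniformly in $x\in\mathbb{R}$, $$\rho_n(x)=\phi(x)\Big(1+\frac{\mu_3}{6\sqrt n\,s^3}\,(x^3-3x)\Big)+o\Big(\frac1{\sqrt n}\Big),$$ where $\phi$ is the standard normal density.
   Context: Standing setting. $X_1$ is a non-negative unbounded random variable with density $p$ on $\mathbb{R}_+$ of the form $p(x)=\exp(-(g(x)-q(x)))$, $x\ge 0$ ($p=0$ on $(-\infty,0)$), where $g$ is positive, convex, four times differentiable, $g(x)/x\to\infty$ as $x\to\infty$, and $q$ is bounded. Put $h=g'$ and let $\psi=h^{\leftarrow}$ be the inverse of $h$ (for large arguments). $RV(\alpha)$ denotes the functions on $\mathbb{R}_+$ regularly varying at infinity with index $\alpha$. It is assumed that $h\in\mathcal{R}$, i.e. one of the following holds. (Regularly varying case) $h(x)=x^{\beta_0}l(x)$ for some $\beta_0>0$, with $l(x)=c\exp\int_1^x\frac{\epsilon(u)}{u}du$, $c>0$, $\epsilon$ twice differentiable, $\epsilon(x)=o(1)$, $x|\epsilon'(x)|=O(1)$, $x^2|\epsilon''(x)|=O(1)$ as $x\to\infty$;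 moreover $|h''|\in RV(\theta)$ for some real $\theta\le\beta_0-2$, and $|q|\in RV(\eta)$ for some $\eta<\theta-\frac{3\beta_0}{2}-\frac32$. (Rapidly varying case) $h$ is rapidly varying at infinity, $\psi\in RV(0)$ with $\psi(t)=c\exp\int_1^t\frac{\epsilon(u)}{u}du$, $c>0$, $\epsilon$ twice differentiable, $\epsilon(t)=o(1)$, $t\epsilon'(t)/\epsilon(t)\to0$, $t^2\epsilon''(t)/\epsilon(t)\to0$ as $t\to\infty$; moreover $|q(\psi(t))|\in RV(\eta)$ as a function of $t$, for some $\eta<-\frac12$. $\Phi(t)=E[e^{tX_1}]$ (finite for all $t\ge0$ and in a neighborhood of $0$), $m(t)=\frac{d}{dt}\log\Phi(t)$, $s^2(t)=m'(t)$ with $s(t)>0$, $\mu_3(t)=\frac{d^3}{dt^3}\log\Phi(t)$. The tilted density is $\pi_t(x)=e^{tx}p(x)/\Phi(t)$, with mean $m(t)$ and variance $s^2(t)$; for $a$ in the range of $m$, $\pi^a:=\pi_t$ where $t$ is the unique solution of $m(t)=a$. *)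

theory Defs
  imports "HOL-Probability.Probability" "HOL-Library.Landau_Symbols"
begin

definition regularly_varying :: "real \<Rightarrow> (real \<Rightarrow> real) \<Rightarrow> bool" where
  "regularly_varying \<alpha> f \<longleftrightarrow>
     (\<exists>x0. set_borel_measurable borel {x0..} f) \<and>
     (\<forall>\<^sub>F x in at_top. f x > 0) \<and>
     (\<forall>r>0. ((\<lambda>x. f (r * x) / f x) \<longlongrightarrow> r powr \<alpha>) at_top)"

definition rapidly_varying :: "(real \<Rightarrow> real) \<Rightarrow> bool" where
  "rapidly_varying f \<longleftrightarrow>
     (\<exists>x0. set_borel_measurable borel {x0..} f) \<and>
     (\<forall>\<^sub>F x in at_top. f x > 0) \<and>
     (\<forall>r>1. filterlim (\<lambda>x. f (r * x) / f x) at_top at_top) \<and>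
     (\<forall>r. 0 < r \<and> r < 1 \<longrightarrow> ((\<lambda>x. f (r * x) / f x) \<longlongrightarrow> 0) at_top)"

definition karamata_form :: "real \<Rightarrow> (real \<Rightarrow> real) \<Rightarrow> real \<Rightarrow> real" where
  "karamata_form c \<epsilon> x = c * exp (integral {1..x} (\<lambda>u. \<epsilon> u / u))"

definition twice_differentiable :: "(real \<Rightarrow> real) \<Rightarrow> bool" where
  "twice_differentiable f \<longleftrightarrow>
     (\<forall>x>0. f differentiable (at x) \<and> deriv f differentiable (at x))"

text \<open>Here \<open>\<psi>\<close> is an inverse of \<open>h\<close> for large arguments only; its values below some threshold
  are arbitrary.\<close>

definition inverse_at_top :: "(real \<Rightarrow> real) \<Rightarrow> (real \<Rightarrow> real) \<Rightarrow> bool" where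
  "inverse_at_top h \<psi> \<longleftrightarrow>
     (\<exists>x0>0. bij_betw h {x0..} {h x0..} \<and> (\<forall>x\<ge>x0. \<psi> (h x) = x))"

text \<open>The representations of \<open>h\<close> and \<open>\<psi>\<close> below are required only for large arguments. For instance
  \<open>h = exp\<close> has \<open>\<psi> = ln\<close>, which vanishes at 1, so that no representation with \<open>c > 0\<close>
  holds on all of \<open>[1, \<infinity>)\<close>.\<close>

definition regular_case :: "(real \<Rightarrow> real) \<Rightarrow> (real \<Rightarrow> real) \<Rightarrow> bool" where
  "regular_case h q \<longleftrightarrow>
     (\<exists>\<beta>0 c \<epsilon> \<theta> \<eta>.
        \<beta>0 > 0 \<and> c > 0 \<and>
        (\<forall>\<^sub>F x in at_top. h x = x powr \<beta>0 * karamata_form c \<epsilon> x) \<and>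
        twice_differentiable \<epsilon> \<and>
        \<epsilon> \<in> o(\<lambda>_. 1) \<and>
        (\<lambda>x. x * \<bar>deriv \<epsilon> x\<bar>) \<in> O(\<lambda>_. 1) \<and>
        (\<lambda>x. x\<^sup>2 * \<bar>(deriv ^^ 2) \<epsilon> x\<bar>) \<in> O(\<lambda>_. 1) \<and>
        \<theta> \<le> \<beta>0 - 2 \<and> regularly_varying \<theta> (\<lambda>x. \<bar>(deriv ^^ 2) h x\<bar>) \<and>
        \<eta> < \<theta> - 3 * \<beta>0 / 2 - 3 / 2 \<and> regularly_varying \<eta> (\<lambda>x. \<bar>q x\<bar>))"

definition rapid_case :: "(real \<Rightarrow> real) \<Rightarrow> (real \<Rightarrow> real) \<Rightarrow> bool" where
  "rapid_case h q \<longleftrightarrow>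
     rapidly_varying h \<and>
     (\<exists>\<psi> c \<epsilon> \<eta>.
        inverse_at_top h \<psi> \<and> regularly_varying 0 \<psi> \<and>
        c > 0 \<and> (\<forall>\<^sub>F t in at_top. \<psi> t = karamata_form c \<epsilon> t) \<and>
        twice_differentiable \<epsilon> \<and>
        \<epsilon> \<in> o(\<lambda>_. 1) \<and>
        ((\<lambda>t. t * deriv \<epsilon> t / \<epsilon> t) \<longlongrightarrow> 0) at_top \<and>
        ((\<lambda>t. t\<^sup>2 * (deriv ^^ 2) \<epsilon> t / \<epsilon> t) \<longlongrightarrow> 0) at_top \<and>
        \<eta> < - 1 / 2 \<and> regularly_varying \<eta> (\<lambda>t. \<bar>q (\<psi> t)\<bar>))"

definition light_density :: "(real \<Rightarrow> real) \<Rightarrow> (real \<Rightarrow> real) \<Rightarrow> real \<Rightarrow> real" where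
  "light_density g q x = (if x \<ge> 0 then exp (- (g x - q x)) else 0)"

definition mgf :: "'a measure \<Rightarrow> ('a \<Rightarrow> real) \<Rightarrow> real \<Rightarrow> real" where
  "mgf M X t = (\<integral>\<omega>. exp (t * X \<omega>) \<partial>M)"

definition tilt_mean :: "'a measure \<Rightarrow> ('a \<Rightarrow> real) \<Rightarrow> real \<Rightarrow> real" where
  "tilt_mean M X = deriv (\<lambda>t. ln (mgf M X t))"

definition tilt_sd :: "'a measure \<Rightarrow> ('a \<Rightarrow> real) \<Rightarrow> real \<Rightarrow> real" where
  "tilt_sd M X t = sqrt (deriv (tilt_mean M X) t)"

definition tilt_mu3 :: "'a measure \<Rightarrow> ('a \<Rightarrow> real) \<Rightarrow> real \<Rightarrow> real" where
  "tilt_mu3 M X = (deriv ^^ 3) (\<lambda>t. ln (mgf M X t))"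

definition tilt_param :: "'a measure \<Rightarrow> ('a \<Rightarrow> real) \<Rightarrow> real \<Rightarrow> real" where
  "tilt_param M X a = (THE t. tilt_mean M X t = a)"

definition tilted_density ::
    "'a measure \<Rightarrow> ('a \<Rightarrow> real) \<Rightarrow> (real \<Rightarrow> real) \<Rightarrow> real \<Rightarrow> real \<Rightarrow> real" where
  "tilted_density M X p t x = exp (t * x) * p x / mgf M X t"

definition normalized_tilted_density ::
    "'a measure \<Rightarrow> ('a \<Rightarrow> real) \<Rightarrow> (real \<Rightarrow> real) \<Rightarrow> real \<Rightarrow> real \<Rightarrow> real" where
  "normalized_tilted_density M X p a x =
     (let t = tilt_param M X a; s = tilt_sd M X t
      in s * tilted_density M X p t (s * x + a))"

text \<open>\<open>conv_power n f\<close> is the \<open>n\<close>-fold convolution of \<open>f\<close> with itself for \<open>n \<ge> 1\<close>; the value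
  at \<open>n = 0\<close> is a dummy, since the convolution unit is not a function.\<close>

fun conv_power :: "nat \<Rightarrow> (real \<Rightarrow> real) \<Rightarrow> real \<Rightarrow> real" where
  "conv_power 0 f = (\<lambda>x. 0)"
| "conv_power (Suc 0) f = f"
| "conv_power (Suc (Suc n)) f = (\<lambda>x. \<integral>y. conv_power (Suc n) f (x - y) * f y \<partial>lborel)"

definition normalized_sum_density ::
    "'a measure \<Rightarrow> ('a \<Rightarrow> real) \<Rightarrow> (real \<Rightarrow> real) \<Rightarrow> real \<Rightarrow> nat \<Rightarrow> real \<Rightarrow> real" where
  "normalized_sum_density M X p a n x =
     sqrt (real n) * conv_power n (normalized_tilted_density M X p a) (sqrt (real n) * x)"

end

theory Submission
  imports Defs
begin

text \<open>The tilted densities are log-concave up to a factor that does not depend on the tilt: \<open>\<pi>\<^sub>t\<close> is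
proportional to \<open>exp (t x - g x)\<close> times \<open>exp (q x)\<close>, the first factor is log-concave because \<open>g\<close> is
convex, and the second lies between two positive constants because \<open>q\<close> is bounded. Rescaled to
mean 0 and variance 1, such densities form a tame class: each of them lies below a multiple of
some Laplace density, with a factor that depends on the bound of \<open>q\<close> only, and variance 1 confines
the scale of that Laplace density, so that the suprema and the fourth moments have a common bound \<open>C\<close>
(\<open>log_concave_up_to_factor_envelope\<close>, \<open>standardized_density_if_laplace_envelope\<close>). Hence it is enough
to prove the Edgeworth expansion for a single standardized density \<open>f \<le> C\<close> with fourth moment
at most \<open>C\<close>, with an error that depends on \<open>n\<close> and \<open>C\<close> only (\<open>edgeworth_expansion\<close>). This error is
of order \<open>1 / n\<close>, hence \<open>o(1 / sqrt n)\<close>, because the fourth moments are under control.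

The expansion is proved by Fourier inversion. Let \<open>\<phi>\<close> be the characteristic function of \<open>f\<close>. For
\<open>n \<ge> 3\<close> the \<open>n\<close>-fold convolution of \<open>f\<close> is at every point the inverse transform of \<open>\<phi> ^ n\<close>
(\<open>conv_power_eq_fourier_inverse\<close>), and the approximating function is the inverse transform of
\<open>exp (- u\<^sup>2 / 2) (1 + \<kappa> (i u)\<^sup>3 / (6 sqrt n))\<close> with \<open>\<kappa>\<close> the third moment of \<open>f\<close>
(\<open>fourier_inverse_gaussian_hermite\<close>). So the difference is at most the \<open>L\<^sup>1\<close> distance of
\<open>\<phi> (u / sqrt n) ^ n\<close> from that function. For \<open>\<bar>u\<bar> \<le> sqrt n / C\<close> a Taylor expansion with the
fourth moment in the remainder gives \<open>O(1 / n)\<close> times an integrable function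
(\<open>char_power_near_zero\<close>). For larger \<open>\<bar>u\<bar>\<close> the Gaussian factor is negligible, and \<open>\<bar>\<phi>\<bar>\<close> stays
below 1 by an amount that depends on \<open>C\<close> only (\<open>char_square_away_from_zero\<close>): a value close to 1 at
some frequency would recur at all small multiples of it, which contradicts the bound
\<open>2 \<pi> C\<close> on the integral of \<open>\<bar>\<phi>\<bar>\<^sup>2\<close> (\<open>square_integrable_char\<close>). Two factors \<open>\<phi>\<close> are kept for
integrability, and the other \<open>n - 2\<close> give a geometric decay.

It remains to identify the standardized tilted density. The derivatives of \<open>log \<Phi>\<close> are the mean,
the variance and the third central moment of the tilted density, and the mean is strictly
increasing and unbounded, so that \<open>m t = a\<close> has exactly one solution as soon as \<open>a \<ge> m 0\<close>.\<close>

section \<open>Characteristic functions of bounded densities\<close>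

text \<open>The bound \<open>C\<close> is a parameter of the locale because all later estimates are to be uniform over the
densities with a common bound.\<close>

locale bounded_density =
  fixes f :: "real \<Rightarrow> real" and C :: real
  assumes meas[measurable]: "f \<in> borel_measurable borel"
    and nonneg: "\<And>x. 0 \<le> f x"
    and le_bound: "\<And>x. f x \<le> C"
    and integrable_density: "integrable lborel f"
    and total: "(\<integral>x. f x \<partial>lborel) = 1"
begin

abbreviation D :: "real measure" where "D \<equiv> density lborel (\<lambda>x. ennreal (f x))"

abbreviation \<phi> :: "real \<Rightarrow> complex" where "\<phi> \<equiv> char D"

lemma real_distribution_D: "real_distribution D"
proof -
  have "emeasure D (space D) = (\<integral>\<^sup>+x. ennreal (f x) \<partial>lborel)"
    by (simp add: emeasure_density)
  also have "\<dots> = 1"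
    using nn_integral_eq_integral[OF integrable_density] nonneg total by simp
  finally have "prob_space D" by (rule prob_spaceI)
  then show ?thesis by (simp add: real_distribution_def real_distribution_axioms_def)
qed

sublocale real_distribution D by (rule real_distribution_D)

lemma bound_pos: "0 < C"
proof (rule ccontr)
  assume "\<not> 0 < C"
  then have "f x = 0" for x using nonneg[of x] le_bound[of x] by linarith
  then show False using total by simp
qed

lemma char_eq: "\<phi> v = (CLINT x|lborel. complex_of_real (f x) * iexp (v * x))"
  unfolding char_def by (subst integral_density) (auto simp: nonneg scaleR_conv_of_real)

lemma norm_char_le: "norm (\<phi> v) \<le> 1"
  by (rule cmod_char_le_1)

lemma char_minus: "\<phi> (- v) = cnj (\<phi> v)"
proof -
  have "\<phi> (-v) = (CLINT x|D. cnj (iexp (v * x)))"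
    unfolding char_def by (simp add: exp_cnj)
  also have "\<dots> = cnj (\<phi> v)"
    unfolding char_def by (rule Bochner_Integration.integral_cnj)
  finally show ?thesis .
qed

end

text \<open>Parseval's relation for two probability measures, by Fubini. With a Gaussian \<open>\<gamma>\<close> it smooths
\<open>\<mu>\<close> without requiring that its characteristic function be integrable.\<close>

lemma char_swap_smoothing:
  assumes "real_distribution \<mu>" "real_distribution \<gamma>"
  shows "(CLINT v|\<gamma>. iexp (- (k * v * y)) * char \<mu> (k * v)) = (CLINT x|\<mu>. char \<gamma> (k * (x - y)))"
proof -
  interpret M: real_distribution \<mu> by fact
  interpret G: real_distribution \<gamma> by fact
  interpret P: pair_prob_space \<gamma> \<mu> ..
  have int: "integrable (\<gamma> \<Otimes>\<^sub>M \<mu>) (\<lambda>(v,x). iexp (k * v * (x - y)))"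
    by (rule P.integrable_const_bound[where B=1]) (auto simp: split_beta)
  have "(CLINT v|\<gamma>. iexp (- (k * v * y)) * char \<mu> (k * v))
      = (CLINT v|\<gamma>. CLINT x|\<mu>. iexp (k * v * (x - y)))"
    unfolding char_def
    by (simp flip: integral_mult_right_zero exp_add add: algebra_simps)
  also have "\<dots> = (CLINT x|\<mu>. CLINT v|\<gamma>. iexp (k * v * (x - y)))"
    using P.Fubini_integral[OF int] by simp
  also have "\<dots> = (CLINT x|\<mu>. char \<gamma> (k * (x - y)))"
    unfolding char_def by (intro Bochner_Integration.integral_cong refl) (simp add: algebra_simps)
  finally show ?thesis .
qed

context bounded_density
begin

text \<open>Writing \<open>\<bar>\<phi>\<bar>\<^sup>2\<close> as \<open>\<phi> (v) \<phi> (- v)\<close> and integrating against a Gaussian gives the density of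
\<open>X - Y\<close> at 0, smoothed at scale \<open>1 / k\<close>, where \<open>X\<close> and \<open>Y\<close> are independent with density \<open>f\<close>. This
density is at most \<open>C\<close>.\<close>

lemma gaussian_mean_square_char:
  assumes k: "0 < (k::real)"
  shows "(\<integral>v. (norm (\<phi> (k * v)))\<^sup>2 \<partial>std_normal_distribution) \<le> C * sqrt (2 * pi) / k"
proof -
  interpret N: real_distribution std_normal_distribution by (rule real_dist_normal_dist)
  interpret P: pair_prob_space std_normal_distribution D ..
  have smooth: "(CLINT v|std_normal_distribution. iexp (- (k * v * y)) * \<phi> (k * v))
      = complex_of_real (\<integral>x. exp (- (k * (x - y))\<^sup>2 / 2) \<partial>D)" for y
    unfolding char_swap_smoothing[OF real_distribution_D real_dist_normal_dist]
      char_std_normal_distribution by simp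
  have bd: "(\<integral>x. exp (- (k * (x - y))\<^sup>2 / 2) \<partial>D) \<le> C * sqrt (2 * pi) / k" for y
  proof -
    have nd: "normal_density y (1 / k) x = exp (- (k * (x - y))\<^sup>2 / 2) * k / sqrt (2 * pi)" for x
      using k by (simp add: normal_density_def real_sqrt_divide power_divide power_mult_distrib real_sqrt_mult)
    have "(\<integral>x. exp (- (k * (x - y))\<^sup>2 / 2) \<partial>D) = (\<integral>x. f x * exp (- (k * (x - y))\<^sup>2 / 2) \<partial>lborel)"
      by (subst integral_density) (auto simp: nonneg)
    also have "\<dots> \<le> (\<integral>x. C * sqrt (2 * pi) / k * normal_density y (1 / k) x \<partial>lborel)"
    proof (rule integral_mono)
      show "integrable lborel (\<lambda>x. f x * exp (- (k * (x - y))\<^sup>2 / 2))"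
        by (rule Bochner_Integration.integrable_bound[OF integrable_density])
          (auto simp: nonneg abs_mult intro!: mult_left_le)
      show "integrable lborel (\<lambda>x. C * sqrt (2 * pi) / k * normal_density y (1 / k) x)"
        using k by (intro integrable_mult_right) (simp add: integrable_normal_density)
      show "f x * exp (- (k * (x - y))\<^sup>2 / 2) \<le> C * sqrt (2 * pi) / k * normal_density y (1 / k) x" for x
        unfolding nd using k le_bound[of x] by (simp add: mult_right_mono)
    qed
    also have "\<dots> = C * sqrt (2 * pi) / k"
      using k by (simp add: integral_normal_density)
    finally show ?thesis .
  qed
  have int: "integrable (std_normal_distribution \<Otimes>\<^sub>M D) (\<lambda>(v,y). iexp (- (k * v * y)) * \<phi> (k * v))"
    by (rule P.integrable_const_bound[where B=1])
      (auto simp: split_beta norm_mult norm_char_le)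
  have "complex_of_real (\<integral>v. (norm (\<phi> (k * v)))\<^sup>2 \<partial>std_normal_distribution)
      = (CLINT v|std_normal_distribution. \<phi> (k * v) * cnj (\<phi> (k * v)))"
    by (subst integral_complex_of_real[symmetric]) (simp only: complex_norm_square)
  also have "\<dots> = (CLINT v|std_normal_distribution. CLINT y|D. iexp (- (k * v * y)) * \<phi> (k * v))"
    by (simp add: char_minus[symmetric] mult.commute) (simp add: char_def ac_simps)
  also have "\<dots> = (CLINT y|D. CLINT v|std_normal_distribution. iexp (- (k * v * y)) * \<phi> (k * v))"
    using P.Fubini_integral[OF int] by simp
  also have "\<dots> = complex_of_real (\<integral>y. (\<integral>x. exp (- (k * (x - y))\<^sup>2 / 2) \<partial>D) \<partial>D)"
    by (simp only: smooth integral_complex_of_real)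
  finally have "(\<integral>v. (norm (\<phi> (k * v)))\<^sup>2 \<partial>std_normal_distribution)
      = (\<integral>y. (\<integral>x. exp (- (k * (x - y))\<^sup>2 / 2) \<partial>D) \<partial>D)"
    by (simp only: of_real_eq_iff)
  also have "\<dots> \<le> (\<integral>y. C * sqrt (2 * pi) / k \<partial>D)"
  proof (rule integral_mono)
    show "integrable D (\<lambda>y. \<integral>x. exp (- (k * (x - y))\<^sup>2 / 2) \<partial>D)"
    proof (rule integrable_const_bound[where B="C * sqrt (2 * pi) / k"])
      show "AE y in D. norm (\<integral>x. exp (- (k * (x - y))\<^sup>2 / 2) \<partial>D) \<le> C * sqrt (2 * pi) / k"
        using bd by (simp add: integral_nonneg_AE)
    qed measurable
    show "integrable D (\<lambda>y. C * sqrt (2 * pi) / k)" by simp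
    show "(\<integral>x. exp (- (k * (x - y))\<^sup>2 / 2) \<partial>D) \<le> C * sqrt (2 * pi) / k" for y by (rule bd)
  qed
  also have "\<dots> = C * sqrt (2 * pi) / k" using prob_space by simp
  finally show ?thesis .
qed

text \<open>An inequality of Plancherel type, with the integral of \<open>f\<^sup>2\<close> estimated by \<open>C\<close>: as the Gaussian
weight widens, the bound of \<open>gaussian_mean_square_char\<close> survives by Fatou's lemma.\<close>

lemma square_integrable_char:
  shows "integrable lborel (\<lambda>v. (norm (\<phi> v))\<^sup>2)"
    and "(\<integral>v. (norm (\<phi> v))\<^sup>2 \<partial>lborel) \<le> 2 * pi * C"
proof -
  let ?h = "\<lambda>(k::nat) v. (norm (\<phi> v))\<^sup>2 * exp (- (v / Suc k)\<^sup>2 / 2)"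
  have fin: "(\<integral>\<^sup>+v. ennreal (?h k v) \<partial>lborel) \<le> ennreal (2 * pi * C)" for k
  proof -
    define j where "j = real (Suc k)"
    have j: "j > 0" by (simp add: j_def)
    have "(\<integral>\<^sup>+v. ennreal (?h k v) \<partial>lborel)
        = ennreal j * (\<integral>\<^sup>+v. ennreal ((norm (\<phi> (j * v)))\<^sup>2 * exp (- v\<^sup>2 / 2)) \<partial>lborel)"
      using j by (subst nn_integral_real_affine[where c=j and t=0]) (auto simp flip: j_def simp del: of_nat_Suc)
    also have "\<dots> = ennreal j * (\<integral>\<^sup>+v. ennreal (sqrt (2 * pi)) * (ennreal (std_normal_density v) * ennreal ((norm (\<phi> (j * v)))\<^sup>2)) \<partial>lborel)"
      by (intro arg_cong2[where f="(*)"] nn_integral_cong refl)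
        (simp add: std_normal_density_def flip: ennreal_mult)
    also have "\<dots> = ennreal j * ennreal (sqrt (2 * pi)) * (\<integral>\<^sup>+v. ennreal (std_normal_density v) * ennreal ((norm (\<phi> (j * v)))\<^sup>2) \<partial>lborel)"
      by (subst nn_integral_cmult) (auto simp: mult.assoc)
    also have "(\<integral>\<^sup>+v. ennreal (std_normal_density v) * ennreal ((norm (\<phi> (j * v)))\<^sup>2) \<partial>lborel)
       = (\<integral>\<^sup>+v. ennreal ((norm (\<phi> (j * v)))\<^sup>2) \<partial>std_normal_distribution)"
      by (subst nn_integral_density) auto
    also have "\<dots> = ennreal (\<integral>v. (norm (\<phi> (j * v)))\<^sup>2 \<partial>std_normal_distribution)"
    proof (rule nn_integral_eq_integral)
      interpret N: real_distribution std_normal_distribution by (rule real_dist_normal_dist)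
      show "integrable std_normal_distribution (\<lambda>v. (norm (\<phi> (j * v)))\<^sup>2)"
        by (rule N.integrable_const_bound[where B=1]) (auto simp: norm_char_le power_le_one)
    qed auto
    also have "\<dots> \<le> ennreal (C * sqrt (2 * pi) / j)"
      by (intro ennreal_leI gaussian_mean_square_char j)
    finally have "(\<integral>\<^sup>+v. ennreal (?h k v) \<partial>lborel) \<le> ennreal j * ennreal (sqrt (2 * pi)) * ennreal (C * sqrt (2 * pi) / j)"
      by (simp add: mult_left_mono)
    also have "\<dots> = ennreal (2 * pi * C)"
      using j bound_pos by (simp flip: ennreal_mult add: field_simps)
    finally show ?thesis .
  qed
  have lim: "(\<lambda>k. ?h k v) \<longlonglongrightarrow> (norm (\<phi> v))\<^sup>2" for v
  proof -
    have "(\<lambda>k. v / real (Suc k)) \<longlonglongrightarrow> 0"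
      using LIMSEQ_Suc[OF lim_const_over_n[of v]] by simp
    from tendsto_mult[OF tendsto_const tendsto_exp[OF tendsto_divide[OF tendsto_minus[OF tendsto_power[OF this, of 2]] tendsto_const[of 2]]], of "(norm (\<phi> v))\<^sup>2"]
    show ?thesis by simp
  qed
  have "(\<integral>\<^sup>+v. ennreal ((norm (\<phi> v))\<^sup>2) \<partial>lborel) = (\<integral>\<^sup>+v. liminf (\<lambda>k. ennreal (?h k v)) \<partial>lborel)"
    by (intro nn_integral_cong lim_imp_Liminf[symmetric] tendsto_ennrealI lim) simp
  also have "\<dots> \<le> liminf (\<lambda>k. \<integral>\<^sup>+v. ennreal (?h k v) \<partial>lborel)"
    by (rule nn_integral_liminf) auto
  also have "\<dots> \<le> ennreal (2 * pi * C)"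
    using fin by (intro Liminf_le) auto
  finally have le: "(\<integral>\<^sup>+v. ennreal ((norm (\<phi> v))\<^sup>2) \<partial>lborel) \<le> ennreal (2 * pi * C)" .
  show *: "integrable lborel (\<lambda>v. (norm (\<phi> v))\<^sup>2)"
    using le by (intro integrableI_bounded) (auto simp: top_unique intro: le_less_trans)
  show "(\<integral>v. (norm (\<phi> v))\<^sup>2 \<partial>lborel) \<le> 2 * pi * C"
    using le nn_integral_eq_integral[OF *] bound_pos by (simp add: ennreal_le_iff)
qed

end

section \<open>Fourier inversion for convolution powers\<close>

text \<open>The positive and the negative part of \<open>v\<close> are densities of two finite measures that agree on all
half-lines, hence everywhere.\<close>

lemma AE_zero_if_tail_integrals_zero:
  fixes v :: "real \<Rightarrow> real"
  assumes v: "integrable lborel v"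
    and tail: "\<And>x. (\<integral>y. indicator {x<..} y * v y \<partial>lborel) = 0"
  shows "AE y in lborel. v y = 0"
proof -
  have [measurable]: "v \<in> borel_measurable borel"
    using v by auto
  let ?P = "density lborel (\<lambda>y. ennreal (max 0 (v y)))"
  let ?N = "density lborel (\<lambda>y. ennreal (max 0 (- v y)))"
  have intP: "integrable lborel (\<lambda>y. indicator {x<..} y * max 0 (v y))"
    and intN: "integrable lborel (\<lambda>y. indicator {x<..} y * max 0 (- v y))" for x :: real
    by (rule Bochner_Integration.integrable_bound[OF v]; auto simp: indicator_def)+
  have P: "emeasure ?P {x<..} = ennreal (\<integral>y. indicator {x<..} y * max 0 (v y) \<partial>lborel)" for x
    using intP[of x]
    by (subst nn_integral_eq_integral[symmetric])
      (auto simp: emeasure_density indicator_def intro!: nn_integral_cong)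
  have N: "emeasure ?N {x<..} = ennreal (\<integral>y. indicator {x<..} y * max 0 (- v y) \<partial>lborel)" for x
    using intN[of x]
    by (subst nn_integral_eq_integral[symmetric])
      (auto simp: emeasure_density indicator_def intro!: nn_integral_cong)
  have eq: "(\<integral>y. indicator {x<..} y * max 0 (v y) \<partial>lborel) = (\<integral>y. indicator {x<..} y * max 0 (- v y) \<partial>lborel)" for x
  proof -
    have "(\<integral>y. indicator {x<..} y * max 0 (v y) \<partial>lborel) - (\<integral>y. indicator {x<..} y * max 0 (- v y) \<partial>lborel)
       = (\<integral>y. indicator {x<..} y * v y \<partial>lborel)"
      by (subst Bochner_Integration.integral_diff[symmetric, OF intP intN])
        (auto intro!: Bochner_Integration.integral_cong simp: indicator_def)
    then show ?thesis using tail by simp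
  qed
  have "?P = ?N"
  proof (rule measure_eqI_lessThan)
    show "emeasure ?P {x<..} < \<infinity>" for x by (simp only: P) (simp del: ennreal_max_0)
    show "emeasure ?P {x<..} = emeasure ?N {x<..}" for x by (simp only: P N eq)
  qed simp_all
  then have "AE y in lborel. ennreal (max 0 (v y)) = ennreal (max 0 (- v y))"
    by (subst (asm) sigma_finite_measure.density_unique_iff[OF lborel.sigma_finite_measure_axioms]) auto
  then show ?thesis
    by eventually_elim (auto simp: max_def split: if_splits)
qed

lemma integrable_indicator_Ioc: "integrable lborel (indicator {a<..b} :: real \<Rightarrow> real)"
  by (cases "a \<le> b") (simp_all add: integrable_indicator_iff)

definition fourier_inverse :: "(real \<Rightarrow> complex) \<Rightarrow> real \<Rightarrow> complex" where
  "fourier_inverse w x = (CLINT v|lborel. iexp (- (v * x)) * w v) / (2 * pi)"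

lemma integrable_iexp_mult:
  assumes "integrable lborel w"
  shows "integrable lborel (\<lambda>v. iexp (- (v * a)) * w v)"
proof -
  have [measurable]: "w \<in> borel_measurable borel" using assms by auto
  show ?thesis
    by (rule Bochner_Integration.integrable_bound[OF assms]) (auto simp: norm_mult)
qed

lemma norm_fourier_inverse_le:
  "norm (fourier_inverse w x) \<le> (\<integral>v. norm (w v) \<partial>lborel) / (2 * pi)"
proof -
  have "norm (CLINT v|lborel. iexp (- (v * x)) * w v) \<le> (\<integral>v. norm (iexp (- (v * x)) * w v) \<partial>lborel)"
    by (rule integral_norm_bound)
  then show ?thesis
    unfolding fourier_inverse_def by (simp add: norm_divide norm_mult divide_right_mono del: of_real_mult)
qed

lemma fourier_inverse_diff:
  assumes "integrable lborel w" "integrable lborel z"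
  shows "fourier_inverse (\<lambda>v. w v - z v) x = fourier_inverse w x - fourier_inverse z x"
  unfolding fourier_inverse_def
  using integrable_iexp_mult[OF assms(1)] integrable_iexp_mult[OF assms(2)]
  by (simp add: right_diff_distrib diff_divide_distrib)

lemma fourier_inverse_measurable [measurable]:
  assumes [measurable]: "w \<in> borel_measurable borel"
  shows "fourier_inverse w \<in> borel_measurable borel"
  unfolding fourier_inverse_def by measurable

lemma integral_iexp_interval:
  fixes a b t :: real
  assumes "a \<le> b" "t \<noteq> 0"
  shows "(CLINT x|lborel. indicator {a<..b} x * iexp (- (t * x)))
    = (iexp (- (t * a)) - iexp (- (t * b))) / (\<i> * t)"
proof -
  have "(CLBINT x=a..b. iexp (- (t * x))) = (- iexp (- (t * b)) / (\<i> * t)) - (- iexp (- (t * a)) / (\<i> * t))"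
  proof (rule interval_integral_FTC_finite)
    show "continuous_on {min a b..max a b} (\<lambda>x. iexp (- (t * x)))"
      by (intro continuous_intros)
    fix x
    have "((\<lambda>z. - exp (\<i> * (- (t * z))) / (\<i> * t)) has_field_derivative exp (\<i> * (- (t * complex_of_real x)))) (at (complex_of_real x))"
      using assms(2) by (auto intro!: derivative_eq_intros simp: field_simps)
    from has_vector_derivative_real_field[OF this]
    show "((\<lambda>x. - iexp (- (t * x)) / (\<i> * t)) has_vector_derivative iexp (- (t * x)))
        (at x within {min a b..max a b})"
      using assms(2) by simp
  qed
  also have "(CLBINT x=a..b. iexp (- (t * x))) = (CLBINT x:{a<..b}. iexp (- (t * x)))"
    using assms by (simp add: interval_integral_Ioc)
  finally show ?thesis
    by (simp add: set_lebesgue_integral_def scaleR_conv_of_real diff_divide_distrib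
        of_real_indicator)
qed

context bounded_density
begin

lemma measure_D: 
  assumes [measurable]: "A \<in> sets borel"
  shows "measure D A = (\<integral>x. indicator A x * f x \<partial>lborel)"
proof -
  have "measure D A = (\<integral>x. indicator A x \<partial>D)" by simp
  also have "\<dots> = (\<integral>x. indicator A x * f x \<partial>lborel)"
    by (subst integral_density) (auto simp: nonneg mult.commute)
  finally show ?thesis .
qed

lemma measure_D_singleton: "measure D {a} = 0"
proof -
  have "AE x in lborel. x \<noteq> a" by (rule AE_lborel_singleton)
  then have "(\<integral>x. indicator {a} x * f x \<partial>lborel) = (\<integral>x. 0 \<partial>lborel)"
    by (subst integral_cong_AE[where g="\<lambda>x. 0"]) (auto elim!: eventually_mono)
  then show ?thesis by (simp add: measure_D)
qed

text \<open>Levy's inversion formula gives the probability of an interval as a limit of integrals over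
\<open>[- T, T]\<close>. If \<open>\<phi>\<close> is integrable, then the limit is the full integral, and its kernel
\<open>(iexp (- (t a)) - iexp (- (t b))) / (\<i> t)\<close> is the integral of \<open>iexp (- (t x))\<close> over the interval.\<close>

lemma interval_probability_eq_fourier_inverse:
  assumes int: "integrable lborel \<phi>" and ab: "a \<le> b"
  shows "complex_of_real (measure D {a<..b}) = (CLINT x|lborel. indicator {a<..b} x * fourier_inverse \<phi> x)"
proof -
  let ?F = "\<lambda>t. (iexp (- (t * a)) - iexp (- (t * b))) / (\<i> * t)"
  have bF: "norm (?F t) \<le> b - a" for t
  proof (cases "t = 0")
    case False
    have "norm (?F t) = norm ((iexp ((-t) * b) - iexp ((-t) * a)) / (\<i> * (-t)))"
      by (simp add: norm_divide norm_minus_commute)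
    also have "\<dots> \<le> b - a"
      using Levy_Inversion_aux2[OF ab, of "-t"] False by simp
    finally show ?thesis .
  qed (use ab in simp)
  have intF: "integrable lborel (\<lambda>t. ?F t * \<phi> t)"
  proof (rule Bochner_Integration.integrable_bound[OF integrable_mult_right[OF int, of "complex_of_real (b - a)"]])
    have "norm (?F t * \<phi> t) \<le> norm (complex_of_real (b - a) * \<phi> t)" for t
      unfolding norm_mult norm_of_real using bF[of t] ab by (intro mult_right_mono) auto
    then show "AE t in lborel. norm (?F t * \<phi> t) \<le> norm (complex_of_real (b - a) * \<phi> t)"
      by (intro AE_I2)
  qed measurable
  have lim1: "(\<lambda>T::nat. CLBINT t=- ereal (real T)..ereal (real T). ?F t * \<phi> t) \<longlonglongrightarrow> (CLINT t|lborel. ?F t * \<phi> t)"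
  proof -
    have eq: "(CLBINT t=- ereal (real T)..ereal (real T). ?F t * \<phi> t) = (CLINT t|lborel. indicator {-real T<..<real T} t *\<^sub>R (?F t * \<phi> t))" for T :: nat
      by (simp add: interval_lebesgue_integral_def set_lebesgue_integral_def)
    have "(\<lambda>T::nat. CLINT t|lborel. indicator {-real T<..<real T} t *\<^sub>R (?F t * \<phi> t)) \<longlonglongrightarrow> (CLINT t|lborel. ?F t * \<phi> t)"
    proof (rule integral_dominated_convergence[where w="\<lambda>t. norm (?F t * \<phi> t)"])
      show "AE t in lborel. (\<lambda>T::nat. indicator {-real T<..<real T} t *\<^sub>R (?F t * \<phi> t)) \<longlonglongrightarrow> ?F t * \<phi> t"
      proof (rule AE_I2, rule tendsto_eventually)
        fix t :: real
        obtain n :: nat where "\<bar>t\<bar> < real n" using reals_Archimedean2 by blast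
        then show "\<forall>\<^sub>F T :: nat in sequentially. indicator {-real T<..<real T} t *\<^sub>R (?F t * \<phi> t) = ?F t * \<phi> t"
          by (intro eventually_sequentiallyI[of n]) (auto simp: indicator_def)
      qed
    qed (use intF in \<open>auto simp: indicator_def\<close>)
    then show ?thesis unfolding eq .
  qed
  have "(\<lambda>T. 1 / (2 * pi) * (CLBINT t=- ereal (real T)..ereal (real T). ?F t * \<phi> t)) \<longlonglongrightarrow> complex_of_real (measure D {a<..b})"
    using Levy_Inversion[OF ab measure_D_singleton measure_D_singleton] by simp
  moreover have "(\<lambda>T::nat. 1 / (2 * pi) * (CLBINT t=- ereal (real T)..ereal (real T). ?F t * \<phi> t)) \<longlonglongrightarrow> 1 / (2 * pi) * (CLINT t|lborel. ?F t * \<phi> t)"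
    by (intro tendsto_mult tendsto_const lim1)
  ultimately have "complex_of_real (measure D {a<..b}) = 1 / (2 * pi) * (CLINT t|lborel. ?F t * \<phi> t)"
    by (rule LIMSEQ_unique)
  also have "(CLINT t|lborel. ?F t * \<phi> t) = (CLINT t|lborel. CLINT x|lborel. indicator {a<..b} x * iexp (- (t * x)) * \<phi> t)"
  proof (rule integral_cong_AE)
    show "AE t in lborel. ?F t * \<phi> t = (CLINT x|lborel. indicator {a<..b} x * iexp (- (t * x)) * \<phi> t)"
      using AE_lborel_singleton[of "0::real"]
      by eventually_elim (simp only: integral_mult_left_zero integral_iexp_interval[OF ab] not_False_eq_True)
  qed auto
  also have "\<dots> = (CLINT x|lborel. CLINT t|lborel. indicator {a<..b} x * iexp (- (t * x)) * \<phi> t)"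
  proof -
    have "integrable (lborel \<Otimes>\<^sub>M lborel) (\<lambda>(t,x). indicator {a<..b} x * iexp (- (t * x)) * \<phi> t)"
    proof (rule lborel_pair.Fubini_integrable)
      have "(\<integral>y. cmod (case (t, y) of (t, x) \<Rightarrow> indicator {a<..b} x * iexp (- (t * x)) * \<phi> t) \<partial>lborel) = (b - a) * norm (\<phi> t)" for t
      proof -
        have "(\<integral>y. cmod (case (t, y) of (t, x) \<Rightarrow> indicator {a<..b} x * iexp (- (t * x)) * \<phi> t) \<partial>lborel)
          = (\<integral>y. indicator {a<..b} y * norm (\<phi> t) \<partial>lborel)"
          by (intro Bochner_Integration.integral_cong) (auto simp: norm_mult indicator_def)
        also have "\<dots> = (b - a) * norm (\<phi> t)" using ab by simp
        finally show ?thesis .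
      qed
      then show "integrable lborel (\<lambda>x. \<integral>y. cmod (case (x, y) of (t, x) \<Rightarrow> indicator {a<..b} x * iexp (- (t * x)) * \<phi> t) \<partial>lborel)"
        using integrable_norm[OF int] by simp
      show "AE x in lborel. integrable lborel (\<lambda>y. case (x, y) of (t, x) \<Rightarrow> indicator {a<..b} x * iexp (- (t * x)) * \<phi> t)"
      proof (rule AE_I2)
        fix t
        have "integrable lborel (\<lambda>x. indicator {a<..b} x * norm (\<phi> t))"
          by (intro integrable_mult_left integrable_indicator_Ioc)
        then show "integrable lborel (\<lambda>y. case (t, y) of (t, x) \<Rightarrow> indicator {a<..b} x * iexp (- (t * x)) * \<phi> t)"
          by (rule Bochner_Integration.integrable_bound) (auto simp: norm_mult indicator_def)
      qed
    qed measurable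
    from lborel_pair.Fubini_integral[OF this] show ?thesis by simp
  qed
  also have "1 / (2 * pi) * \<dots> = (CLINT x|lborel. indicator {a<..b} x * fourier_inverse \<phi> x)"
    unfolding fourier_inverse_def
    by (simp add: mult.assoc flip: integral_mult_right_zero)
  finally show ?thesis .
qed

text \<open>The density and the inverse transform have the same integrals over bounded intervals. The inverse
transform is bounded, but it is not known beforehand to be integrable on the line; hence the
restriction to the windows \<open>(- N, N]\<close>.\<close>

lemma density_eq_fourier_inverse_AE:
  assumes int: "integrable lborel \<phi>"
  shows "AE x in lborel. f x = Re (fourier_inverse \<phi> x)"
proof -
  let ?H = "\<lambda>x. Re (fourier_inverse \<phi> x)"
  let ?v = "\<lambda>N x. indicator {-real N<..real N} x * (f x - ?H x)"
  have H_bd: "\<bar>?H x\<bar> \<le> (\<integral>v. norm (\<phi> v) \<partial>lborel) / (2 * pi)" for x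
    using order_trans[OF abs_Re_le_cmod norm_fourier_inverse_le] .
  have H_int: "integrable lborel (\<lambda>x. indicator {a<..b} x * ?H x)" for a b :: real
  proof (rule Bochner_Integration.integrable_bound)
    show "integrable lborel (\<lambda>x. indicator {a<..b} x * ((\<integral>v. norm (\<phi> v) \<partial>lborel) / (2 * pi)))"
      by (intro integrable_mult_left) (rule integrable_indicator_Ioc)
    show "AE x in lborel. norm (indicator {a<..b} x * ?H x) \<le> norm (indicator {a<..b} x * ((\<integral>v. norm (\<phi> v) \<partial>lborel) / (2 * pi)))"
      using H_bd by (intro AE_I2) (auto simp: indicator_def intro: order_trans)
  qed measurable
  have H_intc: "integrable lborel (\<lambda>x. indicator {a<..b} x * fourier_inverse \<phi> x)" for a b :: real
  proof (rule Bochner_Integration.integrable_bound)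
    show "integrable lborel (\<lambda>x. indicator {a<..b} x * ((\<integral>v. norm (\<phi> v) \<partial>lborel) / (2 * pi)))"
      by (intro integrable_mult_left) (rule integrable_indicator_Ioc)
    show "AE x in lborel. norm (indicator {a<..b} x * fourier_inverse \<phi> x) \<le> norm (indicator {a<..b} x * ((\<integral>v. norm (\<phi> v) \<partial>lborel) / (2 * pi)))"
      using norm_fourier_inverse_le[of \<phi>] by (intro AE_I2) (auto simp: indicator_def intro: order_trans)
  qed measurable
  have f_int: "integrable lborel (\<lambda>x. indicator {a<..b} x * f x)" for a b :: real
    by (rule Bochner_Integration.integrable_bound[OF integrable_density]) (auto simp: indicator_def)
  have eq: "(\<integral>x. indicator {a<..b} x * f x \<partial>lborel) = (\<integral>x. indicator {a<..b} x * ?H x \<partial>lborel)" for a b :: real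
  proof (cases "a \<le> b")
    case True
    have "(\<integral>x. indicator {a<..b} x * ?H x \<partial>lborel) = (\<integral>x. Re (indicator {a<..b} x * fourier_inverse \<phi> x) \<partial>lborel)"
      by (intro Bochner_Integration.integral_cong) (auto simp: indicator_def)
    also have "\<dots> = Re (CLINT x|lborel. indicator {a<..b} x * fourier_inverse \<phi> x)"
      by (rule integral_Re[OF H_intc])
    also have "\<dots> = measure D {a<..b}"
      by (simp flip: interval_probability_eq_fourier_inverse[OF int True])
    finally show ?thesis by (simp add: measure_D)
  qed simp
  have "AE x in lborel. ?v N x = 0" for N
  proof (rule AE_zero_if_tail_integrals_zero)
    show "integrable lborel (?v N)"
      using Bochner_Integration.integrable_diff[OF f_int H_int] by (simp add: right_diff_distrib)
    fix x
    have "(\<integral>y. indicator {x<..} y * ?v N y \<partial>lborel)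
      = (\<integral>y. indicator {max x (- real N)<..real N} y * f y - indicator {max x (- real N)<..real N} y * ?H y \<partial>lborel)"
      by (intro Bochner_Integration.integral_cong) (auto simp: indicator_def)
    also have "\<dots> = 0"
      by (subst Bochner_Integration.integral_diff[OF f_int H_int]) (simp add: eq)
    finally show "(\<integral>y. indicator {x<..} y * ?v N y \<partial>lborel) = 0" .
  qed
  then have "AE x in lborel. \<forall>N. ?v N x = 0"
    by (simp only: AE_all_countable) simp
  then show ?thesis
  proof eventually_elim
    fix x assume *: "\<forall>N. ?v N x = 0"
    obtain n :: nat where "\<bar>x\<bar> < real n" using reals_Archimedean2 by blast
    with *[rule_format, of n] show "f x = ?H x" by (auto simp: indicator_def split: if_splits)
  qed
qed

end

lemma convolution_integrable:
  fixes w :: "real \<Rightarrow> complex"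
  assumes "bounded_density u B" "bounded_density f C" and [measurable]: "w \<in> borel_measurable borel"
    and w: "\<And>x. norm (w x) \<le> 1"
  shows "integrable (lborel \<Otimes>\<^sub>M lborel) (\<lambda>(x,y). complex_of_real (u (x - y) * f y) * w x)"
proof -
  interpret u: bounded_density u B by fact
  interpret f: bounded_density f C by fact
  have [measurable]: "f \<in> borel_measurable borel" "u \<in> borel_measurable borel" by (rule u.meas f.meas)+
  have "integrable (lborel \<Otimes>\<^sub>M lborel) (\<lambda>(y,x). complex_of_real (u (x - y) * f y) * w x)"
  proof (rule Bochner_Integration.integrable_bound)
    have int: "integrable lborel (\<lambda>x. u (x - y) * f y)" for y
      using lborel_integrable_real_affine[OF u.integrable_density, of 1 "-y"] by simp
    have tot: "(\<integral>x. u (x - y) \<partial>lborel) = 1" for y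
      using lborel_integral_real_affine[of 1 u "-y"] u.total by simp
    show "integrable (lborel \<Otimes>\<^sub>M lborel) (\<lambda>(y,x). u (x - y) * f y)"
    proof (rule lborel_pair.Fubini_integrable)
      have "(\<integral>x. norm (case (y, x) of (y, x) \<Rightarrow> u (x - y) * f y) \<partial>lborel) = f y" for y
        by (simp add: u.nonneg f.nonneg abs_mult tot)
      then show "integrable lborel (\<lambda>y. \<integral>x. norm (case (y, x) of (y, x) \<Rightarrow> u (x - y) * f y) \<partial>lborel)"
        using f.integrable_density by simp
    qed (use int in auto)
    show "AE z in lborel \<Otimes>\<^sub>M lborel. norm (case z of (y, x) \<Rightarrow> complex_of_real (u (x - y) * f y) * w x)
        \<le> norm (case z of (y, x) \<Rightarrow> u (x - y) * f y)"
      using w by (intro AE_I2) (auto simp: norm_mult u.nonneg f.nonneg intro!: mult_left_le)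
  qed measurable
  from lborel_pair.integrable_product_swap[OF this] show ?thesis by simp
qed

lemma integral_convolution:
  fixes w :: "real \<Rightarrow> complex"
  assumes "bounded_density u B" "bounded_density f C" and [measurable]: "w \<in> borel_measurable borel"
    and w: "\<And>x. norm (w x) \<le> 1"
  shows "(CLINT x|lborel. complex_of_real (\<integral>y. u (x - y) * f y \<partial>lborel) * w x)
    = (CLINT y|lborel. CLINT x|lborel. complex_of_real (u x * f y) * w (x + y))"
proof -
  interpret u: bounded_density u B by fact
  interpret f: bounded_density f C by fact
  have "(CLINT x|lborel. complex_of_real (\<integral>y. u (x - y) * f y \<partial>lborel) * w x)
      = (CLINT x|lborel. CLINT y|lborel. complex_of_real (u (x - y) * f y) * w x)"
    by (simp del: of_real_mult flip: integral_complex_of_real)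
  also have "\<dots> = (CLINT y|lborel. CLINT x|lborel. complex_of_real (u (x - y) * f y) * w x)"
    using lborel_pair.Fubini_integral[OF convolution_integrable[OF assms]] by simp
  also have "\<dots> = (CLINT y|lborel. CLINT x|lborel. complex_of_real (u x * f y) * w (x + y))"
  proof (rule Bochner_Integration.integral_cong[OF refl])
    fix y
    show "(CLINT x|lborel. complex_of_real (u (x - y) * f y) * w x) = (CLINT x|lborel. complex_of_real (u x * f y) * w (x + y))"
      using lborel_integral_real_affine[of 1 "\<lambda>x. complex_of_real (u (x - y) * f y) * w x" y]
      by (simp add: add.commute)
  qed
  finally show ?thesis .
qed

lemma bounded_density_convolution:
  assumes "bounded_density u B" "bounded_density f C"
  shows "bounded_density (\<lambda>x. \<integral>y. u (x - y) * f y \<partial>lborel) B"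
proof -
  interpret u: bounded_density u B by fact
  interpret f: bounded_density f C by fact
  have [measurable]: "f \<in> borel_measurable borel" "u \<in> borel_measurable borel" by (rule u.meas f.meas)+
  have int: "integrable lborel (\<lambda>y. B * f y)" by (intro integrable_mult_right f.integrable_density)
  have int': "integrable lborel (\<lambda>y. u (x - y) * f y)" for x
    by (rule Bochner_Integration.integrable_bound[OF int])
      (auto simp: abs_mult u.nonneg f.nonneg abs_of_pos[OF u.bound_pos] intro!: mult_right_mono u.le_bound)
  show ?thesis
  proof
    show "(\<lambda>x. \<integral>y. u (x - y) * f y \<partial>lborel) \<in> borel_measurable borel" by measurable
    show "0 \<le> (\<integral>y. u (x - y) * f y \<partial>lborel)" for x
      by (intro integral_nonneg_AE AE_I2) (simp add: u.nonneg f.nonneg)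
    have "(\<integral>y. u (x - y) * f y \<partial>lborel) \<le> (\<integral>y. B * f y \<partial>lborel)" for x
      by (intro integral_mono int int' mult_right_mono u.le_bound f.nonneg)
    then show "(\<integral>y. u (x - y) * f y \<partial>lborel) \<le> B" for x using f.total by simp
    have "integrable lborel (\<lambda>x. CLINT y|lborel. complex_of_real (u (x - y) * f y) * 1)"
      using lborel_pair.integrable_fst'[OF convolution_integrable[OF assms, of "\<lambda>_. 1"]] by simp
    then have "integrable lborel (\<lambda>x. complex_of_real (\<integral>y. u (x - y) * f y \<partial>lborel))"
      by (simp del: of_real_mult flip: integral_complex_of_real)
    then show "integrable lborel (\<lambda>x. \<integral>y. u (x - y) * f y \<partial>lborel)"
      by (simp only: complex_of_real_integrable_eq)
    have "complex_of_real (\<integral>x. (\<integral>y. u (x - y) * f y \<partial>lborel) \<partial>lborel)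
       = (CLINT x|lborel. complex_of_real (\<integral>y. u (x - y) * f y \<partial>lborel) * 1)"
      by (simp only: integral_complex_of_real mult_1_right)
    also have "\<dots> = (CLINT y|lborel. CLINT x|lborel. complex_of_real (u x * f y) * 1)"
      by (rule integral_convolution[OF assms]) auto
    also have "\<dots> = 1"
      by (simp only: integral_complex_of_real mult_1_right integral_mult_left_zero u.total f.total mult_1_left of_real_1)
    finally show "(\<integral>x. (\<integral>y. u (x - y) * f y \<partial>lborel) \<partial>lborel) = 1"
      by (simp only: of_real_eq_1_iff)
  qed
qed

lemma char_convolution:
  assumes "bounded_density u B" "bounded_density f C"
  shows "char (density lborel (\<lambda>x. ennreal (\<integral>y. u (x - y) * f y \<partial>lborel))) v
    = char (density lborel (\<lambda>x. ennreal (u x))) v * char (density lborel (\<lambda>x. ennreal (f x))) v"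
proof -
  interpret u: bounded_density u B by fact
  interpret f: bounded_density f C by fact
  interpret c: bounded_density "\<lambda>x. \<integral>y. u (x - y) * f y \<partial>lborel" B
    by (rule bounded_density_convolution[OF assms])
  have "c.\<phi> v = (CLINT y|lborel. CLINT x|lborel. complex_of_real (u x * f y) * iexp (v * (x + y)))"
    unfolding c.char_eq by (rule integral_convolution[OF assms]) auto
  also have "\<dots> = (CLINT y|lborel. CLINT x|lborel. (complex_of_real (u x) * iexp (v * x)) * (complex_of_real (f y) * iexp (v * y)))"
    by (intro Bochner_Integration.integral_cong refl) (simp add: distrib_left exp_add)
  also have "\<dots> = u.\<phi> v * f.\<phi> v"
    unfolding u.char_eq f.char_eq by simp
  finally show ?thesis .
qed

text \<open>A convolution with an integrable function does not see null sets. So if \<open>u\<close> agrees almost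
everywhere with the inverse transform of its characteristic function, then Fubini's theorem gives
the inversion formula for the convolution of \<open>u\<close> and \<open>f\<close> at every point, wherever the jumps of
\<open>u\<close> and \<open>f\<close> are.\<close>

lemma convolution_eq_fourier_inverse:
  assumes "bounded_density u B" "bounded_density f C"
    and int: "integrable lborel (char (density lborel (\<lambda>x. ennreal (u x))))"
  shows "complex_of_real (\<integral>y. u (x - y) * f y \<partial>lborel) = fourier_inverse
      (\<lambda>v. char (density lborel (\<lambda>x. ennreal (u x))) v * char (density lborel (\<lambda>x. ennreal (f x))) v) x"
proof -
  interpret u: bounded_density u B by fact
  interpret f: bounded_density f C by fact
  have [measurable]: "f \<in> borel_measurable borel" "u \<in> borel_measurable borel" by (rule u.meas f.meas)+
  let ?H = "\<lambda>x. Re (fourier_inverse u.\<phi> x)"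
  \<comment> \<open>The inverse transform is real because \<open>\<phi> (- v)\<close> is the conjugate of \<open>\<phi> v\<close>.\<close>
  have real: "complex_of_real (?H x) = fourier_inverse u.\<phi> x" for x
  proof -
    have "cnj (fourier_inverse u.\<phi> x) = (CLINT v|lborel. cnj (iexp (- (v * x)) * u.\<phi> v)) / (2 * pi)"
      unfolding fourier_inverse_def
      by (simp only: complex_cnj_divide complex_cnj_complex_of_real Bochner_Integration.integral_cnj)
    also have "(CLINT v|lborel. cnj (iexp (- (v * x)) * u.\<phi> v)) = (CLINT v|lborel. iexp (v * x) * u.\<phi> (- v))"
      by (intro Bochner_Integration.integral_cong refl) (simp add: exp_cnj u.char_minus)
    also have "\<dots> = (CLINT v|lborel. iexp (- (v * x)) * u.\<phi> v)"
      using lborel_integral_real_affine[of "-1" "\<lambda>v. iexp (v * x) * u.\<phi> (- v)" 0] by simp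
    finally have "cnj (fourier_inverse u.\<phi> x) = fourier_inverse u.\<phi> x"
      unfolding fourier_inverse_def .
    then show ?thesis by (simp add: complex_eq_iff)
  qed
  have AE: "AE y in lborel. u (x - y) = ?H (x - y)"
  proof -
    have "AE y in distr lborel borel (\<lambda>y. x + (-1) * y). u y = ?H y"
    proof -
      have "lborel = density (distr lborel borel (\<lambda>y. x + (-1) * y)) (\<lambda>_. ennreal \<bar>-1\<bar>)"
        by (rule lborel_real_affine) simp
      then have "lborel = distr lborel borel (\<lambda>y. x + (-1) * y)"
        by (simp add: density_1)
      then have "distr lborel borel (\<lambda>y. x + (-1) * y) = lborel" by (rule sym)
      then show ?thesis by (simp only: u.density_eq_fourier_inverse_AE[OF int])
    qed
    then show ?thesis by (subst (asm) AE_distr_iff) auto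
  qed
  have "(\<integral>y. u (x - y) * f y \<partial>lborel) = (\<integral>y. ?H (x - y) * f y \<partial>lborel)"
    using AE by (intro integral_cong_AE) auto
  then have "complex_of_real (\<integral>y. u (x - y) * f y \<partial>lborel) = (CLINT y|lborel. fourier_inverse u.\<phi> (x - y) * complex_of_real (f y))"
    by (simp only: integral_complex_of_real[symmetric] of_real_mult real)
  also have "\<dots> = (CLINT y|lborel. CLINT v|lborel. iexp (- (v * (x - y))) * u.\<phi> v * complex_of_real (f y)) / (2 * pi)"
    unfolding fourier_inverse_def by simp
  also have "(CLINT y|lborel. CLINT v|lborel. iexp (- (v * (x - y))) * u.\<phi> v * complex_of_real (f y))
     = (CLINT v|lborel. CLINT y|lborel. iexp (- (v * (x - y))) * u.\<phi> v * complex_of_real (f y))"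
  proof -
    have "integrable (lborel \<Otimes>\<^sub>M lborel) (\<lambda>(v,y). iexp (- (v * (x - y))) * u.\<phi> v * complex_of_real (f y))"
    proof (rule lborel_pair.Fubini_integrable)
      have "(\<integral>y. cmod (case (v, y) of (v, y) \<Rightarrow> iexp (- (v * (x - y))) * u.\<phi> v * complex_of_real (f y)) \<partial>lborel) = norm (u.\<phi> v)" for v
        by (simp add: norm_mult f.nonneg f.total)
      then show "integrable lborel (\<lambda>v. \<integral>y. cmod (case (v, y) of (v, y) \<Rightarrow> iexp (- (v * (x - y))) * u.\<phi> v * complex_of_real (f y)) \<partial>lborel)"
        using integrable_norm[OF int] by simp
      show "AE v in lborel. integrable lborel (\<lambda>y. case (v, y) of (v, y) \<Rightarrow> iexp (- (v * (x - y))) * u.\<phi> v * complex_of_real (f y))"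
      proof (rule AE_I2)
        fix v
        show "integrable lborel (\<lambda>y. case (v, y) of (v, y) \<Rightarrow> iexp (- (v * (x - y))) * u.\<phi> v * complex_of_real (f y))"
          by (rule Bochner_Integration.integrable_bound[OF f.integrable_density])
            (auto simp: norm_mult f.nonneg u.norm_char_le intro!: mult_left_le_one_le)
      qed
    qed measurable
    from lborel_pair.Fubini_integral[OF this] show ?thesis by simp
  qed
  also have "\<dots> = (CLINT v|lborel. iexp (- (v * x)) * (u.\<phi> v * f.\<phi> v))"
  proof (intro Bochner_Integration.integral_cong refl)
    fix v
    have "(CLINT y|lborel. iexp (- (v * (x - y))) * u.\<phi> v * complex_of_real (f y))
      = (CLINT y|lborel. iexp (- (v * x)) * u.\<phi> v * (complex_of_real (f y) * iexp (v * y)))"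
      by (intro Bochner_Integration.integral_cong refl) (simp add: right_diff_distrib exp_diff exp_minus field_simps)
    also have "\<dots> = iexp (- (v * x)) * u.\<phi> v * f.\<phi> v"
      unfolding f.char_eq by (rule integral_mult_right_zero)
    finally show "(CLINT y|lborel. iexp (- (v * (x - y))) * u.\<phi> v * complex_of_real (f y)) = iexp (- (v * x)) * (u.\<phi> v * f.\<phi> v)"
      by (simp add: mult.assoc)
  qed
  finally show ?thesis unfolding fourier_inverse_def .
qed

context bounded_density
begin

lemma conv_power_Suc: "n \<ge> 1 \<Longrightarrow> conv_power (Suc n) f = (\<lambda>x. \<integral>y. conv_power n f (x - y) * f y \<partial>lborel)"
  by (cases n) auto

lemma conv_power_bounded_density:
  assumes "n \<ge> 1"
  shows "bounded_density (conv_power n f) C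
    \<and> char (density lborel (\<lambda>x. ennreal (conv_power n f x))) = (\<lambda>v. \<phi> v ^ n)"
  using assms
proof (induction n rule: dec_induct)
  case base
  show ?case using bounded_density_axioms by simp
next
  case (step n)
  have ax: "bounded_density (conv_power n f) C" using step by simp
  show ?case
    unfolding conv_power_Suc[OF step(1)]
    using bounded_density_convolution[OF ax bounded_density_axioms]
      char_convolution[OF ax bounded_density_axioms] step(3)
    by (auto simp: fun_eq_iff mult.commute)
qed

lemma integrable_char_power:
  assumes "n \<ge> 2"
  shows "integrable lborel (\<lambda>v. \<phi> v ^ n)"
proof (rule Bochner_Integration.integrable_bound[OF square_integrable_char(1)])
  have "norm (\<phi> v) ^ n \<le> norm (\<phi> v) ^ 2" for v
    by (rule power_decreasing[OF assms]) (auto simp: norm_char_le)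
  then show "AE v in lborel. norm (\<phi> v ^ n) \<le> norm ((norm (\<phi> v))\<^sup>2)"
    by (simp add: norm_power)
qed measurable

text \<open>Two factors make \<open>\<phi> ^ (n - 1)\<close> integrable, and the third convolution turns the almost-everywhere
formula into one that holds at each point; hence \<open>n \<ge> 3\<close>.\<close>

lemma conv_power_eq_fourier_inverse:
  assumes "n \<ge> 3"
  shows "complex_of_real (conv_power n f x) = fourier_inverse (\<lambda>v. \<phi> v ^ n) x"
proof -
  obtain m where m: "n = Suc m" "m \<ge> 2" using assms by (cases n) auto
  have ax: "bounded_density (conv_power m f) C"
    and ch: "char (density lborel (\<lambda>x. ennreal (conv_power m f x))) = (\<lambda>v. \<phi> v ^ m)"
    using conv_power_bounded_density[of m] m by auto
  show ?thesis
    using convolution_eq_fourier_inverse[OF ax bounded_density_axioms, of x] m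
    by (simp add: ch integrable_char_power conv_power_Suc mult.commute)
qed

end

section \<open>Standardized densities and their characteristic functions near zero\<close>

text \<open>One constant bounds both the density and its fourth moment. It is at least 1, since the fourth
moment is at least the square of the second.\<close>

locale standardized_density = bounded_density +
  assumes integrable_moment4: "integrable lborel (\<lambda>x. f x * x ^ 4)"
    and mean: "(\<integral>x. f x * x \<partial>lborel) = 0"
    and variance: "(\<integral>x. f x * x\<^sup>2 \<partial>lborel) = 1"
    and moment4_le: "(\<integral>x. f x * x ^ 4 \<partial>lborel) \<le> C"
begin

definition skewness :: real where "skewness = (\<integral>x. f x * x ^ 3 \<partial>lborel)"

lemma integrable_moment:
  assumes "k \<le> 4" shows "integrable lborel (\<lambda>x. f x * x ^ k)"
proof (rule Bochner_Integration.integrable_bound)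
  show "integrable lborel (\<lambda>x. f x + f x * x ^ 4)"
    by (intro Bochner_Integration.integrable_add integrable_density integrable_moment4)
  have "\<bar>x\<bar> ^ k \<le> 1 + x ^ 4" for x :: real
  proof (cases "\<bar>x\<bar> \<le> 1")
    case True
    then have "\<bar>x\<bar> ^ k \<le> 1" by (simp add: power_le_one)
    then show ?thesis by (rule order_trans) simp
  next
    case False
    then have "\<bar>x\<bar> ^ k \<le> \<bar>x\<bar> ^ 4" using assms by (intro power_increasing) auto
    then show ?thesis by simp
  qed
  then have "f x * \<bar>x\<bar> ^ k \<le> f x * (1 + x ^ 4)" for x
    by (intro mult_left_mono nonneg) auto
  then have "norm (f x * x ^ k) \<le> norm (f x + f x * x ^ 4)" for x
    using nonneg[of x] by (simp add: abs_mult power_abs algebra_simps)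
  then show "AE x in lborel. norm (f x * x ^ k) \<le> norm (f x + f x * x ^ 4)" by simp
qed measurable

lemma moment_D:
  shows "expectation (\<lambda>x. x ^ k) = (\<integral>x. f x * x ^ k \<partial>lborel)"
    and "k \<le> 4 \<Longrightarrow> integrable D (\<lambda>x. x ^ k)"
  using integrable_moment[of k]
  by (auto simp: integral_density Bochner_Integration.integrable_density nonneg)

lemma bound_ge_1: "1 \<le> C"
proof -
  have "0 \<le> (\<integral>x. f x * x ^ 4 - 2 * (f x * x\<^sup>2) + f x \<partial>lborel)"
  proof (intro integral_nonneg_AE AE_I2)
    fix x
    have "f x * x ^ 4 - 2 * (f x * x\<^sup>2) + f x = f x * (x\<^sup>2 - 1)\<^sup>2"
      by (simp add: power2_diff algebra_simps flip: power_mult)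
    then show "0 \<le> f x * x ^ 4 - 2 * (f x * x\<^sup>2) + f x" using nonneg by simp
  qed
  also have "\<dots> = (\<integral>x. f x * x ^ 4 \<partial>lborel) - 2 * (\<integral>x. f x * x\<^sup>2 \<partial>lborel) + 1"
    using integrable_moment[of 4] integrable_moment[of 2] integrable_density total by simp
  finally show ?thesis using moment4_le variance by simp
qed

lemma abs_skewness_le: "\<bar>skewness\<bar> \<le> C"
proof -
  have "\<bar>skewness\<bar> \<le> (\<integral>x. \<bar>f x * x ^ 3\<bar> \<partial>lborel)"
    unfolding skewness_def by (rule integral_abs_bound)
  also have "\<dots> \<le> (\<integral>x. (f x * x\<^sup>2 + f x * x ^ 4) / 2 \<partial>lborel)"
  proof (rule integral_mono)
    show "integrable lborel (\<lambda>x. \<bar>f x * x ^ 3\<bar>)" using integrable_moment[of 3] by simp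
    show "integrable lborel (\<lambda>x. (f x * x\<^sup>2 + f x * x ^ 4) / 2)"
      using integrable_moment[of 4] integrable_moment[of 2] by simp
    fix x :: real
    have "2 * (\<bar>x\<bar> * \<bar>x\<bar>\<^sup>2) \<le> \<bar>x\<bar>\<^sup>2 + (\<bar>x\<bar>\<^sup>2)\<^sup>2"
      using sum_squares_bound[of "\<bar>x\<bar>" "\<bar>x\<bar>\<^sup>2"] by simp
    then have "\<bar>x\<bar> ^ 3 \<le> (x\<^sup>2 + x ^ 4) / 2"
      by (simp add: power3_eq_cube power2_eq_square power4_eq_xxxx)
    from mult_left_mono[OF this nonneg[of x]]
    show "\<bar>f x * x ^ 3\<bar> \<le> (f x * x\<^sup>2 + f x * x ^ 4) / 2"
      by (simp add: abs_mult power_abs nonneg algebra_simps)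
  qed
  also have "\<dots> = (1 + (\<integral>x. f x * x ^ 4 \<partial>lborel)) / 2"
    using integrable_moment[of 4] integrable_moment[of 2] variance by simp
  also have "\<dots> \<le> C" using moment4_le bound_ge_1 by simp
  finally show ?thesis .
qed

lemma char_taylor:
  "norm (\<phi> w - (1 + (- (w\<^sup>2 / 2) + (\<i> * w) ^ 3 * skewness / 6))) \<le> C * w ^ 4 / 24"
proof -
  let ?m = "expectation (\<lambda>x. min (2 * \<bar>x\<bar> ^ 3 * Suc 3) (\<bar>w\<bar> * \<bar>x\<bar> ^ Suc 3))"
  have sum3: "(\<Sum>k\<le>3. ((\<i> * w) ^ k / fact k) * m k) = m 0 + \<i> * w * m 1 - w\<^sup>2 / 2 * m 2 + (\<i> * w) ^ 3 / 6 * m 3"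
    for m :: "nat \<Rightarrow> complex"
    by (simp add: numeral_eq_Suc power_mult_distrib fact_numeral mult.left_commute mult.assoc)
  have "(\<Sum>k\<le>3. ((\<i> * w) ^ k / fact k) * complex_of_real (expectation (\<lambda>x. x ^ k)))
      = 1 + (- (w\<^sup>2 / 2) + (\<i> * w) ^ 3 * skewness / 6)"
    unfolding sum3 moment_D(1) by (simp add: total mean variance skewness_def)
  then have "norm (\<phi> w - (1 + (- (w\<^sup>2 / 2) + (\<i> * w) ^ 3 * skewness / 6))) \<le> \<bar>w\<bar> ^ 3 / fact (Suc 3) * ?m"
    using char_approx2[OF moment_D(2), of 3 w] by simp
  also have "?m \<le> expectation (\<lambda>x. \<bar>w\<bar> * x ^ 4)"
  proof (rule integral_mono)
    show i: "integrable D (\<lambda>x. \<bar>w\<bar> * x ^ 4)" using moment_D(2)[of 4] by simp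
    show "integrable D (\<lambda>x. min (2 * \<bar>x\<bar> ^ 3 * Suc 3) (\<bar>w\<bar> * \<bar>x\<bar> ^ Suc 3))"
      by (rule Bochner_Integration.integrable_bound[OF i]) (auto simp: abs_mult eval_nat_numeral)
  qed (auto simp: eval_nat_numeral)
  also have "expectation (\<lambda>x. \<bar>w\<bar> * x ^ 4) \<le> \<bar>w\<bar> * C"
    using moment4_le by (simp add: moment_D(1) mult_left_mono)
  finally have "norm (\<phi> w - (1 + (- (w\<^sup>2 / 2) + (\<i> * w) ^ 3 * skewness / 6))) \<le> \<bar>w\<bar> ^ 3 / fact (Suc 3) * (\<bar>w\<bar> * C)"
    by (simp add: mult_left_mono divide_right_mono)
  also have "\<bar>w\<bar> ^ 3 / fact (Suc 3) * (\<bar>w\<bar> * C) = C * w ^ 4 / 24"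
    by (simp add: fact_numeral eval_nat_numeral)
  finally show ?thesis by simp
qed

lemma norm_exp_minus_1_minus_le:
  fixes z :: complex
  assumes "norm z \<le> 1"
  shows "norm (exp z - 1 - z) \<le> 3 * (norm z)\<^sup>2"
proof -
  have "norm (exp z - 1 - z) \<le> exp (norm z) * (norm z)\<^sup>2"
    using Taylor_exp_field[of z 1] by (simp add: power2_eq_square algebra_simps)
  also have "exp (norm z) \<le> exp 1" using assms by simp
  also have "\<dots> \<le> (3::real)" by (rule exp_le)
  finally show ?thesis by (simp add: mult_right_mono)
qed

text \<open>The Fourier transform of the normal density with its first Edgeworth correction.\<close>

definition edgeworth_char :: "nat \<Rightarrow> real \<Rightarrow> complex" where
  "edgeworth_char n u = complex_of_real (exp (- (u\<^sup>2 / 2))) * (1 + (\<i> * u) ^ 3 * complex_of_real (skewness / (6 * sqrt (real n))))"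

text \<open>The factor \<open>n r ^ (n - 1)\<close> is what makes a fourth-order approximation of \<open>\<phi>\<close> sufficient: it costs
a factor \<open>n\<close> and preserves the Gaussian decay of all but one of the factors.\<close>

lemma norm_power_diff_le:
  fixes a b :: complex
  assumes "norm a \<le> r" "norm b \<le> r"
  shows "norm (a ^ n - b ^ n) \<le> real n * r ^ (n - 1) * norm (a - b)"
proof (cases n)
  case (Suc m)
  have r: "0 \<le> r" using assms(1) norm_ge_zero order_trans by blast
  have eq: "norm (a ^ n - b ^ n) = norm (a - b) * norm (\<Sum>p<Suc m. a ^ p * b ^ (m - p))"
    unfolding Suc by (subst diff_power_eq_sum) (simp add: norm_mult)
  have "norm (\<Sum>p<Suc m. a ^ p * b ^ (m - p)) \<le> (\<Sum>p<Suc m. r ^ m)"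
  proof (rule sum_norm_le)
    fix p assume p: "p \<in> {..<Suc m}"
    have "norm (a ^ p * b ^ (m - p)) \<le> r ^ p * r ^ (m - p)"
      unfolding norm_mult norm_power using assms
      by (intro mult_mono power_mono) (auto simp: r)
    also have "\<dots> = r ^ m" using p by (simp flip: power_add)
    finally show "norm (a ^ p * b ^ (m - p)) \<le> r ^ m" .
  qed
  then have "norm (a - b) * norm (\<Sum>p<Suc m. a ^ p * b ^ (m - p)) \<le> norm (a - b) * (\<Sum>p<Suc m. r ^ m)"
    by (intro mult_left_mono) auto
  then show ?thesis unfolding eq using Suc by (simp add: ac_simps)
qed simp

text \<open>The comparison function is an exponential, because its \<open>n\<close>-th power is explicit. Its cubic term is
purely imaginary, so that its modulus is exactly \<open>exp (- w\<^sup>2 / 2)\<close>. The radius \<open>1 / C\<close> is small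
enough for the third and fourth order terms to use up at most half of \<open>w\<^sup>2 / 2\<close>.\<close>

lemma char_near_zero:
  assumes w: "\<bar>w\<bar> \<le> 1 / C"
  shows "norm (\<phi> w) \<le> exp (- (w\<^sup>2 / 4))"
    and "norm (\<phi> w - exp (complex_of_real (- (w\<^sup>2 / 2)) + (\<i> * w) ^ 3 * skewness / 6)) \<le> 4 * C * w ^ 4"
proof -
  define z where "z = complex_of_real (- (w\<^sup>2 / 2)) + (\<i> * w) ^ 3 * skewness / 6"
  have Cw: "C * \<bar>w\<bar> \<le> 1" using w bound_pos by (simp add: field_simps)
  have w1: "\<bar>w\<bar> \<le> 1" using bound_ge_1 by (intro order_trans[OF w]) simp
  have w2: "w\<^sup>2 \<le> 1" using w1 by (simp add: abs_square_le_1)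
  have w3: "C * \<bar>w\<bar> ^ 3 \<le> w\<^sup>2"
    using mult_right_mono[OF Cw, of "\<bar>w\<bar>\<^sup>2"] by (simp add: power3_eq_cube power2_eq_square mult.assoc)
  have w4: "C * w ^ 4 \<le> w\<^sup>2"
  proof -
    have "C * w ^ 4 = (C * \<bar>w\<bar> ^ 3) * \<bar>w\<bar>"
      by (simp add: eval_nat_numeral)
    also have "\<dots> \<le> w\<^sup>2 * 1" by (intro mult_mono w3 w1) auto
    finally show ?thesis by simp
  qed
  have c3: "norm ((\<i> * w) ^ 3 * skewness / 6) \<le> w\<^sup>2 / 6"
  proof -
    have "norm ((\<i> * w) ^ 3 * skewness / 6) = \<bar>w\<bar> ^ 3 * \<bar>skewness\<bar> / 6"
      by (simp add: norm_mult norm_power norm_divide)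
    also have "\<dots> \<le> \<bar>w\<bar> ^ 3 * C / 6" by (intro divide_right_mono mult_left_mono abs_skewness_le) auto
    finally show ?thesis using w3 by (simp add: mult.commute)
  qed
  have nz: "norm z \<le> w\<^sup>2"
  proof -
    have "norm (complex_of_real (- (w\<^sup>2 / 2))) = w\<^sup>2 / 2"
      by (simp only: norm_of_real) simp
    then have "norm z \<le> w\<^sup>2 / 2 + w\<^sup>2 / 6"
      using norm_triangle_ineq[of "complex_of_real (- (w\<^sup>2 / 2))" "(\<i> * w) ^ 3 * skewness / 6"] c3
      unfolding z_def by linarith
    also have "\<dots> \<le> w\<^sup>2" by simp
    finally show ?thesis .
  qed
  have taylor: "norm (\<phi> w - (1 + z)) \<le> C * w ^ 4 / 24"
    using char_taylor[of w] by (simp add: z_def)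
  have "norm (\<phi> w) = norm ((\<phi> w - (1 + z)) + ((1 + complex_of_real (- (w\<^sup>2 / 2))) + (\<i> * w) ^ 3 * skewness / 6))"
    by (simp add: z_def)
  also have "\<dots> \<le> norm (\<phi> w - (1 + z)) + (norm (1 + complex_of_real (- (w\<^sup>2 / 2))) + norm ((\<i> * w) ^ 3 * skewness / 6))"
    by (intro order_trans[OF norm_triangle_ineq] add_left_mono norm_triangle_ineq)
  also have "norm (1 + complex_of_real (- (w\<^sup>2 / 2))) = 1 - w\<^sup>2 / 2"
  proof -
    have "1 + complex_of_real (- (w\<^sup>2 / 2)) = complex_of_real (1 - w\<^sup>2 / 2)" by simp
    then show ?thesis using w2 by (simp only: norm_of_real)
  qed
  finally have "norm (\<phi> w) \<le> 1 - w\<^sup>2 / 4"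
    using taylor c3 w4 zero_le_power2[of w] by linarith
  also have "\<dots> \<le> exp (- (w\<^sup>2 / 4))"
    using exp_ge_add_one_self[of "- (w\<^sup>2 / 4)"] by simp
  finally show "norm (\<phi> w) \<le> exp (- (w\<^sup>2 / 4))" .
  have "norm (\<phi> w - exp z) \<le> norm (\<phi> w - (1 + z)) + norm (exp z - 1 - z)"
    using norm_triangle_ineq4[of "\<phi> w - (1 + z)" "exp z - 1 - z"] by (simp add: algebra_simps)
  also have "norm (exp z - 1 - z) \<le> 3 * (norm z)\<^sup>2"
    using nz w2 by (intro norm_exp_minus_1_minus_le) simp
  also have "(norm z)\<^sup>2 \<le> w ^ 4"
    using power_mono[OF nz, of 2] by (simp flip: power_mult)
  finally have "norm (\<phi> w - exp z) \<le> C * w ^ 4 / 24 + 3 * w ^ 4"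
    using taylor by simp
  moreover have "1 * w ^ 4 \<le> C * w ^ 4"
    using bound_ge_1 by (intro mult_right_mono) auto
  moreover have "0 \<le> w ^ 4" by simp
  ultimately have "norm (\<phi> w - exp z) \<le> 4 * C * w ^ 4" by linarith
  then show "norm (\<phi> w - exp (complex_of_real (- (w\<^sup>2 / 2)) + (\<i> * w) ^ 3 * skewness / 6)) \<le> 4 * C * w ^ 4"
    by (simp add: z_def)
qed

text \<open>Two steps: replace \<open>\<phi> (w)\<close>, where \<open>w = u / sqrt n\<close>, by \<open>b = exp (- w\<^sup>2 / 2 + \<kappa> (i w)\<^sup>3 / 6)\<close>, with
error \<open>O(w\<^sup>4)\<close> per factor; then linearize \<open>b ^ n = exp (- u\<^sup>2 / 2) exp (i \<theta>)\<close> in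
\<open>\<theta> = - \<kappa> u\<^sup>3 / (6 sqrt n)\<close>, with error \<open>\<theta>\<^sup>2 / 2\<close>. Both errors are of order \<open>1 / n\<close>.\<close>

lemma char_power_near_zero:
  assumes n: "n \<ge> 1" and u: "\<bar>u\<bar> \<le> sqrt n / C"
  shows "norm (\<phi> (u / sqrt n) ^ n - edgeworth_char n u) \<le> (8 * C * u ^ 4 + C\<^sup>2 * u ^ 6) * exp (- (u\<^sup>2 / 4)) / n"
proof -
  define w where "w = u / sqrt n"
  define b where "b = exp (complex_of_real (- (w\<^sup>2 / 2)) + (\<i> * w) ^ 3 * skewness / 6)"
  define \<theta> where "\<theta> = - (u ^ 3 * skewness / (6 * sqrt n))"
  have sn: "sqrt (real n) > 0" using n by simp
  have w: "\<bar>w\<bar> \<le> 1 / C"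
    unfolding w_def using u sn by (simp add: field_simps)
  have uw: "u = w * sqrt n" using sn by (simp add: w_def)
  have nw2: "n * w\<^sup>2 = u\<^sup>2" using n by (simp add: uw power_mult_distrib)
  have i3: "(\<i> * complex_of_real y) ^ 3 = - \<i> * complex_of_real (y ^ 3)" for y
    by (simp add: power_mult_distrib eval_nat_numeral ac_simps)
  have bn: "norm b = exp (- (w\<^sup>2 / 2))"
    unfolding b_def i3 by simp
  have 1: "norm (\<phi> w ^ n - b ^ n) \<le> real n * exp (- (w\<^sup>2 / 4)) ^ (n - 1) * (4 * C * w ^ 4)"
  proof -
    have "norm (\<phi> w ^ n - b ^ n) \<le> real n * exp (- (w\<^sup>2 / 4)) ^ (n - 1) * norm (\<phi> w - b)"
      by (rule norm_power_diff_le) (use char_near_zero(1)[OF w] bn in auto)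
    also have "\<dots> \<le> real n * exp (- (w\<^sup>2 / 4)) ^ (n - 1) * (4 * C * w ^ 4)"
      using char_near_zero(2)[OF w] unfolding b_def by (intro mult_left_mono) auto
    finally show ?thesis .
  qed
  have 2: "exp (- (w\<^sup>2 / 4)) ^ (n - 1) \<le> 2 * exp (- (u\<^sup>2 / 4))"
  proof -
    \<comment> \<open>The power \<open>n - 1\<close> lacks one factor of the Gaussian decay, which is at least \<open>1 / 2\<close>.\<close>
    obtain m where m: "n = Suc m" using n by (cases n) auto
    have "exp (- (w\<^sup>2 / 4)) ^ (n - 1) = exp (w\<^sup>2 / 4) * exp (- (u\<^sup>2 / 4))"
      by (simp add: m flip: exp_of_nat_mult exp_add nw2) (simp add: field_simps)
    also have "exp (w\<^sup>2 / 4) \<le> 2"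
    proof -
      have "\<bar>w\<bar> \<le> 1" using bound_ge_1 by (intro order_trans[OF w]) simp
      then have "w\<^sup>2 \<le> 1" by (simp add: abs_square_le_1)
      then have "exp (w\<^sup>2 / 4) \<le> exp (1 / 4)" by simp
      also have "\<dots> \<le> 2" using exp_bound[of "1/4"] by (simp add: power2_eq_square)
      finally show ?thesis .
    qed
    finally show ?thesis by simp
  qed
  have w4: "real n * w ^ 4 = u ^ 4 / n"
  proof -
    have "sqrt (real n) ^ 4 = (real n)\<^sup>2" using power_mult[of "sqrt (real n)" 2 2] by simp
    then show ?thesis using n by (simp add: uw power_mult_distrib power2_eq_square)
  qed
  have "norm (\<phi> w ^ n - b ^ n) \<le> exp (- (w\<^sup>2 / 4)) ^ (n - 1) * (4 * C * (real n * w ^ 4))"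
    using 1 by (simp add: ac_simps)
  also have "\<dots> \<le> (2 * exp (- (u\<^sup>2 / 4))) * (4 * C * (real n * w ^ 4))"
    using bound_pos by (intro mult_right_mono 2) auto
  also have "\<dots> = 8 * C * u ^ 4 * exp (- (u\<^sup>2 / 4)) / n"
    unfolding w4 by simp
  finally have A: "norm (\<phi> w ^ n - b ^ n) \<le> 8 * C * u ^ 4 * exp (- (u\<^sup>2 / 4)) / n" .
  \<comment> \<open>Here the skewness enters: the cubic terms of the \<open>n\<close> factors add up to the phase \<open>\<theta>\<close>.\<close>
  have bpow: "b ^ n = complex_of_real (exp (- (u\<^sup>2 / 2))) * iexp \<theta>"
  proof -
    have e: "real n * w ^ 3 = u ^ 3 / sqrt n"
      using n by (simp add: uw power_mult_distrib eval_nat_numeral)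
    have "b ^ n = exp (complex_of_real (real n * (- (w\<^sup>2 / 2))) + \<i> * complex_of_real (- (real n * w ^ 3 * skewness / 6)))"
      unfolding b_def i3 by (subst exp_of_nat_mult[symmetric]) (simp add: algebra_simps)
    also have "real n * (- (w\<^sup>2 / 2)) = - (u\<^sup>2 / 2)" using nw2 by simp
    also have "- (real n * w ^ 3 * skewness / 6) = \<theta>" unfolding e \<theta>_def by simp
    finally show ?thesis by (simp only: exp_add exp_of_real)
  qed
  have edge: "edgeworth_char n u = complex_of_real (exp (- (u\<^sup>2 / 2))) * (1 + \<i> * \<theta>)"
    unfolding edgeworth_char_def i3 \<theta>_def by simp
  have "norm (b ^ n - edgeworth_char n u) = exp (- (u\<^sup>2 / 2)) * norm (iexp \<theta> - (1 + \<i> * \<theta>))"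
    unfolding bpow edge right_diff_distrib[symmetric] norm_mult norm_of_real by simp
  also have "\<dots> \<le> exp (- (u\<^sup>2 / 4)) * (C\<^sup>2 * u ^ 6 / n)"
  proof (rule mult_mono)
    have "norm (iexp \<theta> - (1 + \<i> * \<theta>)) \<le> \<theta>\<^sup>2 / 2"
      using iexp_approx1[of \<theta> 1] by (simp add: eval_nat_numeral)
    also have "\<theta>\<^sup>2 = skewness\<^sup>2 * u ^ 6 / (36 * n)"
      unfolding \<theta>_def by (simp add: power_divide power_mult_distrib flip: power_mult)
    also have "skewness\<^sup>2 * u ^ 6 / (36 * n) / 2 \<le> C\<^sup>2 * u ^ 6 / n"
    proof -
      have "skewness\<^sup>2 \<le> C\<^sup>2" using abs_skewness_le by (simp add: abs_le_square_iff[symmetric])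
      then have "skewness\<^sup>2 * u ^ 6 \<le> C\<^sup>2 * u ^ 6" by (intro mult_right_mono) auto
      moreover have "skewness\<^sup>2 * u ^ 6 / 72 \<le> skewness\<^sup>2 * u ^ 6" by simp
      ultimately have "skewness\<^sup>2 * u ^ 6 / 72 \<le> C\<^sup>2 * u ^ 6" by linarith
      then show ?thesis using n by (simp add: field_simps)
    qed
    finally show "norm (iexp \<theta> - (1 + \<i> * \<theta>)) \<le> C\<^sup>2 * u ^ 6 / n" .
  qed auto
  finally have B: "norm (b ^ n - edgeworth_char n u) \<le> exp (- (u\<^sup>2 / 4)) * (C\<^sup>2 * u ^ 6 / n)" .
  have "norm (\<phi> w ^ n - edgeworth_char n u) \<le> norm (\<phi> w ^ n - b ^ n) + norm (b ^ n - edgeworth_char n u)"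
    using norm_triangle_ineq[of "\<phi> w ^ n - b ^ n" "b ^ n - edgeworth_char n u"] by simp
  also have "\<dots> \<le> 8 * C * u ^ 4 * exp (- (u\<^sup>2 / 4)) / n + exp (- (u\<^sup>2 / 4)) * (C\<^sup>2 * u ^ 6 / n)"
    by (intro add_mono A B)
  also have "\<dots> = (8 * C * u ^ 4 + C\<^sup>2 * u ^ 6) * exp (- (u\<^sup>2 / 4)) / n"
    by (simp add: algebra_simps add_divide_distrib)
  finally show ?thesis by (simp add: w_def)
qed

end

section \<open>Fourier inversion of the Edgeworth polynomial\<close>

lemma iexp_increment: "norm (iexp (h * v) - 1 - \<i> * (h * v)) \<le> h\<^sup>2 * v\<^sup>2 / 2"
  using iexp_approx1[of "h * v" 1] by (simp add: power_mult_distrib algebra_simps eval_nat_numeral)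

lemma char_moment_has_derivative:
  assumes "\<And>j. integrable M (\<lambda>v. v ^ j)" "sets M = sets borel"
  shows "((\<lambda>x. CLINT v|M. complex_of_real (v ^ k) * iexp (x * v)) has_vector_derivative \<i> * (CLINT v|M. complex_of_real (v ^ Suc k) * iexp (x * v))) (at x)"
proof -
  let ?G = "\<lambda>j x. CLINT v|M. complex_of_real (v ^ j) * iexp (x * v)"
  have [measurable_cong]: "sets M = sets borel" by fact
  have int: "integrable M (\<lambda>v. complex_of_real (v ^ j) * iexp (x * v))" for j x
    by (rule Bochner_Integration.integrable_bound[OF assms(1)[of j]]) (auto simp: norm_mult norm_power power_abs)
  define B where "B = (\<integral>v. \<bar>v ^ Suc (Suc k)\<bar> \<partial>M)"
  have bound: "norm (?G k y - ?G k x - (y - x) *\<^sub>R (\<i> * ?G (Suc k) x)) \<le> B * norm (y - x) * norm (y - x)" for y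
  proof -
    define h where "h = y - x"
    have "?G k y - ?G k x - h *\<^sub>R (\<i> * ?G (Suc k) x)
        = (CLINT v|M. complex_of_real (v ^ k) * iexp (y * v) - complex_of_real (v ^ k) * iexp (x * v)
            - (\<i> * h) * (complex_of_real (v ^ Suc k) * iexp (x * v)))"
      using int[of k y] int[of k x] int[of "Suc k" x]
      by (simp add: scaleR_conv_of_real mult.assoc mult.left_commute del: power_Suc)
    also have "\<dots> = (CLINT v|M. complex_of_real (v ^ k) * iexp (x * v) * (iexp (h * v) - 1 - \<i> * (h * v)))"
    proof (rule Bochner_Integration.integral_cong[OF refl])
      fix v
      have "iexp (y * v) = iexp (x * v) * iexp (h * v)"
        by (simp add: h_def algebra_simps flip: exp_add)
      then show "complex_of_real (v ^ k) * iexp (y * v) - complex_of_real (v ^ k) * iexp (x * v)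
            - (\<i> * h) * (complex_of_real (v ^ Suc k) * iexp (x * v))
         = complex_of_real (v ^ k) * iexp (x * v) * (iexp (h * v) - 1 - \<i> * (h * v))"
        by (simp add: algebra_simps)
    qed
    finally have eq: "?G k y - ?G k x - h *\<^sub>R (\<i> * ?G (Suc k) x)
        = (CLINT v|M. complex_of_real (v ^ k) * iexp (x * v) * (iexp (h * v) - 1 - \<i> * (h * v)))" .
    have i2: "integrable M (\<lambda>v. h\<^sup>2 * \<bar>v ^ Suc (Suc k)\<bar>)"
      using assms(1)[of "Suc (Suc k)"] by (intro integrable_mult_right) (rule integrable_abs)
    have pt: "norm (complex_of_real (v ^ k) * iexp (x * v) * (iexp (h * v) - 1 - \<i> * (h * v))) \<le> h\<^sup>2 * \<bar>v ^ Suc (Suc k)\<bar>" for v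
    proof -
      have "norm (complex_of_real (v ^ k) * iexp (x * v) * (iexp (h * v) - 1 - \<i> * (h * v)))
          = \<bar>v\<bar> ^ k * norm (iexp (h * v) - 1 - \<i> * (h * v))"
        by (simp add: norm_mult norm_power del: of_real_mult)
      also have "\<dots> \<le> \<bar>v\<bar> ^ k * (h\<^sup>2 * v\<^sup>2)"
        by (intro mult_left_mono order_trans[OF iexp_increment]) auto
      finally show ?thesis by (simp add: abs_mult power_abs power2_eq_square ac_simps)
    qed
    have "norm (?G k y - ?G k x - h *\<^sub>R (\<i> * ?G (Suc k) x)) \<le> (\<integral>v. h\<^sup>2 * \<bar>v ^ Suc (Suc k)\<bar> \<partial>M)"
      unfolding eq
    proof (rule Bochner_Integration.integral_norm_bound_integral[OF _ i2 pt])
      show "integrable M (\<lambda>v. complex_of_real (v ^ k) * iexp (x * v) * (iexp (h * v) - 1 - \<i> * (h * v)))"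
        by (rule Bochner_Integration.integrable_bound[OF i2])
          (measurable, intro AE_I2 order_trans[OF pt], simp)
    qed
    also have "\<dots> = B * norm h * norm h" unfolding B_def by (simp add: power2_eq_square)
    finally show ?thesis by (simp add: h_def)
  qed
  show ?thesis
    unfolding has_vector_derivative_def has_derivative_iff_norm
  proof (intro conjI)
    show "bounded_linear (\<lambda>h. h *\<^sub>R (\<i> * ?G (Suc k) x))" by (rule bounded_linear_scaleR_left)
    have "((\<lambda>y. B * norm (y - x)) \<longlongrightarrow> B * norm (x - x)) (at x)"
      by (intro tendsto_intros)
    then have lim: "((\<lambda>y. B * norm (y - x)) \<longlongrightarrow> 0) (at x)" by simp
    show "((\<lambda>y. norm (?G k y - ?G k x - (y - x) *\<^sub>R (\<i> * ?G (Suc k) x)) / norm (y - x)) \<longlongrightarrow> 0) (at x)"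
    proof (rule tendsto_sandwich[OF _ _ tendsto_const lim])
      show "\<forall>\<^sub>F y in at x. norm (?G k y - ?G k x - (y - x) *\<^sub>R (\<i> * ?G (Suc k) x)) / norm (y - x) \<le> B * norm (y - x)"
        unfolding eventually_at_filter
        by (intro always_eventually allI impI) (use bound in \<open>simp add: divide_le_eq\<close>)
    qed simp
  qed
qed

text \<open>Each differentiation of \<open>exp (- x\<^sup>2 / 2)\<close>, the characteristic function of the normal distribution,
brings down a factor \<open>i v\<close> under the integral sign.\<close>

lemma gaussian_third_moment_char:
  "(CLINT v|std_normal_distribution. complex_of_real (v ^ 3) * iexp (x * v)) = - \<i> * ((x ^ 3 - 3 * x) * exp (- x\<^sup>2 / 2))"
proof -
  let ?G = "\<lambda>k x. CLINT v|std_normal_distribution. complex_of_real (v ^ k) * iexp (x * v)"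
  have D: "(?G k has_vector_derivative \<i> * ?G (Suc k) x) (at x)" for k x
    by (rule char_moment_has_derivative) (auto intro: integrable_std_normal_distribution_moment)
  have step: "?G (Suc k) x = - \<i> * d" if "\<And>x. ?G k x = F x" "(F has_vector_derivative d) (at x)" for k F d x
  proof -
    have "?G k = F" using that(1) by auto
    then have "\<i> * ?G (Suc k) x = d"
      using D[of k x] that(2) by (metis vector_derivative_unique_at)
    then show ?thesis by (simp add: algebra_simps flip: \<open>_ = d\<close>)
  qed
  have g0: "?G 0 x = complex_of_real (exp (- x\<^sup>2 / 2))" for x
    using fun_cong[OF char_std_normal_distribution, of x] by (simp add: char_def)
  have d0: "((\<lambda>x. complex_of_real (exp (- x\<^sup>2 / 2))) has_vector_derivative complex_of_real (- x * exp (- x\<^sup>2 / 2))) (at x)" for x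
    by (rule has_vector_derivative_of_real) (auto intro!: derivative_eq_intros)
  have d1: "((\<lambda>x. - \<i> * complex_of_real (- x * exp (- x\<^sup>2 / 2))) has_vector_derivative
      - \<i> * complex_of_real ((x\<^sup>2 - 1) * exp (- x\<^sup>2 / 2))) (at x)" for x
    by (rule has_vector_derivative_mult_right, rule has_vector_derivative_of_real)
      (auto intro!: derivative_eq_intros simp: algebra_simps power2_eq_square)
  have d2: "((\<lambda>x. - \<i> * (- \<i> * complex_of_real ((x\<^sup>2 - 1) * exp (- x\<^sup>2 / 2)))) has_vector_derivative
      - \<i> * (- \<i> * complex_of_real ((3 * x - x ^ 3) * exp (- x\<^sup>2 / 2)))) (at x)" for x
    by (rule has_vector_derivative_mult_right, rule has_vector_derivative_mult_right, rule has_vector_derivative_of_real)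
      (auto intro!: derivative_eq_intros simp: algebra_simps power2_eq_square power3_eq_cube)
  have g1: "?G (Suc 0) x = - \<i> * complex_of_real (- x * exp (- x\<^sup>2 / 2))" for x
    by (rule step[OF g0 d0])
  have g2: "?G (Suc (Suc 0)) x = - \<i> * (- \<i> * complex_of_real ((x\<^sup>2 - 1) * exp (- x\<^sup>2 / 2)))" for x
    by (rule step[OF g1 d1])
  have "?G (Suc (Suc (Suc 0))) x = - \<i> * (- \<i> * (- \<i> * complex_of_real ((3 * x - x ^ 3) * exp (- x\<^sup>2 / 2))))"
    by (rule step[OF g2 d2])
  then show ?thesis by (simp add: algebra_simps flip: numeral_3_eq_3)
qed

text \<open>The polynomial \<open>x ^ 3 - 3 x\<close> is the third Hermite polynomial; it arises from the factor
\<open>(i u) ^ 3\<close> as the third derivative of the normal density, up to sign.\<close>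

lemma fourier_inverse_gaussian_hermite:
  fixes c :: real
  shows "fourier_inverse (\<lambda>u. complex_of_real (exp (- (u\<^sup>2 / 2))) * (1 + (\<i> * u) ^ 3 * c)) x
    = std_normal_density x * (1 + c * (x ^ 3 - 3 * x))"
proof -
  have i3: "(\<i> * complex_of_real y) ^ 3 = - \<i> * complex_of_real (y ^ 3)" for y
    by (simp add: power_mult_distrib eval_nat_numeral ac_simps)
  interpret N: real_distribution std_normal_distribution by (rule real_dist_normal_dist)
  have int0: "integrable std_normal_distribution (\<lambda>v. iexp (- x * v))"
    by (rule N.integrable_const_bound[where B=1]) auto
  have int3: "integrable std_normal_distribution (\<lambda>v. complex_of_real (v ^ 3) * iexp (- x * v))"
    by (rule Bochner_Integration.integrable_bound[OF integrable_std_normal_distribution_moment[of 3]]) (auto simp: norm_mult norm_power power_abs)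
  have "(CLINT v|lborel. iexp (- (v * x)) * (complex_of_real (exp (- (v\<^sup>2 / 2))) * (1 + (\<i> * v) ^ 3 * c)))
      = (CLINT v|lborel. sqrt (2 * pi) * (std_normal_density v *\<^sub>R (iexp (- x * v) - (\<i> * c) * (complex_of_real (v ^ 3) * iexp (- x * v)))))"
    by (intro Bochner_Integration.integral_cong refl)
      (simp only: i3, simp add: std_normal_density_def scaleR_conv_of_real algebra_simps)
  also have "\<dots> = sqrt (2 * pi) * (CLINT v|std_normal_distribution. iexp (- x * v) - (\<i> * c) * (complex_of_real (v ^ 3) * iexp (- x * v)))"
  proof -
    have "(CLINT v|std_normal_distribution. iexp (- x * v) - (\<i> * c) * (complex_of_real (v ^ 3) * iexp (- x * v)))
      = (CLINT v|lborel. std_normal_density v *\<^sub>R (iexp (- x * v) - (\<i> * c) * (complex_of_real (v ^ 3) * iexp (- x * v))))"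
      by (rule integral_density) auto
    then show ?thesis by (simp only: integral_mult_right_zero)
  qed
  also have "(CLINT v|std_normal_distribution. iexp (- x * v) - (\<i> * c) * (complex_of_real (v ^ 3) * iexp (- x * v)))
      = char std_normal_distribution (- x) - \<i> * c * (CLINT v|std_normal_distribution. complex_of_real (v ^ 3) * iexp (- x * v))"
    using int0 int3 by (simp add: char_def mult.assoc)
  also have "\<dots> = exp (- x\<^sup>2 / 2) * (1 + c * (x ^ 3 - 3 * x))"
    unfolding gaussian_third_moment_char char_std_normal_distribution
    by (simp add: algebra_simps)
  finally have I: "(CLINT v|lborel. iexp (- (v * x)) * (complex_of_real (exp (- (v\<^sup>2 / 2))) * (1 + (\<i> * v) ^ 3 * c)))
      = complex_of_real (sqrt (2 * pi) * (exp (- x\<^sup>2 / 2) * (1 + c * (x ^ 3 - 3 * x))))"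
    by simp
  have "sqrt (2 * pi) * E / (2 * pi) = 1 / sqrt (2 * pi) * E" for E
    by (simp add: field_simps)
  then have "sqrt (2 * pi) * (exp (- x\<^sup>2 / 2) * (1 + c * (x ^ 3 - 3 * x))) / (2 * pi)
      = std_normal_density x * (1 + c * (x ^ 3 - 3 * x))"
    unfolding std_normal_density_def by (simp only: mult.assoc)
  from arg_cong[OF this, of complex_of_real] show ?thesis
    unfolding fourier_inverse_def I by simp
qed

section \<open>Characteristic functions away from zero\<close>

lemma abs_sin_add_le: "\<bar>sin (x + y :: real)\<bar> \<le> \<bar>sin x\<bar> + \<bar>sin y\<bar>"
proof -
  have "\<bar>sin (x + y)\<bar> \<le> \<bar>sin x * cos y\<bar> + \<bar>cos x * sin y\<bar>"
    by (simp add: sin_add abs_triangle_ineq)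
  also have "\<dots> \<le> \<bar>sin x\<bar> + \<bar>sin y\<bar>"
    by (intro add_mono) (auto simp: abs_mult intro!: mult_left_le mult_left_le_one_le abs_cos_le_one)
  finally show ?thesis .
qed

lemma abs_sin_nat_mult_le: "\<bar>sin (real k * x)\<bar> \<le> real k * \<bar>sin x\<bar>"
proof (induction k)
  case (Suc k)
  have "\<bar>sin (real (Suc k) * x)\<bar> \<le> \<bar>sin (real k * x)\<bar> + \<bar>sin x\<bar>"
    using abs_sin_add_le[of "real k * x" x] by (simp add: algebra_simps)
  with Suc show ?case by (simp add: algebra_simps)
qed simp

lemma one_minus_cos_eq: "1 - cos (x::real) = 2 * (sin (x / 2))\<^sup>2"
  using cos_double_sin[of "x / 2"] by simp

lemma one_minus_cos_nat_mult_le: "1 - cos (real k * x) \<le> (real k)\<^sup>2 * (1 - cos x)"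
proof -
  have "\<bar>sin (real k * (x / 2))\<bar>\<^sup>2 \<le> (real k * \<bar>sin (x / 2)\<bar>)\<^sup>2"
    by (intro power_mono abs_sin_nat_mult_le) simp
  then show ?thesis by (simp add: one_minus_cos_eq power_mult_distrib)
qed

lemma one_minus_cos_add_le: "1 - cos (x + y :: real) \<le> 2 * (1 - cos x) + 2 * (1 - cos y)"
proof -
  have "\<bar>sin (x / 2 + y / 2)\<bar>\<^sup>2 \<le> (\<bar>sin (x / 2)\<bar> + \<bar>sin (y / 2)\<bar>)\<^sup>2"
    by (intro power_mono abs_sin_add_le) simp
  also have "\<dots> \<le> 2 * \<bar>sin (x / 2)\<bar>\<^sup>2 + 2 * \<bar>sin (y / 2)\<bar>\<^sup>2"
    using sum_squares_bound[of "\<bar>sin (x / 2)\<bar>" "\<bar>sin (y / 2)\<bar>"]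
    by (simp add: power2_sum del: power2_abs)
  finally show ?thesis by (simp add: one_minus_cos_eq add_divide_distrib)
qed

lemma one_minus_cos_le_square: "1 - cos (x::real) \<le> x\<^sup>2 / 2"
proof -
  have "\<bar>sin (x / 2)\<bar>\<^sup>2 \<le> \<bar>x / 2\<bar>\<^sup>2"
    by (intro power_mono abs_sin_x_le_abs_x) simp
  then show ?thesis by (simp add: one_minus_cos_eq power_divide)
qed

context standardized_density
begin

text \<open>\<open>\<bar>\<phi>\<bar>\<^sup>2\<close> is the characteristic function of the difference of two independent copies, hence real.
Inequalities for \<open>1 - cos\<close> thereby become inequalities for the defect \<open>1 - \<bar>\<phi>\<bar>\<^sup>2\<close>.\<close>

lemma char_defect_eq:
  "1 - (norm (\<phi> w))\<^sup>2 = (\<integral>y. (\<integral>x. 1 - cos (w * (x - y)) \<partial>D) \<partial>D)"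
proof -
  have inner: "(\<integral>x. cos (w * (x - y)) \<partial>D) = Re (\<phi> w * iexp (- (w * y)))" for y
  proof -
    have int: "integrable D (\<lambda>x. iexp (w * (x - y)))"
      by (rule integrable_const_bound[where B=1]) auto
    have "(\<integral>x. cos (w * (x - y)) \<partial>D) = (\<integral>x. Re (iexp (w * (x - y))) \<partial>D)"
      by (simp add: Re_exp)
    also have "\<dots> = Re (CLINT x|D. iexp (w * (x - y)))" by (rule integral_Re[OF int])
    also have "(CLINT x|D. iexp (w * (x - y))) = (CLINT x|D. iexp (w * x) * iexp (- (w * y)))"
      by (intro Bochner_Integration.integral_cong refl) (simp add: algebra_simps flip: exp_add)
    also have "\<dots> = \<phi> w * iexp (- (w * y))" by (simp add: char_def)
    finally show ?thesis .
  qed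
  have int1: "integrable D (\<lambda>x. cos (w * (x - y)))" for y
    by (rule integrable_const_bound[where B=1]) auto
  have int2: "integrable D (\<lambda>y. \<phi> w * iexp (- (w * y)))"
    by (rule integrable_const_bound[where B=1]) (auto simp: norm_mult norm_char_le)
  have one: "(\<integral>x. 1 \<partial>D) = (1::real)" using prob_space by simp
  have "(\<integral>y. (\<integral>x. 1 - cos (w * (x - y)) \<partial>D) \<partial>D) = (\<integral>y. 1 - Re (\<phi> w * iexp (- (w * y))) \<partial>D)"
    using int1 by (simp only: Bochner_Integration.integral_diff integrable_const one inner)
  also have "\<dots> = 1 - (\<integral>y. Re (\<phi> w * iexp (- (w * y))) \<partial>D)"
    using integrable_Re[OF int2] by (simp only: Bochner_Integration.integral_diff integrable_const one)
  also have "(\<integral>y. Re (\<phi> w * iexp (- (w * y))) \<partial>D) = Re (CLINT y|D. \<phi> w * iexp (- (w * y)))"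
    by (rule integral_Re[OF int2])
  also have "(CLINT y|D. \<phi> w * iexp (- (w * y))) = \<phi> w * \<phi> (- w)"
    by (simp add: char_def)
  also have "Re (\<phi> w * \<phi> (- w)) = (norm (\<phi> w))\<^sup>2"
    by (simp add: char_minus complex_norm_square[symmetric] del: of_real_power)
  finally show ?thesis by simp
qed

lemma integrable_cos_defect:
  "integrable D (\<lambda>x. 1 - cos (w * (x - y)))"
  "integrable D (\<lambda>y. \<integral>x. 1 - cos (w * (x - y)) \<partial>D)"
proof -
  show *: "integrable D (\<lambda>x. 1 - cos (w * (x - y)))" for y
    by (rule integrable_const_bound[where B=2]) (auto intro!: AE_I2 simp: abs_le_iff intro: order_trans[OF cos_le_one])
  have "\<bar>\<integral>x. 1 - cos (w * (x - y)) \<partial>D\<bar> \<le> 2" for y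
  proof -
    have "0 \<le> (\<integral>x. 1 - cos (w * (x - y)) \<partial>D)" by (intro integral_nonneg_AE AE_I2) simp
    moreover have "(\<integral>x. 1 - cos (w * (x - y)) \<partial>D) \<le> (\<integral>x. 2 \<partial>D)"
    proof (rule integral_mono[OF *])
      show "1 - cos (w * (x - y)) \<le> 2" for x using cos_ge_minus_one[of "w * (x - y)"] by linarith
    qed simp
    moreover have "(\<integral>x. 2 \<partial>D) = (2::real)" using prob_space by simp
    ultimately show ?thesis by simp
  qed
  then show "integrable D (\<lambda>y. \<integral>x. 1 - cos (w * (x - y)) \<partial>D)"
    by (intro integrable_const_bound[where B=2]) auto
qed

lemma char_defect_nat_mult_le:
  "1 - (norm (\<phi> (real k * w)))\<^sup>2 \<le> (real k)\<^sup>2 * (1 - (norm (\<phi> w))\<^sup>2)"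
proof -
  have "1 - (norm (\<phi> (real k * w)))\<^sup>2 \<le> (\<integral>y. (\<integral>x. (real k)\<^sup>2 * (1 - cos (w * (x - y))) \<partial>D) \<partial>D)"
    unfolding char_defect_eq
  proof (intro integral_mono integrable_cos_defect)
    show "1 - cos (real k * w * (x - y)) \<le> (real k)\<^sup>2 * (1 - cos (w * (x - y)))" for x y
      using one_minus_cos_nat_mult_le[of k "w * (x - y)"] by (simp only: mult.assoc)
    show "integrable D (\<lambda>y. \<integral>x. (real k)\<^sup>2 * (1 - cos (w * (x - y))) \<partial>D)"
      unfolding integral_mult_right_zero by (intro integrable_mult_right integrable_cos_defect)
  qed (intro integrable_mult_right integrable_cos_defect)
  also have "\<dots> = (real k)\<^sup>2 * (1 - (norm (\<phi> w))\<^sup>2)"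
    unfolding char_defect_eq by simp
  finally show ?thesis .
qed

lemma char_defect_add_le:
  "1 - (norm (\<phi> (v + w)))\<^sup>2 \<le> 2 * (1 - (norm (\<phi> v))\<^sup>2) + 2 * (1 - (norm (\<phi> w))\<^sup>2)"
proof -
  have "1 - (norm (\<phi> (v + w)))\<^sup>2
      \<le> (\<integral>y. (\<integral>x. 2 * (1 - cos (v * (x - y))) + 2 * (1 - cos (w * (x - y))) \<partial>D) \<partial>D)"
    unfolding char_defect_eq
  proof (intro integral_mono integrable_cos_defect)
    fix x y
    show "1 - cos ((v + w) * (x - y)) \<le> 2 * (1 - cos (v * (x - y))) + 2 * (1 - cos (w * (x - y)))"
      using one_minus_cos_add_le[of "v * (x - y)" "w * (x - y)"] by (simp only: distrib_right)
  next
    show "integrable D (\<lambda>y. \<integral>x. 2 * (1 - cos (v * (x - y))) + 2 * (1 - cos (w * (x - y))) \<partial>D)"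
      using integrable_cos_defect by (simp only: Bochner_Integration.integral_add integrable_mult_right integral_mult_right_zero Bochner_Integration.integrable_add)
  qed (intro Bochner_Integration.integrable_add integrable_mult_right integrable_cos_defect)
  also have "\<dots> = 2 * (1 - (norm (\<phi> v))\<^sup>2) + 2 * (1 - (norm (\<phi> w))\<^sup>2)"
    unfolding char_defect_eq using integrable_cos_defect
    by (simp only: Bochner_Integration.integral_add integrable_mult_right integral_mult_right_zero)
  finally show ?thesis .
qed

lemma char_defect_le_square:
  "1 - (norm (\<phi> w))\<^sup>2 \<le> w\<^sup>2"
proof -
  have m1: "integrable D (\<lambda>x. x)" "integrable D (\<lambda>x. x\<^sup>2)" "expectation (\<lambda>x. x) = 0" "expectation (\<lambda>x. x\<^sup>2) = 1"
    using moment_D(2)[of 1] moment_D(2)[of 2] moment_D(1)[of 1] moment_D(1)[of 2] mean variance by simp_all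
  have one: "(\<integral>x. (c::real) \<partial>D) = c" for c using prob_space by simp
  have i: "integrable D (\<lambda>x. (x - y)\<^sup>2)" for y
    unfolding power2_diff using m1 by (intro Bochner_Integration.integrable_add Bochner_Integration.integrable_diff) auto
  have e: "(\<integral>x. (x - y)\<^sup>2 \<partial>D) = 1 + y\<^sup>2" for y
  proof -
    have "(\<integral>x. (x - y)\<^sup>2 \<partial>D) = (\<integral>x. (x\<^sup>2 + y\<^sup>2) - 2 * y * x \<partial>D)"
      by (simp add: power2_diff ac_simps)
    also have "\<dots> = 1 + y\<^sup>2" using m1 prob_space by simp
    finally show ?thesis .
  qed
  have "1 - (norm (\<phi> w))\<^sup>2 \<le> (\<integral>y. (\<integral>x. w\<^sup>2 / 2 * (x - y)\<^sup>2 \<partial>D) \<partial>D)"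
    unfolding char_defect_eq
  proof (intro integral_mono integrable_cos_defect)
    fix x y
    show "1 - cos (w * (x - y)) \<le> w\<^sup>2 / 2 * (x - y)\<^sup>2"
      using one_minus_cos_le_square[of "w * (x - y)"] by (simp add: power_mult_distrib)
  next
    show "integrable D (\<lambda>y. \<integral>x. w\<^sup>2 / 2 * (x - y)\<^sup>2 \<partial>D)"
      unfolding integral_mult_right_zero e using m1 by (intro integrable_mult_right Bochner_Integration.integrable_add) auto
  qed (intro integrable_mult_right i)
  also have "\<dots> = w\<^sup>2"
    unfolding integral_mult_right_zero e using m1 one[of 1] by simp
  finally show ?thesis .
qed

end

text \<open>The factor \<open>8 \<pi> C\<close> is the number of recurrences that contradicts \<open>square_integrable_char\<close>, see
\<open>char_defect_ge_large_frequency\<close>; the factor \<open>(2 C)\<^sup>2\<close> pays for the passage from frequencies above 1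
down to \<open>1 / C\<close>.\<close>

definition char_gap :: "real \<Rightarrow> real" where
  "char_gap C = 1 / (32 * (real (nat \<lceil>8 * pi * C\<rceil> + 1))\<^sup>2 * C\<^sup>2)"

context standardized_density
begin

lemma char_gap_pos: "0 < char_gap C"
proof -
  have "0 < real (nat \<lceil>8 * pi * C\<rceil> + 1)" by linarith
  then show ?thesis unfolding char_gap_def
    using bound_pos by (intro divide_pos_pos mult_pos_pos zero_less_power) auto
qed

text \<open>If the defect at \<open>w\<close> is very small, then it is small near each of \<open>w, 2 w, \<dots>, K w\<close>, and
\<open>\<bar>\<phi>\<bar>\<^sup>2 \<ge> 1 / 2\<close> on \<open>K\<close> intervals of length \<open>1 / 2\<close>, which are disjoint because \<open>\<bar>w\<bar> \<ge> 1\<close>. So the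
integral of \<open>\<bar>\<phi>\<bar>\<^sup>2\<close> is at least \<open>K / 4\<close>, which exceeds \<open>2 \<pi> C\<close>.\<close>

lemma char_defect_ge_large_frequency:
  fixes K :: nat
  assumes K: "8 * pi * C < K" and w: "1 \<le> \<bar>w\<bar>"
  shows "1 / (8 * (real K)\<^sup>2) \<le> 1 - (norm (\<phi> w))\<^sup>2"
proof (rule ccontr)
  assume "\<not> ?thesis"
  then have small: "1 - (norm (\<phi> w))\<^sup>2 < 1 / (8 * (real K)\<^sup>2)" by simp
  have Kpos: "real K > 0" using bound_pos by (intro less_trans[OF _ K]) simp
  let ?I = "\<lambda>k. {real k * w - 1 / 4 .. real k * w + 1 / 4}"
  \<comment> \<open>Near the \<open>k\<close>-th multiple the defect is at most \<open>2 / 8 + 2 / 16\<close>.\<close>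
  have half: "1 / 2 \<le> (norm (\<phi> v))\<^sup>2" if k: "k \<in> {1..K}" and v: "v \<in> ?I k" for k v
  proof -
    have "1 - (norm (\<phi> (real k * w)))\<^sup>2 \<le> (real k)\<^sup>2 * (1 - (norm (\<phi> w))\<^sup>2)"
      by (rule char_defect_nat_mult_le)
    also have "\<dots> \<le> (real K)\<^sup>2 * (1 / (8 * (real K)\<^sup>2))"
      using k small norm_char_le[of w]
      by (intro mult_mono power_mono) (auto simp: power_le_one)
    also have "\<dots> = 1 / 8" using Kpos by simp
    finally have a: "1 - (norm (\<phi> (real k * w)))\<^sup>2 \<le> 1 / 8" .
    have "\<bar>v - real k * w\<bar> \<le> 1 / 4" using v by (simp only: abs_le_iff) auto
    then have "\<bar>v - real k * w\<bar>\<^sup>2 \<le> (1 / 4)\<^sup>2" by (intro power_mono) auto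
    then have "(v - real k * w)\<^sup>2 \<le> (1 / 4)\<^sup>2" by simp
    then have b: "1 - (norm (\<phi> (v - real k * w)))\<^sup>2 \<le> 1 / 16"
      using char_defect_le_square[of "v - real k * w"] by (simp add: power2_eq_square)
    show ?thesis
      using char_defect_add_le[of "real k * w" "v - real k * w"] a b by simp
  qed
  have disj: "(\<Sum>k\<in>{1..K}. indicator (?I k) v / 2) \<le> (norm (\<phi> v))\<^sup>2" for v
  proof (cases "\<exists>k\<in>{1..K}. v \<in> ?I k")
    case True
    then obtain k where k: "k \<in> {1..K}" "v \<in> ?I k" by blast
    have "v \<notin> ?I j" if "j \<noteq> k" for j
    proof
      assume "v \<in> ?I j"
      with k have "(real j - real k) * w \<le> 1 / 2" "- ((real j - real k) * w) \<le> 1 / 2"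
        unfolding left_diff_distrib by auto
      then have "\<bar>(real j - real k) * w\<bar> \<le> 1 / 2" by (simp only: abs_le_iff)
      moreover have "1 \<le> \<bar>real j - real k\<bar>" using that by linarith
      then have "1 * 1 \<le> \<bar>real j - real k\<bar> * \<bar>w\<bar>" using w by (intro mult_mono) auto
      ultimately show False by (simp add: abs_mult)
    qed
    then have "(\<Sum>j\<in>{1..K}. indicator (?I j) v / 2) = (\<Sum>j\<in>{1..K}. if j = k then 1 / 2 else (0::real))"
      using k by (intro sum.cong) (auto simp: indicator_def)
    also have "\<dots> = 1 / 2" using k by simp
    finally show ?thesis using half[OF k] by simp
  next
    case False
    then have "(\<Sum>k\<in>{1..K}. indicator (?I k) v / 2) = (0::real)"
      by (intro sum.neutral) auto
    then show ?thesis by simp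
  qed
  have int: "integrable lborel (\<lambda>v. indicator (?I k) v / 2 :: real)" for k
  proof -
    have "integrable lborel (indicator (?I k) :: real \<Rightarrow> real)"
      using emeasure_lborel_cbox_finite[of "real k * w - 1 / 4" "real k * w + 1 / 4"]
      by (intro integrable_real_indicator) (simp_all only: cbox_interval sets_lborel atLeastAtMost_borel)
    from integrable_mult_left[OF this, of "1 / 2"] show ?thesis by simp
  qed
  have "real K / 4 = (\<Sum>k\<in>{1..K}. (\<integral>v. indicator (?I k) v / 2 \<partial>lborel))"
    by simp
  also have "\<dots> = (\<integral>v. (\<Sum>k\<in>{1..K}. indicator (?I k) v / 2) \<partial>lborel)"
    by (rule Bochner_Integration.integral_sum[symmetric]) (rule int)
  also have "\<dots> \<le> (\<integral>v. (norm (\<phi> v))\<^sup>2 \<partial>lborel)"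
    by (intro integral_mono Bochner_Integration.integrable_sum int square_integrable_char disj)
  also have "\<dots> \<le> 2 * pi * C" by (rule square_integrable_char)
  finally show False using K by simp
qed

text \<open>Some multiple \<open>k w\<close> with \<open>k \<le> 2 C\<close> has modulus at least 1, and the defect at \<open>k w\<close> is at most
\<open>k\<^sup>2\<close> times the defect at \<open>w\<close>.\<close>

lemma char_square_away_from_zero:
  assumes w: "1 / C \<le> \<bar>w\<bar>"
  shows "(norm (\<phi> w))\<^sup>2 \<le> 1 - char_gap C"
proof -
  define K where "K = nat \<lceil>8 * pi * C\<rceil> + 1"
  have K: "8 * pi * C < K" unfolding K_def by linarith
  have C: "1 \<le> C" by (rule bound_ge_1)
  have w0: "0 < \<bar>w\<bar>" using w C by (intro less_le_trans[OF _ w]) simp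
  define k where "k = nat \<lceil>1 / \<bar>w\<bar>\<rceil>"
  have k1: "1 / \<bar>w\<bar> \<le> k" unfolding k_def by linarith
  have k2: "k \<le> 1 / \<bar>w\<bar> + 1" unfolding k_def using w0 by (simp add: of_nat_nat ceiling_correct le_nat_iff)
  have "1 / \<bar>w\<bar> \<le> C" using w w0 C by (simp add: field_simps)
  with k2 C have k3: "real k \<le> 2 * C" by linarith
  have "1 \<le> \<bar>real k * w\<bar>" using k1 w0 by (simp add: abs_mult field_simps)
  from char_defect_ge_large_frequency[OF K this]
  have "1 / (8 * (real K)\<^sup>2) \<le> (real k)\<^sup>2 * (1 - (norm (\<phi> w))\<^sup>2)"
    using char_defect_nat_mult_le[of k w] by linarith
  also have "\<dots> \<le> (2 * C)\<^sup>2 * (1 - (norm (\<phi> w))\<^sup>2)"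
    using k3 norm_char_le[of w] by (intro mult_right_mono power_mono) (auto simp: power_le_one)
  finally have *: "1 / (8 * (real K)\<^sup>2) \<le> (2 * C)\<^sup>2 * (1 - (norm (\<phi> w))\<^sup>2)" .
  have "0 < (2 * C)\<^sup>2" using C by simp
  with * have "1 / (8 * (real K)\<^sup>2) / (2 * C)\<^sup>2 \<le> 1 - (norm (\<phi> w))\<^sup>2"
    by (metis pos_divide_le_eq mult.commute)
  moreover have "char_gap C = 1 / (8 * (real K)\<^sup>2) / (2 * C)\<^sup>2"
    unfolding char_gap_def K_def[symmetric] by (simp add: power_mult_distrib)
  ultimately have "char_gap C \<le> 1 - (norm (\<phi> w))\<^sup>2" by simp
  then show ?thesis by simp
qed

end

section \<open>The Edgeworth expansion with uniform error\<close>

text \<open>One integrable function that dominates the error of \<open>char_power_near_zero\<close> and the bound of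
\<open>norm_edgeworth_char_le_far\<close>, after the power \<open>C ^ 3\<close> has been taken out.\<close>

definition edgeworth_majorant :: "real \<Rightarrow> real" where
  "edgeworth_majorant u = (2 * u\<^sup>2 + 8 * u ^ 4 + 3 * u ^ 6) * exp (- (u\<^sup>2 / 4))"

lemma edgeworth_majorant_nonneg: "0 \<le> edgeworth_majorant u"
  unfolding edgeworth_majorant_def by (intro mult_nonneg_nonneg add_nonneg_nonneg) auto

lemma integrable_edgeworth_majorant: "integrable lborel edgeworth_majorant"
proof -
  have "integrable lborel (\<lambda>u. normal_density 0 (sqrt 2) u * (u - 0) ^ k)" for k
    by (rule integrable_normal_moment) simp
  then have "integrable lborel (\<lambda>u. sqrt (2 * pi * (sqrt 2)\<^sup>2) * (normal_density 0 (sqrt 2) u * (u - 0) ^ k))" for k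
    by (rule integrable_mult_right)
  then have m: "integrable lborel (\<lambda>u::real. u ^ k * exp (- (u\<^sup>2 / 4)))" for k
    by (simp add: normal_density_def ac_simps)
  have "edgeworth_majorant = (\<lambda>u. 2 * (u\<^sup>2 * exp (- (u\<^sup>2 / 4))) + 8 * (u ^ 4 * exp (- (u\<^sup>2 / 4))) + 3 * (u ^ 6 * exp (- (u\<^sup>2 / 4))))"
    unfolding edgeworth_majorant_def by (auto simp: algebra_simps)
  then show ?thesis
    by (simp only: \<open>edgeworth_majorant = _\<close>) (intro Bochner_Integration.integrable_add integrable_mult_right m)
qed

lemma edgeworth_majorant_measurable [measurable]: "edgeworth_majorant \<in> borel_measurable borel"
  using integrable_edgeworth_majorant by auto

context standardized_density
begin

text \<open>In this range \<open>C\<^sup>2 u\<^sup>2 / n \<ge> 1\<close>, and multiplication by this quantity produces the factor \<open>1 / n\<close>; the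
polynomial growth is absorbed by half of the Gaussian exponent.\<close>

lemma norm_edgeworth_char_le_far:
  assumes n: "n \<ge> 1" and u: "sqrt n / C < \<bar>u\<bar>"
  shows "norm (edgeworth_char n u) \<le> C ^ 3 / n * (2 * u\<^sup>2 + u ^ 6) * exp (- (u\<^sup>2 / 4))"
proof -
  have C: "1 \<le> C" by (rule bound_ge_1)
  have sn: "1 \<le> sqrt (real n)" using n by simp
  have nu: "real n \<le> C\<^sup>2 * u\<^sup>2"
  proof -
    have "sqrt n \<le> C * \<bar>u\<bar>" using u C by (simp add: field_simps)
    then have "(sqrt n)\<^sup>2 \<le> (C * \<bar>u\<bar>)\<^sup>2" by (intro power_mono) auto
    then show ?thesis by (simp add: power_mult_distrib)
  qed
  have "norm (edgeworth_char n u) \<le> exp (- (u\<^sup>2 / 2)) * (1 + C * \<bar>u\<bar> ^ 3)"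
  proof -
    have "norm (1 + (\<i> * u) ^ 3 * complex_of_real (skewness / (6 * sqrt n))) \<le> 1 + \<bar>u\<bar> ^ 3 * (\<bar>skewness\<bar> / (6 * sqrt n))"
      by (rule order_trans[OF norm_triangle_ineq]) (simp add: norm_mult norm_power norm_divide)
    also have "\<bar>u\<bar> ^ 3 * (\<bar>skewness\<bar> / (6 * sqrt n)) \<le> \<bar>u\<bar> ^ 3 * (C / 1)"
    proof (intro mult_left_mono frac_le)
      show "1 \<le> 6 * sqrt (real n)" using sn by linarith
    qed (use abs_skewness_le C in auto)
    finally have "norm (1 + (\<i> * u) ^ 3 * complex_of_real (skewness / (6 * sqrt n))) \<le> 1 + C * \<bar>u\<bar> ^ 3"
      by (simp only: div_by_1 mult.commute add_left_mono)
    then show ?thesis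
      unfolding edgeworth_char_def norm_mult norm_of_real by (intro mult_mono) auto
  qed
  also have "1 + C * \<bar>u\<bar> ^ 3 \<le> C * (2 + u ^ 4)"
  proof -
    have "\<bar>u\<bar> ^ 3 \<le> 1 + u ^ 4"
    proof (cases "\<bar>u\<bar> \<le> 1")
      case True
      then have "\<bar>u\<bar> ^ 3 \<le> 1" by (simp add: power_le_one)
      then show ?thesis by (rule order_trans) simp
    next
      case False
      then have "\<bar>u\<bar> ^ 3 \<le> \<bar>u\<bar> ^ 4" by (intro power_increasing) auto
      then show ?thesis by simp
    qed
    then have "C * \<bar>u\<bar> ^ 3 \<le> C * (1 + u ^ 4)" using C by (intro mult_left_mono) auto
    then show ?thesis using C by (simp add: algebra_simps)
  qed
  also have "exp (- (u\<^sup>2 / 2)) * (C * (2 + u ^ 4)) \<le> exp (- (u\<^sup>2 / 4)) * (C * (2 + u ^ 4) * (C\<^sup>2 * u\<^sup>2 / n))"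
  proof (rule mult_mono)
    have "C * (2 + u ^ 4) * 1 \<le> C * (2 + u ^ 4) * (C\<^sup>2 * u\<^sup>2 / n)"
      using nu n C by (intro mult_left_mono) (auto simp: field_simps)
    then show "C * (2 + u ^ 4) \<le> C * (2 + u ^ 4) * (C\<^sup>2 * u\<^sup>2 / n)" by simp
  qed (use C in auto)
  also have "\<dots> = C ^ 3 / n * (2 * u\<^sup>2 + u ^ 6) * exp (- (u\<^sup>2 / 4))"
    by (simp add: field_simps eval_nat_numeral)
  finally show ?thesis by (simp add: mult_left_mono)
qed

lemma char_power_minus_edgeworth_char_le:
  assumes n: "n \<ge> 2"
  shows "norm (\<phi> (u / sqrt n) ^ n - edgeworth_char n u)
    \<le> C ^ 3 / n * edgeworth_majorant u + sqrt (1 - char_gap C) ^ (n - 2) * (norm (\<phi> (u / sqrt n)))\<^sup>2"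
proof (cases "\<bar>u\<bar> \<le> sqrt n / C")
  case True
  have C: "1 \<le> C" by (rule bound_ge_1)
  have "norm (\<phi> (u / sqrt n) ^ n - edgeworth_char n u) \<le> (8 * C * u ^ 4 + C\<^sup>2 * u ^ 6) * exp (- (u\<^sup>2 / 4)) / n"
    using n True by (intro char_power_near_zero) auto
  also have "\<dots> \<le> (C ^ 3 * (2 * u\<^sup>2 + 8 * u ^ 4 + 3 * u ^ 6)) * exp (- (u\<^sup>2 / 4)) / n"
  proof (intro divide_right_mono mult_right_mono)
    have "C * (8 * u ^ 4) \<le> C ^ 3 * (8 * u ^ 4)"
      using C power_increasing[of 1 3 C] by (intro mult_right_mono) auto
    moreover have "C\<^sup>2 * u ^ 6 \<le> C ^ 3 * (3 * u ^ 6)"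
      using C by (intro mult_mono power_increasing) auto
    moreover have "0 \<le> C ^ 3 * (2 * u\<^sup>2)" using C by simp
    ultimately show "8 * C * u ^ 4 + C\<^sup>2 * u ^ 6 \<le> C ^ 3 * (2 * u\<^sup>2 + 8 * u ^ 4 + 3 * u ^ 6)"
      by (simp add: distrib_left)
  qed auto
  also have "\<dots> = C ^ 3 / n * edgeworth_majorant u" by (simp add: edgeworth_majorant_def)
  also have "\<dots> \<le> C ^ 3 / n * edgeworth_majorant u + sqrt (1 - char_gap C) ^ (n - 2) * (norm (\<phi> (u / sqrt n)))\<^sup>2"
  proof -
    have "(norm (\<phi> (1 / C)))\<^sup>2 \<le> 1 - char_gap C" using bound_pos by (intro char_square_away_from_zero) simp
    then have "0 \<le> 1 - char_gap C" by (rule order_trans[rotated]) simp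
    then show ?thesis by simp
  qed
  finally show ?thesis .
next
  case False
  have sn: "sqrt (real n) > 0" using n by simp
  have C: "1 \<le> C" by (rule bound_ge_1)
  let ?a = "norm (\<phi> (u / sqrt n))"
  have "?a\<^sup>2 \<le> 1 - char_gap C"
  proof (rule char_square_away_from_zero)
    show "1 / C \<le> \<bar>u / sqrt n\<bar>" using False sn C by (simp add: field_simps)
  qed
  then have a: "?a \<le> sqrt (1 - char_gap C)" by (rule real_le_rsqrt)
  have "norm (\<phi> (u / sqrt n) ^ n) = ?a ^ (n - 2) * ?a\<^sup>2"
  proof -
    have "?a ^ n = ?a ^ ((n - 2) + 2)" by (simp only: le_add_diff_inverse2[OF n])
    then show ?thesis by (simp only: norm_power power_add)
  qed
  also have "\<dots> \<le> sqrt (1 - char_gap C) ^ (n - 2) * ?a\<^sup>2"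
    using a by (intro mult_right_mono power_mono) auto
  finally have 1: "norm (\<phi> (u / sqrt n) ^ n) \<le> sqrt (1 - char_gap C) ^ (n - 2) * ?a\<^sup>2" .
  have "norm (edgeworth_char n u) \<le> C ^ 3 / n * (2 * u\<^sup>2 + u ^ 6) * exp (- (u\<^sup>2 / 4))"
    using n False by (intro norm_edgeworth_char_le_far) auto
  also have "\<dots> \<le> C ^ 3 / n * (2 * u\<^sup>2 + 8 * u ^ 4 + 3 * u ^ 6) * exp (- (u\<^sup>2 / 4))"
    using C by (intro mult_right_mono mult_left_mono) auto
  also have "\<dots> = C ^ 3 / n * edgeworth_majorant u" by (simp add: edgeworth_majorant_def)
  finally show ?thesis
    using 1 norm_triangle_ineq4[of "\<phi> (u / sqrt n) ^ n" "edgeworth_char n u"] by linarith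
qed

text \<open>In the second error term, two factors \<open>\<phi>\<close> have been integrated, which gives \<open>2 \<pi> C\<close> by
\<open>square_integrable_char\<close>; the factor \<open>sqrt n\<close> is the Jacobian of \<open>u = sqrt n v\<close>.\<close>

theorem edgeworth_expansion:
  assumes n: "n \<ge> 3"
  shows "\<bar>sqrt n * conv_power n f (sqrt n * x)
      - std_normal_density x * (1 + skewness / (6 * sqrt n) * (x ^ 3 - 3 * x))\<bar>
    \<le> C ^ 3 / n * (\<integral>u. edgeworth_majorant u \<partial>lborel) + sqrt n * C * sqrt (1 - char_gap C) ^ (n - 2)"
proof -
  let ?w = "\<lambda>u. \<phi> (u / sqrt n) ^ n"
  have sn: "sqrt (real n) > 0" using n by simp
  have n2: "n \<ge> 2" using n by simp
  have scale: "complex_of_real (sqrt n * conv_power n f (sqrt n * x)) = fourier_inverse ?w x"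
  proof -
    have "(CLINT v|lborel. iexp (- (v * (sqrt n * x))) * \<phi> v ^ n)
      = (1 / sqrt n) *\<^sub>R (CLINT u|lborel. iexp (- (u * x)) * ?w u)"
      using sn lborel_integral_real_affine[of "1 / sqrt n" "\<lambda>v. iexp (- (v * (sqrt n * x))) * \<phi> v ^ n" 0]
      by (simp add: mult.commute)
    then show ?thesis
      using sn unfolding of_real_mult conv_power_eq_fourier_inverse[OF n] fourier_inverse_def
      by (simp add: scaleR_conv_of_real)
  qed
  have gauss: "complex_of_real (std_normal_density x * (1 + skewness / (6 * sqrt n) * (x ^ 3 - 3 * x)))
     = fourier_inverse (edgeworth_char n) x"
    using fourier_inverse_gaussian_hermite[of "skewness / (6 * sqrt n)" x]
    unfolding edgeworth_char_def by simp
  have int_sq: "integrable lborel (\<lambda>u. (norm (\<phi> (u / sqrt n)))\<^sup>2)"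
    using lborel_integrable_real_affine[OF square_integrable_char(1), of "1 / sqrt n" 0] sn by simp
  have int_w: "integrable lborel ?w"
    using lborel_integrable_real_affine[OF integrable_char_power[OF n2], of "1 / sqrt n" 0] sn by simp
  have int_maj: "integrable lborel (\<lambda>u. C ^ 3 / n * edgeworth_majorant u + sqrt (1 - char_gap C) ^ (n - 2) * (norm (\<phi> (u / sqrt n)))\<^sup>2)"
    by (intro Bochner_Integration.integrable_add integrable_mult_right integrable_edgeworth_majorant int_sq)
  have [measurable]: "edgeworth_char n \<in> borel_measurable borel"
    unfolding edgeworth_char_def by measurable
  have int_d: "integrable lborel (\<lambda>u. ?w u - edgeworth_char n u)"
  proof (rule Bochner_Integration.integrable_bound[OF int_maj])
    show "AE u in lborel. norm (?w u - edgeworth_char n u)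
      \<le> norm (C ^ 3 / n * edgeworth_majorant u + sqrt (1 - char_gap C) ^ (n - 2) * (norm (\<phi> (u / sqrt n)))\<^sup>2)"
      by (intro AE_I2 order_trans[OF char_power_minus_edgeworth_char_le[OF n2]])
        (simp only: real_norm_def abs_ge_self)
  qed measurable
  have int_e: "integrable lborel (edgeworth_char n)"
    using Bochner_Integration.integrable_diff[OF int_w int_d] by simp
  have "\<bar>sqrt n * conv_power n f (sqrt n * x)
      - std_normal_density x * (1 + skewness / (6 * sqrt n) * (x ^ 3 - 3 * x))\<bar>
    = norm (fourier_inverse (\<lambda>u. ?w u - edgeworth_char n u) x)"
    unfolding fourier_inverse_diff[OF int_w int_e] scale[symmetric] gauss[symmetric]
    by (simp only: of_real_diff[symmetric] norm_of_real real_norm_def)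
  also have "\<dots> \<le> (\<integral>u. norm (?w u - edgeworth_char n u) \<partial>lborel) / (2 * pi)"
    by (rule norm_fourier_inverse_le)
  also have "\<dots> \<le> (\<integral>u. C ^ 3 / n * edgeworth_majorant u + sqrt (1 - char_gap C) ^ (n - 2) * (norm (\<phi> (u / sqrt n)))\<^sup>2 \<partial>lborel) / (2 * pi)"
    by (intro divide_right_mono integral_mono int_maj integrable_norm int_d char_power_minus_edgeworth_char_le n2) simp
  also have "\<dots> = C ^ 3 / n * (\<integral>u. edgeworth_majorant u \<partial>lborel) / (2 * pi)
      + sqrt (1 - char_gap C) ^ (n - 2) * (\<integral>u. (norm (\<phi> (u / sqrt n)))\<^sup>2 \<partial>lborel) / (2 * pi)"
    using int_sq integrable_edgeworth_majorant by (simp add: add_divide_distrib)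
  also have "(\<integral>u. (norm (\<phi> (u / sqrt n)))\<^sup>2 \<partial>lborel) = sqrt n * (\<integral>v. (norm (\<phi> v))\<^sup>2 \<partial>lborel)"
    using sn lborel_integral_real_affine[of "sqrt n" "\<lambda>u. (norm (\<phi> (u / sqrt n)))\<^sup>2" 0] by simp
  also have "C ^ 3 / n * (\<integral>u. edgeworth_majorant u \<partial>lborel) / (2 * pi)
      + sqrt (1 - char_gap C) ^ (n - 2) * (sqrt n * (\<integral>v. (norm (\<phi> v))\<^sup>2 \<partial>lborel)) / (2 * pi)
    \<le> C ^ 3 / n * (\<integral>u. edgeworth_majorant u \<partial>lborel) + sqrt (1 - char_gap C) ^ (n - 2) * (sqrt n * (2 * pi * C)) / (2 * pi)"
  proof (intro add_mono divide_right_mono mult_left_mono square_integrable_char)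
    have div: "c / (2 * pi) \<le> c" if "0 \<le> c" for c :: real
      using divide_left_mono[of 1 "2 * pi" c] that pi_gt3 by simp
    have "0 \<le> C ^ 3 / n * (\<integral>u. edgeworth_majorant u \<partial>lborel)"
      using bound_pos by (intro mult_nonneg_nonneg integral_nonneg_AE AE_I2 edgeworth_majorant_nonneg) auto
    then show "C ^ 3 / n * (\<integral>u. edgeworth_majorant u \<partial>lborel) / (2 * pi) \<le> C ^ 3 / n * (\<integral>u. edgeworth_majorant u \<partial>lborel)"
      by (rule div)
    have "(norm (\<phi> (1 / C)))\<^sup>2 \<le> 1 - char_gap C" using bound_pos by (intro char_square_away_from_zero) simp
    then have "0 \<le> 1 - char_gap C" by (rule order_trans[rotated]) simp
    then show "0 \<le> sqrt (1 - char_gap C) ^ (n - 2)" by simp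
  qed auto
  finally show ?thesis by (simp add: ac_simps)
qed

end

section \<open>Densities that are log-concave up to a bounded factor\<close>

definition laplace_moment :: "nat \<Rightarrow> real" where
  "laplace_moment k = (\<integral>u. \<bar>u\<bar> ^ k * exp (- \<bar>u\<bar>) \<partial>lborel)"

lemma laplace_moment_nonneg: "0 \<le> laplace_moment k"
  unfolding laplace_moment_def by (intro integral_nonneg_AE AE_I2) simp

lemma integrable_laplace_moment: "integrable lborel (\<lambda>u::real. \<bar>u\<bar> ^ k * exp (- \<bar>u\<bar>))"
proof -
  let ?h = "\<lambda>u::real. erlang_density 0 1 u * u ^ k"
  have h0: "0 \<le> ?h u" for u by (simp add: erlang_density_def)
  have h: "integrable lborel ?h"
  proof (rule integrableI_bounded)
    have "(\<integral>\<^sup>+u. ennreal (norm (?h u)) \<partial>lborel) = (\<integral>\<^sup>+u. ennreal (?h u) \<partial>lborel)"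
      by (intro nn_integral_cong) (simp add: erlang_density_def)
    also have "\<dots> < \<infinity>" by (subst nn_integral_erlang_ith_moment) auto
    finally show "(\<integral>\<^sup>+u. ennreal (norm (?h u)) \<partial>lborel) < \<infinity>" .
  qed measurable
  have h': "integrable lborel (\<lambda>u. ?h (0 + (-1) * u))"
    by (rule lborel_integrable_real_affine[OF h]) simp
  show ?thesis
  proof (rule Bochner_Integration.integrable_bound[OF Bochner_Integration.integrable_add[OF h h']])
    show "AE u in lborel. norm (\<bar>u\<bar> ^ k * exp (- \<bar>u\<bar>)) \<le> norm (?h u + ?h (0 + (-1) * u))"
      by (intro AE_I2) (auto simp: erlang_density_def abs_if mult.commute)
  qed measurable
qed

lemma laplace_envelope_moment:
  fixes f :: "real \<Rightarrow> real"
  assumes [measurable]: "f \<in> borel_measurable borel" and f0: "\<And>x. 0 \<le> f x" and D: "0 < D"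
    and env: "\<And>x. f x \<le> A / D * exp (- (\<bar>x - x0\<bar> / D))"
  shows "integrable lborel (\<lambda>x. f x * \<bar>x - x0\<bar> ^ k)"
    and "(\<integral>x. f x * \<bar>x - x0\<bar> ^ k \<partial>lborel) \<le> A * D ^ k * laplace_moment k"
proof -
  let ?e = "\<lambda>x. A / D * exp (- (\<bar>x - x0\<bar> / D)) * \<bar>x - x0\<bar> ^ k"
  have aff: "?e x = A * D ^ k / D * (\<bar>- x0 / D + 1 / D * x\<bar> ^ k * exp (- \<bar>- x0 / D + 1 / D * x\<bar>))" for x
  proof -
    have "- x0 / D + 1 / D * x = (x - x0) / D" by (simp add: diff_divide_distrib)
    then have "\<bar>- x0 / D + 1 / D * x\<bar> = \<bar>x - x0\<bar> / D" using D by (simp add: abs_divide)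
    then show ?thesis using D by (simp add: power_divide)
  qed
  have e: "integrable lborel ?e"
    unfolding aff using D
    by (intro integrable_mult_right lborel_integrable_real_affine[OF integrable_laplace_moment]) simp
  have "laplace_moment k = \<bar>1 / D\<bar> *\<^sub>R (\<integral>x. \<bar>- x0 / D + 1 / D * x\<bar> ^ k * exp (- \<bar>- x0 / D + 1 / D * x\<bar>) \<partial>lborel)"
    unfolding laplace_moment_def using D by (intro lborel_integral_real_affine) simp
  then have "(\<integral>x. ?e x \<partial>lborel) = A * D ^ k * laplace_moment k"
    unfolding aff integral_mult_right_zero using D by simp
  moreover have le: "f x * \<bar>x - x0\<bar> ^ k \<le> ?e x" for x
    by (intro mult_right_mono env) simp
  moreover show i: "integrable lborel (\<lambda>x. f x * \<bar>x - x0\<bar> ^ k)"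
  proof (rule Bochner_Integration.integrable_bound[OF e])
    show "AE x in lborel. norm (f x * \<bar>x - x0\<bar> ^ k) \<le> norm (?e x)"
    proof (rule AE_I2)
      fix x
      have "norm (f x * \<bar>x - x0\<bar> ^ k) = f x * \<bar>x - x0\<bar> ^ k" using f0 by simp
      also have "\<dots> \<le> norm (?e x)" using le[of x] unfolding real_norm_def by (rule order_trans[OF _ abs_ge_self])
      finally show "norm (f x * \<bar>x - x0\<bar> ^ k) \<le> norm (?e x)" .
    qed
  qed measurable
  ultimately show "(\<integral>x. f x * \<bar>x - x0\<bar> ^ k \<partial>lborel) \<le> A * D ^ k * laplace_moment k"
    using integral_mono[OF i e le] by simp
qed

definition envelope_bound :: "real \<Rightarrow> real" where
  "envelope_bound A = max (A * sqrt (A * laplace_moment 2))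
     (8 * (A * (6 * A) ^ 4 * laplace_moment 4 + (A * (6 * A)\<^sup>2 * laplace_moment 2)\<^sup>2))"

text \<open>An envelope of height \<open>A / D\<close> and width \<open>D\<close> has a variance of order \<open>D\<^sup>2\<close>, so that variance 1
prevents \<open>D\<close> from being too small, which bounds the height. It also prevents \<open>D\<close> from being too large, since
by Chebyshev's inequality the interval \<open>(- 2, 2]\<close> carries at least \<open>3 / 4\<close> of the mass under a
density of height at most \<open>A / D\<close>. The centre \<open>x0\<close> of the envelope is within a bounded distance of
the mean 0, because the second moment about \<open>x0\<close> is \<open>1 + x0\<^sup>2\<close>.\<close>

lemma standardized_density_if_laplace_envelope:
  fixes f :: "real \<Rightarrow> real"
  assumes [measurable]: "f \<in> borel_measurable borel" and f0: "\<And>x. 0 \<le> f x" and D: "0 < D"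
    and env: "\<And>x. f x \<le> A / D * exp (- (\<bar>x - x0\<bar> / D))"
    and int: "integrable lborel f" and total: "(\<integral>x. f x \<partial>lborel) = 1"
    and mean: "(\<integral>x. f x * x \<partial>lborel) = 0" and variance: "(\<integral>x. f x * x\<^sup>2 \<partial>lborel) = 1"
  shows "\<And>x. f x \<le> envelope_bound A"
    and "integrable lborel (\<lambda>x. f x * x ^ 4)"
    and "(\<integral>x. f x * x ^ 4 \<partial>lborel) \<le> envelope_bound A"
proof -
  note moment = laplace_envelope_moment[OF assms(1) f0 D env]
  have A: "0 < A"
  proof (rule ccontr)
    assume "\<not> 0 < A"
    then have "A / D * exp (- (\<bar>x - x0\<bar> / D)) \<le> 0" for x
      using D by (intro mult_nonpos_nonneg divide_nonpos_pos) auto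
    then have "f x = 0" for x using env[of x] f0[of x] by (meson order.antisym order_trans)
    then show False using total by simp
  qed
  have sup: "f x \<le> A / D" for x
  proof -
    have "A / D * exp (- (\<bar>x - x0\<bar> / D)) \<le> A / D * 1" using A D by (intro mult_left_mono) auto
    then show ?thesis using env[of x] by simp
  qed
  have i1: "integrable lborel (\<lambda>x. f x * x)"
  proof (rule Bochner_Integration.integrable_bound)
    show "integrable lborel (\<lambda>x. f x * \<bar>x - x0\<bar> ^ 1 + \<bar>x0\<bar> * f x)"
      by (intro Bochner_Integration.integrable_add moment integrable_mult_right int)
    have "f x * \<bar>x\<bar> \<le> f x * (\<bar>x - x0\<bar> + \<bar>x0\<bar>)" for x using f0 by (intro mult_left_mono) auto
    then show "AE x in lborel. norm (f x * x) \<le> norm (f x * \<bar>x - x0\<bar> ^ 1 + \<bar>x0\<bar> * f x)"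
      using f0 by (intro AE_I2) (auto simp: abs_mult algebra_simps intro: order_trans[OF _ abs_ge_self])
  qed measurable
  have i2: "integrable lborel (\<lambda>x. f x * x\<^sup>2)"
    using variance not_integrable_integral_eq by fastforce
  have i4: "integrable lborel (\<lambda>x. f x * \<bar>x - x0\<bar> ^ 4)" by (rule moment)
  have quart: "x ^ 4 \<le> 8 * (\<bar>x - x0\<bar> ^ 4 + x0 ^ 4)" for x
  proof -
    have sq: "(a + b)\<^sup>2 \<le> 2 * (a\<^sup>2 + b\<^sup>2)" for a b :: real
      using sum_squares_bound[of a b] by (simp add: power2_sum)
    have "x\<^sup>2 \<le> 2 * ((x - x0)\<^sup>2 + x0\<^sup>2)" using sq[of "x - x0" x0] by simp
    then have "(x\<^sup>2)\<^sup>2 \<le> (2 * ((x - x0)\<^sup>2 + x0\<^sup>2))\<^sup>2" by (intro power_mono) auto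
    also have "\<dots> = 4 * ((x - x0)\<^sup>2 + x0\<^sup>2)\<^sup>2" by (simp only: power_mult_distrib) simp
    also have "\<dots> \<le> 4 * (2 * (((x - x0)\<^sup>2)\<^sup>2 + (x0\<^sup>2)\<^sup>2))" by (intro mult_left_mono sq) auto
    finally show ?thesis by simp
  qed
  have i4': "integrable lborel (\<lambda>x. 8 * (f x * \<bar>x - x0\<bar> ^ 4 + x0 ^ 4 * f x))"
    by (intro integrable_mult_right Bochner_Integration.integrable_add i4 int)
  have q: "f x * x ^ 4 \<le> 8 * (f x * \<bar>x - x0\<bar> ^ 4 + x0 ^ 4 * f x)" for x
    using mult_left_mono[OF quart[of x] f0[of x]] by (simp add: algebra_simps)
  show fourth: "integrable lborel (\<lambda>x. f x * x ^ 4)"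
  proof (rule Bochner_Integration.integrable_bound[OF i4'])
    show "AE x in lborel. norm (f x * x ^ 4) \<le> norm (8 * (f x * \<bar>x - x0\<bar> ^ 4 + x0 ^ 4 * f x))"
      using q f0 by (intro AE_I2) (auto simp: abs_mult intro: order_trans[OF _ abs_ge_self])
  qed measurable
  have "(\<integral>x. f x * \<bar>x - x0\<bar> ^ 2 \<partial>lborel) = (\<integral>x. f x * x\<^sup>2 - 2 * x0 * (f x * x) + x0\<^sup>2 * f x \<partial>lborel)"
    by (intro Bochner_Integration.integral_cong) (auto simp: power2_diff algebra_simps)
  also have "\<dots> = 1 + x0\<^sup>2" using i1 i2 int mean variance total by simp
  finally have second: "1 + x0\<^sup>2 \<le> A * D\<^sup>2 * laplace_moment 2" using moment(2)[of 2] by simp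
  have Dlow: "1 \<le> D * sqrt (A * laplace_moment 2)"
  proof -
    have "1 \<le> D\<^sup>2 * (A * laplace_moment 2)" using second by (simp add: ac_simps) (metis add_increasing2 le_add_same_cancel1 order_trans zero_le_power2)
    then have "sqrt 1 \<le> sqrt (D\<^sup>2 * (A * laplace_moment 2))" by (rule real_sqrt_le_mono)
    then show ?thesis using D by (simp add: real_sqrt_mult)
  qed
  show "f x \<le> envelope_bound A" for x
  proof -
    have "A / D \<le> A / D * (D * sqrt (A * laplace_moment 2))"
      using Dlow A D mult_left_mono[of 1 "D * sqrt (A * laplace_moment 2)" "A / D"] by simp
    also have "\<dots> = A * sqrt (A * laplace_moment 2)" using D by simp
    finally show ?thesis using sup[of x] unfolding envelope_bound_def by linarith
  qed
  have Dup: "D \<le> 6 * A"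
  proof -
    have ib: "integrable lborel (\<lambda>x. A / D * indicator {-2<..2} x + f x * x\<^sup>2 / 4)"
      by (intro Bochner_Integration.integrable_add integrable_mult_right integrable_indicator_Ioc)
        (use i2 in simp)
    have "f x \<le> A / D * indicator {-2<..2} x + f x * x\<^sup>2 / 4" for x
    proof (cases "x \<in> {-2<..2}")
      case True
      then show ?thesis using sup[of x] f0[of x] by (simp add: add_increasing2)
    next
      case False
      then have "2 \<le> \<bar>x\<bar>" by auto
      then have "2\<^sup>2 \<le> \<bar>x\<bar>\<^sup>2" by (intro power_mono) auto
      then have "f x * 4 \<le> f x * x\<^sup>2" using f0 by (intro mult_left_mono) auto
      then show ?thesis using False by simp
    qed
    from integral_mono[OF int ib this]
    have "1 \<le> A / D * 4 + 1 / 4" using total variance i2 by (simp add: integrable_indicator_Ioc)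
    then have "3 * D \<le> 16 * A" using D by (simp add: field_simps)
    then show ?thesis using A by simp
  qed
  have x0: "x0\<^sup>2 \<le> A * (6 * A)\<^sup>2 * laplace_moment 2"
  proof -
    have "A * D\<^sup>2 * laplace_moment 2 \<le> A * (6 * A)\<^sup>2 * laplace_moment 2"
      using A D Dup by (intro mult_right_mono mult_left_mono power_mono laplace_moment_nonneg) auto
    then show ?thesis using second by linarith
  qed
  have "(\<integral>x. f x * x ^ 4 \<partial>lborel) \<le> (\<integral>x. 8 * (f x * \<bar>x - x0\<bar> ^ 4 + x0 ^ 4 * f x) \<partial>lborel)"
    by (intro integral_mono fourth i4' q)
  also have "\<dots> = 8 * ((\<integral>x. f x * \<bar>x - x0\<bar> ^ 4 \<partial>lborel) + (x0\<^sup>2)\<^sup>2)"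
    using i4 int total by simp
  also have "\<dots> \<le> 8 * (A * (6 * A) ^ 4 * laplace_moment 4 + (A * (6 * A)\<^sup>2 * laplace_moment 2)\<^sup>2)"
  proof (intro mult_left_mono add_mono power_mono x0)
    have "A * D ^ 4 * laplace_moment 4 \<le> A * (6 * A) ^ 4 * laplace_moment 4"
      using A D Dup by (intro mult_right_mono mult_left_mono power_mono laplace_moment_nonneg) auto
    then show "(\<integral>x. f x * \<bar>x - x0\<bar> ^ 4 \<partial>lborel) \<le> A * (6 * A) ^ 4 * laplace_moment 4"
      using moment(2)[of 4] by linarith
  qed auto
  also have "\<dots> \<le> envelope_bound A" unfolding envelope_bound_def by simp
  finally show "(\<integral>x. f x * x ^ 4 \<partial>lborel) \<le> envelope_bound A" .
qed

text \<open>Let \<open>v0\<close> be the infimum of \<open>V\<close>. On the set \<open>V \<le> v0 + 2\<close>, which is an interval, the density is at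
least \<open>1 / L\<close>; as its mass is at most 1, this interval has length at most \<open>L\<close>. Hence \<open>V\<close>, nearly
minimal at \<open>x0\<close>, has grown by more than 1 at distance \<open>2 L\<close>, and by convexity it grows at least
linearly with slope \<open>1 / (2 L)\<close> from there on. The infimum need not be attained, so that \<open>x0\<close> is
only a point where \<open>V\<close> is less than \<open>v0 + 1\<close>.\<close>

lemma log_concave_up_to_factor_envelope:
  fixes f V :: "real \<Rightarrow> real"
  assumes K: "1 \<le> K" and [measurable]: "f \<in> borel_measurable borel"
    and int: "integrable lborel f" and total: "(\<integral>x. f x \<partial>lborel) = 1"
    and f0: "\<And>x. 0 \<le> f x" and off: "\<And>x. x \<notin> S \<Longrightarrow> f x = 0"
    and V: "convex_on S V" and bdd: "bdd_below (V ` S)"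
    and lower: "\<And>x. x \<in> S \<Longrightarrow> exp (- V x) / K \<le> f x"
    and upper: "\<And>x. x \<in> S \<Longrightarrow> f x \<le> K * exp (- V x)"
  obtains x0 D where "0 < D" "\<And>x. f x \<le> (2 * K\<^sup>2 * exp 3) / D * exp (- (\<bar>x - x0\<bar> / D))"
proof -
  have S: "S \<noteq> {}"
  proof
    assume "S = {}"
    then have "f = (\<lambda>x. 0)" using off by auto
    then show False using total by simp
  qed
  have cS: "convex S" using V by (simp add: convex_on_def)
  define v0 where "v0 = Inf (V ` S)"
  have v0: "v0 \<le> V x" if "x \<in> S" for x
    unfolding v0_def using bdd that by (intro cInf_lower) auto
  obtain x0 where x0: "x0 \<in> S" "V x0 < v0 + 1"
    using cInf_lessD[of "V ` S" "v0 + 1"] S unfolding v0_def by auto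
  define L where "L = K * exp (v0 + 2)"
  have L: "0 < L" using K by (simp add: L_def)
  define D where "D = 2 * L"
  have D: "0 < D" using L by (simp add: D_def)
  have far: "v0 + 2 < V z" if z: "z \<in> S" "L < \<bar>z - x0\<bar>" for z
  proof (rule ccontr)
    assume "\<not> v0 + 2 < V z"
    then have Vz: "V z \<le> v0 + 2" by simp
    define a b where "a = min z x0" and "b = max z x0"
    have ab: "a \<le> b" "b - a = \<bar>z - x0\<bar>" by (auto simp: a_def b_def)
    have "indicator {a<..b} y * (1 / L) \<le> f y" for y
    proof (cases "y \<in> {a<..b}")
      case True
      then have seg: "y \<in> closed_segment x0 z"
        by (auto simp: closed_segment_eq_real_ivl a_def b_def min_def max_def split: if_splits)
      then have yS: "y \<in> S" using cS x0(1) z(1) closed_segment_subset by blast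
      obtain u where u: "y = (1 - u) *\<^sub>R x0 + u *\<^sub>R z" "0 \<le> u" "u \<le> 1"
        using seg unfolding closed_segment_def by blast
      have "V y \<le> (1 - u) * V x0 + u * V z"
        unfolding u(1) using convex_onD[OF V, of u x0 z] u x0 z by simp
      also have "\<dots> \<le> v0 + 2"
        using u x0 Vz by (intro convex_bound_le) auto
      finally have "V y \<le> v0 + 2" .
      then have "exp (- (v0 + 2)) / K \<le> exp (- V y) / K" using K by (intro divide_right_mono) auto
      also have "\<dots> \<le> f y" by (rule lower[OF yS])
      finally show ?thesis using True by (simp add: L_def exp_minus field_simps exp_add exp_diff)
    qed (use f0 in simp)
    then have "(\<integral>y. indicator {a<..b} y * (1 / L) \<partial>lborel) \<le> (\<integral>y. f y \<partial>lborel)"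
      by (intro integral_mono int integrable_mult_left integrable_indicator_Ioc)
    then have "\<bar>z - x0\<bar> / L \<le> 1" using ab total by simp
    then show False using z(2) L by (simp add: field_simps)
  qed
  have grow: "v0 + \<bar>x - x0\<bar> / D - 1 \<le> V x" if x: "x \<in> S" for x
  proof (cases "\<bar>x - x0\<bar> \<le> D")
    case True
    then have "\<bar>x - x0\<bar> / D \<le> 1" using D by simp
    then show ?thesis using v0[OF x] by linarith
  next
    case False
    define r where "r = D / \<bar>x - x0\<bar>"
    have l: "0 < r" "r < 1" using False D by (auto simp: r_def field_simps)
    define z where "z = (1 - r) *\<^sub>R x0 + r *\<^sub>R x"
    have z: "z \<in> S" unfolding z_def using cS x0 x l by (intro convexD) auto
    have "z - x0 = r * (x - x0)" by (simp add: z_def algebra_simps)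
    then have "\<bar>z - x0\<bar> = D" using l False D by (simp add: abs_mult r_def)
    then have "v0 + 2 < V z" using L by (intro far[OF z]) (simp add: D_def)
    also have "V z \<le> (1 - r) * V x0 + r * V x"
      unfolding z_def using convex_onD[OF V, of r x0 x] l x0 x by simp
    finally have "1 < r * (V x - V x0)" using x0(2) by (simp add: algebra_simps)
    then have "1 / r < V x - V x0" using l by (simp add: field_simps)
    then have "\<bar>x - x0\<bar> / D < V x - V x0" by (simp add: r_def)
    then show ?thesis using v0[OF x0(1)] by linarith
  qed
  have "f x \<le> (2 * K\<^sup>2 * exp 3) / D * exp (- (\<bar>x - x0\<bar> / D))" for x
  proof (cases "x \<in> S")
    case True
    have "f x \<le> K * exp (- V x)" by (rule upper[OF True])
    also have "\<dots> \<le> K * exp (1 - v0 - \<bar>x - x0\<bar> / D)"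
      using grow[OF True] K by (intro mult_left_mono) auto
    also have "\<dots> = (2 * K\<^sup>2 * exp 3) / D * exp (- (\<bar>x - x0\<bar> / D))"
    proof -
      have "exp (1 - v0 - \<bar>x - x0\<bar> / D) = exp 3 / exp (v0 + 2) * exp (- (\<bar>x - x0\<bar> / D))"
        by (simp flip: exp_diff exp_add)
      then show ?thesis using K by (simp add: D_def L_def power2_eq_square)
    qed
    finally show ?thesis .
  qed (use off K D in simp)
  with D show ?thesis by (rule that)
qed

section \<open>Exponential families\<close>

text \<open>A positive weight on the half-line whose exponential moments are all finite. With \<open>F k\<close> the \<open>k\<close>-th derivative of
the moment generating function, the cumulants of the tilted densities are rational expressions
in the \<open>F k\<close>.\<close>

locale exponential_family =
  fixes p :: "real \<Rightarrow> real"
  assumes p_measurable [measurable]: "p \<in> borel_measurable borel"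
    and p_neg: "\<And>x. x < 0 \<Longrightarrow> p x = 0"
    and p_pos: "\<And>x. 0 \<le> x \<Longrightarrow> 0 < p x"
    and exp_integrable: "\<And>t. integrable lborel (\<lambda>x. exp (t * x) * p x)"
begin

definition F :: "nat \<Rightarrow> real \<Rightarrow> real" where
  "F k t = (\<integral>x. x ^ k * (exp (t * x) * p x) \<partial>lborel)"

lemma p_nonneg: "0 \<le> p x"
  using p_neg[of x] p_pos[of x] by (cases "x < 0") auto

lemma integrable_F: "integrable lborel (\<lambda>x. x ^ k * (exp (t * x) * p x))"
proof (rule Bochner_Integration.integrable_bound[OF exp_integrable[of "real k + t"]])
  show "AE x in lborel. norm (x ^ k * (exp (t * x) * p x)) \<le> norm (exp ((real k + t) * x) * p x)"
  proof (rule AE_I2)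
    fix x :: real
    show "norm (x ^ k * (exp (t * x) * p x)) \<le> norm (exp ((real k + t) * x) * p x)"
    proof (cases "x < 0")
      case False
      have "x ^ k \<le> exp x ^ k"
        using False by (intro power_mono order_trans[OF _ exp_ge_add_one_self]) auto
      then have "x ^ k * (exp (t * x) * p x) \<le> exp x ^ k * (exp (t * x) * p x)"
        by (intro mult_right_mono) (auto simp: p_nonneg)
      also have "\<dots> = exp ((real k + t) * x) * p x"
        by (simp add: distrib_right exp_add exp_of_nat_mult)
      finally show ?thesis using False p_nonneg[of x] by (simp add: abs_mult)
    qed (simp add: p_neg)
  qed
qed measurable

text \<open>For an increment \<open>h\<close> with \<open>\<bar>h\<bar> \<le> 1\<close> and for \<open>x \<ge> 0\<close>, the remainder \<open>exp (h x) - 1 - h x\<close> is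
at most \<open>h\<^sup>2 x\<^sup>2 exp x\<close>, and integration turns this bound into \<open>h\<^sup>2\<close> times \<open>F (k + 2) (t + 1)\<close>.\<close>

lemma F_has_derivative: "(F k has_real_derivative F (Suc k) t) (at t)"
proof -
  have bound: "norm (F k y - F k t - F (Suc k) t * (y - t)) \<le> F (Suc (Suc k)) (t + 1) * norm (y - t) * norm (y - t)"
    if y: "\<bar>y - t\<bar> \<le> 1" for y
  proof -
    define h where "h = y - t"
    have "F k y - F k t - F (Suc k) t * h
       = (\<integral>x. x ^ k * (exp (y * x) * p x) - x ^ k * (exp (t * x) * p x) - x ^ Suc k * (exp (t * x) * p x) * h \<partial>lborel)"
      unfolding F_def using integrable_F by (simp del: power_Suc)
    also have "\<dots> = (\<integral>x. x ^ k * (exp (t * x) * p x) * (exp (h * x) - 1 - h * x) \<partial>lborel)"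
    proof (rule Bochner_Integration.integral_cong[OF refl])
      fix x
      have "exp (y * x) = exp (t * x) * exp (h * x)"
        by (simp add: h_def algebra_simps flip: exp_add)
      then show "x ^ k * (exp (y * x) * p x) - x ^ k * (exp (t * x) * p x) - x ^ Suc k * (exp (t * x) * p x) * h
         = x ^ k * (exp (t * x) * p x) * (exp (h * x) - 1 - h * x)"
        by (simp add: algebra_simps)
    qed
    finally have eq: "F k y - F k t - F (Suc k) t * h = (\<integral>x. x ^ k * (exp (t * x) * p x) * (exp (h * x) - 1 - h * x) \<partial>lborel)" .
    have i2: "integrable lborel (\<lambda>x. h\<^sup>2 * (x ^ Suc (Suc k) * (exp ((t + 1) * x) * p x)))"
      by (intro integrable_mult_right integrable_F)
    have pt: "norm (x ^ k * (exp (t * x) * p x) * (exp (h * x) - 1 - h * x)) \<le> h\<^sup>2 * (x ^ Suc (Suc k) * (exp ((t + 1) * x) * p x))" for x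
    proof (cases "x < 0")
      case False
      then have x: "0 \<le> x" by simp
      have "\<bar>exp (h * x) - 1 - h * x\<bar> \<le> exp \<bar>h * x\<bar> * (h * x)\<^sup>2"
        using Taylor_exp_field[of "h * x" 1] by (simp add: power2_eq_square algebra_simps)
      also have "\<dots> \<le> exp x * (h * x)\<^sup>2"
        using y x by (intro mult_right_mono) (auto simp: abs_mult h_def mult_left_le_one_le)
      finally have "x ^ k * (exp (t * x) * p x) * \<bar>exp (h * x) - 1 - h * x\<bar> \<le> x ^ k * (exp (t * x) * p x) * (exp x * (h * x)\<^sup>2)"
        using x p_nonneg by (intro mult_left_mono) auto
      also have "\<dots> = h\<^sup>2 * (x ^ Suc (Suc k) * (exp ((t + 1) * x) * p x))"
        by (simp add: distrib_right exp_add power2_eq_square)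
      finally show ?thesis using x p_nonneg[of x] by (simp add: abs_mult)
    qed (simp add: p_neg)
    have "norm (F k y - F k t - F (Suc k) t * h) \<le> (\<integral>x. h\<^sup>2 * (x ^ Suc (Suc k) * (exp ((t + 1) * x) * p x)) \<partial>lborel)"
      unfolding eq
    proof (rule Bochner_Integration.integral_norm_bound_integral[OF _ i2 pt])
      show "integrable lborel (\<lambda>x. x ^ k * (exp (t * x) * p x) * (exp (h * x) - 1 - h * x))"
        by (rule Bochner_Integration.integrable_bound[OF i2])
          (measurable, intro AE_I2 order_trans[OF pt], simp only: real_norm_def abs_ge_self)
    qed
    also have "\<dots> = F (Suc (Suc k)) (t + 1) * norm h * norm h"
      unfolding integral_mult_right_zero F_def by (simp add: power2_eq_square)
    finally show ?thesis by (simp add: h_def)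
  qed
  show ?thesis
    unfolding has_field_derivative_def has_derivative_iff_norm
  proof (intro conjI)
    show "bounded_linear ((*) (F (Suc k) t))" by (rule bounded_linear_mult_right)
    have "((\<lambda>y. F (Suc (Suc k)) (t + 1) * norm (y - t)) \<longlongrightarrow> F (Suc (Suc k)) (t + 1) * norm (t - t)) (at t)"
      by (intro tendsto_intros)
    then have lim: "((\<lambda>y. F (Suc (Suc k)) (t + 1) * norm (y - t)) \<longlongrightarrow> 0) (at t)" by simp
    show "((\<lambda>y. norm (F k y - F k t - F (Suc k) t * (y - t)) / norm (y - t)) \<longlongrightarrow> 0) (at t)"
    proof (rule tendsto_sandwich[OF _ _ tendsto_const lim])
      show "\<forall>\<^sub>F y in at t. norm (F k y - F k t - F (Suc k) t * (y - t)) / norm (y - t) \<le> F (Suc (Suc k)) (t + 1) * norm (y - t)"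
        unfolding eventually_at
      proof (intro exI[of _ 1] conjI ballI impI)
        fix y assume "y \<noteq> t \<and> dist y t < 1"
        then show "norm (F k y - F k t - F (Suc k) t * (y - t)) / norm (y - t) \<le> F (Suc (Suc k)) (t + 1) * norm (y - t)"
          using bound[of y] by (simp add: divide_le_eq dist_real_def)
      qed simp
    qed simp
  qed
qed

text \<open>The exceptional point \<open>c\<close> allows for weights with a single zero, such as the squared distance from the mean.\<close>

lemma weighted_integral_pos:
  assumes int: "integrable lborel (\<lambda>x. w x * p x)" and w0: "\<And>x. 0 \<le> w x"
    and w: "\<And>x. x \<in> {b<..b + 1} \<Longrightarrow> x \<noteq> c \<Longrightarrow> 0 < w x" and b: "0 \<le> b"
  shows "0 < (\<integral>x. w x * p x \<partial>lborel)"
proof (rule ccontr)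
  have nn: "AE x in lborel. 0 \<le> w x * p x" by (simp add: w0 p_nonneg)
  assume "\<not> ?thesis"
  moreover have "0 \<le> (\<integral>x. w x * p x \<partial>lborel)" by (rule integral_nonneg_AE[OF nn])
  ultimately have "(\<integral>x. w x * p x \<partial>lborel) = 0" by simp
  then have "AE x in lborel. w x * p x = 0"
    using integral_nonneg_eq_0_iff_AE[OF int nn] by simp
  with AE_lborel_singleton[of c] have "AE x in lborel. x \<notin> {b<..b + 1}"
  proof eventually_elim
    case (elim x)
    show ?case
    proof
      assume x: "x \<in> {b<..b + 1}"
      then have "0 < w x * p x" using w[OF x] elim b p_pos[of x] by (intro mult_pos_pos) auto
      then show False using elim by simp
    qed
  qed
  then have "emeasure lborel {b<..b + 1} = 0"
    by (subst (asm) AE_iff_null_sets[symmetric]) auto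
  then show False by simp
qed

lemma F0_pos: "0 < F 0 t"
proof -
  have "0 < (\<integral>x. exp (t * x) * p x \<partial>lborel)"
    by (rule weighted_integral_pos[where b=0 and c=0]) (auto intro: exp_integrable)
  then show ?thesis by (simp add: F_def)
qed

definition mean :: "real \<Rightarrow> real" where "mean t = F 1 t / F 0 t"
definition var :: "real \<Rightarrow> real" where "var t = F 2 t / F 0 t - (mean t)\<^sup>2"
definition third :: "real \<Rightarrow> real" where
  "third t = F 3 t / F 0 t - 3 * mean t * (F 2 t / F 0 t) + 2 * mean t ^ 3"

lemma ratio_has_derivative:
  "((\<lambda>t. F k t / F 0 t) has_real_derivative F (Suc k) t / F 0 t - mean t * (F k t / F 0 t)) (at t)"
proof -
  have "((\<lambda>t. F k t / F 0 t) has_real_derivative (F (Suc k) t * F 0 t - F k t * F (Suc 0) t) / (F 0 t * F 0 t)) (at t)"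
    using F0_pos[of t] by (intro DERIV_divide F_has_derivative) simp
  also have "(F (Suc k) t * F 0 t - F k t * F (Suc 0) t) / (F 0 t * F 0 t) = F (Suc k) t / F 0 t - mean t * (F k t / F 0 t)"
    using F0_pos[of t] by (simp add: mean_def field_simps)
  finally show ?thesis .
qed

lemma log_F_has_derivative: "((\<lambda>t. ln (F 0 t)) has_real_derivative mean t) (at t)"
  using F0_pos[of t] F_has_derivative[of 0 t]
  by (auto intro!: derivative_eq_intros simp: mean_def)

lemma mean_has_derivative: "(mean has_real_derivative var t) (at t)"
  using ratio_has_derivative[of 1 t]
  by (simp add: mean_def[abs_def, symmetric] var_def power2_eq_square numeral_2_eq_2)
    (simp add: mean_def[abs_def])

lemma var_has_derivative: "(var has_real_derivative third t) (at t)"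
proof -
  have "((\<lambda>t. F 2 t / F 0 t - (mean t)\<^sup>2) has_real_derivative
      (F (Suc 2) t / F 0 t - mean t * (F 2 t / F 0 t)) - (2 * mean t * var t)) (at t)"
    by (intro DERIV_diff ratio_has_derivative) (auto intro!: derivative_eq_intros mean_has_derivative)
  also have "(F (Suc 2) t / F 0 t - mean t * (F 2 t / F 0 t)) - (2 * mean t * var t) = third t"
    unfolding third_def var_def by (simp add: algebra_simps power2_eq_square power3_eq_cube)
  finally show ?thesis by (simp add: var_def[abs_def])
qed

lemma central_moments:
  shows "(\<integral>x. (x - mean t) * (exp (t * x) * p x) \<partial>lborel) = 0"
    and "(\<integral>x. (x - mean t)\<^sup>2 * (exp (t * x) * p x) \<partial>lborel) = F 0 t * var t"
    and "(\<integral>x. (x - mean t) ^ 3 * (exp (t * x) * p x) \<partial>lborel) = F 0 t * third t"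
proof -
  let ?w = "\<lambda>k x. x ^ k * (exp (t * x) * p x)"
  have p1: "(x - m) * W = x ^ 1 * W - m * (x ^ 0 * W)" for x m W :: real
    by (simp add: algebra_simps)
  have p2: "(x - m)\<^sup>2 * W = x\<^sup>2 * W - 2 * m * (x ^ 1 * W) + m\<^sup>2 * (x ^ 0 * W)" for x m W :: real
    by (simp add: algebra_simps power2_eq_square)
  have p3: "(x - m) ^ 3 * W = x ^ 3 * W - 3 * m * (x\<^sup>2 * W) + 3 * m\<^sup>2 * (x ^ 1 * W) - m ^ 3 * (x ^ 0 * W)" for x m W :: real
    by (simp add: algebra_simps power2_eq_square power3_eq_cube)
  have F1: "F 1 t = mean t * F 0 t" using F0_pos[of t] by (simp add: mean_def)
  have "(\<integral>x. (x - mean t) * (exp (t * x) * p x) \<partial>lborel) = (\<integral>x. ?w 1 x - mean t * ?w 0 x \<partial>lborel)"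
    by (simp only: p1)
  also have "\<dots> = F 1 t - mean t * F 0 t"
    unfolding F_def using integrable_F by (simp only: Bochner_Integration.integral_diff integrable_mult_right integral_mult_right_zero)
  finally show "(\<integral>x. (x - mean t) * (exp (t * x) * p x) \<partial>lborel) = 0" using F1 by simp
  have "(\<integral>x. (x - mean t)\<^sup>2 * (exp (t * x) * p x) \<partial>lborel)
      = (\<integral>x. ?w 2 x - 2 * mean t * ?w 1 x + (mean t)\<^sup>2 * ?w 0 x \<partial>lborel)"
    by (simp only: p2)
  also have "\<dots> = F 2 t - 2 * mean t * F 1 t + (mean t)\<^sup>2 * F 0 t"
    unfolding F_def using integrable_F
    by (simp only: Bochner_Integration.integral_add Bochner_Integration.integral_diff Bochner_Integration.integrable_diff integrable_mult_right integral_mult_right_zero)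
  also have "\<dots> = F 0 t * var t"
    using F0_pos[of t] unfolding F1 var_def by (simp add: algebra_simps power2_eq_square)
  finally show "(\<integral>x. (x - mean t)\<^sup>2 * (exp (t * x) * p x) \<partial>lborel) = F 0 t * var t" .
  have "(\<integral>x. (x - mean t) ^ 3 * (exp (t * x) * p x) \<partial>lborel)
      = (\<integral>x. ?w 3 x - 3 * mean t * ?w 2 x + 3 * (mean t)\<^sup>2 * ?w 1 x - mean t ^ 3 * ?w 0 x \<partial>lborel)"
    by (simp only: p3)
  also have "\<dots> = F 3 t - 3 * mean t * F 2 t + 3 * (mean t)\<^sup>2 * F 1 t - mean t ^ 3 * F 0 t"
    unfolding F_def using integrable_F
    by (simp only: Bochner_Integration.integral_add Bochner_Integration.integral_diff Bochner_Integration.integrable_add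
        Bochner_Integration.integrable_diff integrable_mult_right integral_mult_right_zero)
  also have "\<dots> = F 0 t * third t"
    using F0_pos[of t] unfolding F1 third_def by (simp add: algebra_simps power2_eq_square power3_eq_cube)
  finally show "(\<integral>x. (x - mean t) ^ 3 * (exp (t * x) * p x) \<partial>lborel) = F 0 t * third t" .
qed

lemma var_pos: "0 < var t"
proof -
  have "0 < (\<integral>x. ((x - mean t)\<^sup>2 * exp (t * x)) * p x \<partial>lborel)"
  proof (rule weighted_integral_pos[where b=0 and c="mean t"])
    have p2: "(x - m)\<^sup>2 * W = x ^ 2 * W - 2 * m * (x ^ 1 * W) + m\<^sup>2 * (x ^ 0 * W)" for x m W :: real
      by (simp add: algebra_simps power2_eq_square)
    have "integrable lborel (\<lambda>x. x ^ 2 * (exp (t * x) * p x) - 2 * mean t * (x ^ 1 * (exp (t * x) * p x)) + (mean t)\<^sup>2 * (x ^ 0 * (exp (t * x) * p x)))"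
      by (intro Bochner_Integration.integrable_add Bochner_Integration.integrable_diff integrable_mult_right integrable_F)
    then have "integrable lborel (\<lambda>x. (x - mean t)\<^sup>2 * (exp (t * x) * p x))"
      by (simp only: p2)
    then show "integrable lborel (\<lambda>x. ((x - mean t)\<^sup>2 * exp (t * x)) * p x)"
      by (simp only: mult.assoc)
    show "0 \<le> (x - mean t)\<^sup>2 * exp (t * x)" for x by simp
    show "0 < (x - mean t)\<^sup>2 * exp (t * x)" if "x \<noteq> mean t" for x using that by simp
  qed simp
  then have "0 < F 0 t * var t" by (simp only: central_moments(2) mult.assoc)
  then show ?thesis using F0_pos[of t] by (simp only: zero_less_mult_pos)
qed

lemma mean_strict_mono: "t < u \<Longrightarrow> mean t < mean u"
proof (rule DERIV_pos_imp_increasing[where f = mean])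
  fix x
  show "\<exists>y. (mean has_real_derivative y) (at x) \<and> 0 < y"
    by (rule exI[of _ "var x"]) (simp add: mean_has_derivative var_pos)
qed

text \<open>If the mean stayed below \<open>a\<close>, then \<open>F 0 t\<close>, whose logarithmic derivative is the mean, would grow at
most like \<open>exp (a t)\<close>. But it grows at least like \<open>exp (b t)\<close> for each \<open>b\<close>, because the density has
mass to the right of \<open>b\<close>.\<close>

lemma mean_attains:
  assumes a: "mean 0 \<le> a"
  obtains t where "mean t = a"
proof -
  have "\<exists>t\<ge>0. a < mean t"
  proof (rule ccontr)
    assume "\<not> ?thesis"
    then have le: "mean t \<le> a" if "0 \<le> t" for t using that by (meson not_less)
    define b where "b = \<bar>a\<bar> + 1"
    define c where "c = (\<integral>x. indicator {b<..b + 1} x * p x \<partial>lborel)"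
    have p_int: "integrable lborel p" using exp_integrable[of 0] by simp
    have i: "integrable lborel (\<lambda>x. indicator {b<..b + 1} x * p x)"
      by (rule Bochner_Integration.integrable_bound[OF p_int]) (auto simp: indicator_def)
    have c: "0 < c" unfolding c_def
      by (rule weighted_integral_pos[where b=b and c=b, OF i]) (auto simp: b_def)
    have upper: "ln (F 0 t) - a * t \<le> ln (F 0 0)" if t: "0 \<le> t" for t
    proof -
      have "ln (F 0 t) - a * t \<le> ln (F 0 0) - a * 0"
      proof (rule DERIV_nonpos_imp_nonincreasing[OF t, where f = "\<lambda>t. ln (F 0 t) - a * t"])
        fix u assume u: "0 \<le> u" "u \<le> t"
        have "((\<lambda>t. ln (F 0 t) - a * t) has_real_derivative mean u - a) (at u)"
          by (rule DERIV_diff[OF log_F_has_derivative]) (auto intro!: derivative_eq_intros)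
        then show "\<exists>y. ((\<lambda>t. ln (F 0 t) - a * t) has_real_derivative y) (at u) \<and> y \<le> 0"
          using le[OF u(1)] by (intro exI conjI) auto
      qed
      then show ?thesis by simp
    qed
    have lower: "exp (t * b) * c \<le> F 0 t" if t: "0 \<le> t" for t
    proof -
      have "exp (t * b) * c = (\<integral>x. exp (t * b) * (indicator {b<..b + 1} x * p x) \<partial>lborel)" by (simp add: c_def)
      also have "\<dots> \<le> (\<integral>x. exp (t * x) * p x \<partial>lborel)"
      proof (intro integral_mono exp_integrable integrable_mult_right i)
        fix x
        show "exp (t * b) * (indicator {b<..b + 1} x * p x) \<le> exp (t * x) * p x"
          using t p_nonneg[of x] by (auto simp: indicator_def intro!: mult_right_mono mult_left_mono)
      qed
      finally show ?thesis by (simp add: F_def)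
    qed
    \<comment> \<open>The two growth rates are compatible only if \<open>c exp t \<le> F 0 0\<close>, which fails here since \<open>exp t \<ge> 1 + t\<close>.\<close>
    define t where "t = F 0 0 / c"
    have t: "0 \<le> t" using c F0_pos[of 0] by (simp add: t_def)
    have F0t: "F 0 t \<le> F 0 0 * exp (a * t)"
    proof -
      have "exp (ln (F 0 t)) \<le> exp (ln (F 0 0) + a * t)" using upper[OF t] by simp
      then show ?thesis using F0_pos by (simp add: exp_add)
    qed
    have "exp (a * t) * exp t \<le> exp (t * b)"
    proof -
      have "a * t + t \<le> t * b" using t mult_right_mono[OF abs_ge_self[of a] t] by (simp add: b_def algebra_simps)
      then show ?thesis by (simp flip: exp_add)
    qed
    then have "exp (a * t) * exp t * c \<le> exp (t * b) * c" using c by (intro mult_right_mono) auto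
    also have "\<dots> \<le> F 0 0 * exp (a * t)" using lower[OF t] F0t by (rule order_trans)
    finally have "exp t * c * exp (a * t) \<le> F 0 0 * exp (a * t)" by (simp only: ac_simps)
    then have "exp t * c \<le> F 0 0" by (rule mult_right_le_imp_le) simp
    moreover have "(1 + t) * c \<le> exp t * c" using c by (intro mult_right_mono) auto
    moreover have "(1 + t) * c = c + F 0 0" using c by (simp add: t_def algebra_simps)
    ultimately show False using c by simp
  qed
  then obtain u where u: "0 \<le> u" "a < mean u" by blast
  have "isCont mean x" for x by (rule DERIV_isCont[OF mean_has_derivative])
  then have "\<exists>t\<ge>0. t \<le> u \<and> mean t = a"
    using IVT[of mean 0 a u] a less_imp_le[OF u(2)] u(1) by blast
  then show ?thesis using that by blast
qed

end

section \<open>Normalized tilted densities\<close>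

context exponential_family
begin

definition normalized_density :: "real \<Rightarrow> real \<Rightarrow> real" where
  "normalized_density t x = sqrt (var t) * (exp (t * (sqrt (var t) * x + mean t)) * p (sqrt (var t) * x + mean t) / F 0 t)"

lemma normalized_density_measurable [measurable]: "normalized_density t \<in> borel_measurable borel"
  unfolding normalized_density_def by measurable

lemma normalized_density_nonneg: "0 \<le> normalized_density t x"
  unfolding normalized_density_def using F0_pos[of t] p_nonneg var_pos[of t] by (simp add: less_imp_le)

lemma integral_normalized_density:
  "(\<integral>x. normalized_density t x * x ^ k \<partial>lborel)
    = (\<integral>y. (y - mean t) ^ k * (exp (t * y) * p y) \<partial>lborel) / (F 0 t * sqrt (var t) ^ k)"
proof -
  define s where "s = sqrt (var t)"
  have s: "0 < s" using var_pos[of t] by (simp add: s_def)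
  have "(\<integral>y. (y - mean t) ^ k * (exp (t * y) * p y) / (F 0 t * s ^ k) \<partial>lborel)
    = s * (\<integral>x. (mean t + s * x - mean t) ^ k * (exp (t * (mean t + s * x)) * p (mean t + s * x)) / (F 0 t * s ^ k) \<partial>lborel)"
    using s by (subst lborel_integral_real_affine[where c=s and t="mean t"]) simp_all
  also have "\<dots> = (\<integral>x. normalized_density t x * x ^ k \<partial>lborel)"
    unfolding normalized_density_def s_def[symmetric] using s
    by (simp add: power_mult_distrib ac_simps flip: integral_mult_right_zero)
  finally show ?thesis by (simp add: s_def)
qed

lemma normalized_density_moments:
  shows "integrable lborel (normalized_density t)"
    and "(\<integral>x. normalized_density t x \<partial>lborel) = 1"
    and "(\<integral>x. normalized_density t x * x \<partial>lborel) = 0"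
    and "(\<integral>x. normalized_density t x * x\<^sup>2 \<partial>lborel) = 1"
    and "(\<integral>x. normalized_density t x * x ^ 3 \<partial>lborel) = third t / sqrt (var t) ^ 3"
proof -
  have F: "F 0 t \<noteq> 0" and v: "0 < var t" using F0_pos[of t] var_pos[of t] by auto
  show 0: "(\<integral>x. normalized_density t x \<partial>lborel) = 1"
    using integral_normalized_density[of t 0] F by (simp add: F_def)
  then show "integrable lborel (normalized_density t)"
    using not_integrable_integral_eq by fastforce
  show "(\<integral>x. normalized_density t x * x \<partial>lborel) = 0"
    using integral_normalized_density[of t 1] by (simp add: central_moments)
  show "(\<integral>x. normalized_density t x * x\<^sup>2 \<partial>lborel) = 1"
    using integral_normalized_density[of t 2] F v by (simp add: central_moments)
  show "(\<integral>x. normalized_density t x * x ^ 3 \<partial>lborel) = third t / sqrt (var t) ^ 3"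
    using integral_normalized_density[of t 3] F by (simp add: central_moments)
qed

text \<open>The normalized tilted density is \<open>exp (- V)\<close> times \<open>exp (q (y x))\<close>, where \<open>y x\<close> undoes the
standardization and \<open>V\<close> is convex as the composition of \<open>g\<close> with an affine map, plus an affine
function. The resulting constant does not depend on the tilt \<open>t\<close>.\<close>

lemma standardized_normalized_density:
  assumes g: "convex_on {0..} g" and q: "\<And>x. 0 \<le> x \<Longrightarrow> \<bar>q x\<bar> \<le> B"
    and p: "\<And>x. 0 \<le> x \<Longrightarrow> p x = exp (- (g x - q x))"
    and bdd: "\<And>x. 0 \<le> x \<Longrightarrow> b \<le> g x - t * x"
  shows "standardized_density (normalized_density t) (envelope_bound (2 * (exp B)\<^sup>2 * exp 3))"
proof -
  let ?f = "normalized_density t"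
  define s where "s = sqrt (var t)"
  define y where "y = (\<lambda>x. s * x + mean t)"
  define S where "S = {x. 0 \<le> y x}"
  define V where "V = (\<lambda>x. g (y x) - t * y x + (ln (F 0 t) - ln s))"
  have s: "0 < s" using var_pos[of t] by (simp add: s_def)
  have B: "0 \<le> B" using q[of 0] by simp
  have f_eq: "?f x = exp (- V x) * exp (q (y x))" if "x \<in> S" for x
  proof -
    have "exp (- V x) * exp (q (y x)) = s * (exp (t * y x) * exp (- (g (y x) - q (y x))) / F 0 t)"
      unfolding V_def using s F0_pos[of t]
      by (simp add: exp_add exp_diff exp_minus field_simps)
    then show ?thesis using that p[of "y x"] unfolding normalized_density_def s_def y_def S_def by simp
  qed
  have f_off: "?f x = 0" if "x \<notin> S" for x
    using that p_neg[of "y x"] unfolding normalized_density_def s_def y_def S_def by simp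
  have convex_S: "convex S"
    unfolding S_def y_def
  proof (rule convexI)
    fix x x' u v :: real
    assume *: "x \<in> {x. 0 \<le> s * x + mean t}" "x' \<in> {x. 0 \<le> s * x + mean t}" "0 \<le> u" "0 \<le> v" "u + v = 1"
    have "s * (u * x + v * x') + (u + v) * mean t = u * (s * x + mean t) + v * (s * x' + mean t)"
      by (simp add: algebra_simps)
    then have "s * (u * x + v * x') + mean t = u * (s * x + mean t) + v * (s * x' + mean t)"
      using * by simp
    then show "u *\<^sub>R x + v *\<^sub>R x' \<in> {x. 0 \<le> s * x + mean t}" using * by simp
  qed
  have V: "convex_on S V"
    unfolding convex_on_def
  proof (intro conjI ballI allI impI convex_S)
    fix x x' u v :: real
    assume *: "x \<in> S" "x' \<in> S" "0 \<le> u" "0 \<le> v" "u + v = 1"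
    have "y (u *\<^sub>R x + v *\<^sub>R x') = s * (u * x + v * x') + (u + v) * mean t"
      using * by (simp add: y_def)
    then have yy: "y (u *\<^sub>R x + v *\<^sub>R x') = u *\<^sub>R y x + v *\<^sub>R y x'"
      by (simp add: y_def algebra_simps)
    have "g (u *\<^sub>R y x + v *\<^sub>R y x') \<le> u * g (y x) + v * g (y x')"
      using g * unfolding convex_on_def S_def by simp
    moreover have "ln (F 0 t) - ln s = u * (ln (F 0 t) - ln s) + v * (ln (F 0 t) - ln s)"
      using * by (simp flip: distrib_right)
    ultimately show "V (u *\<^sub>R x + v *\<^sub>R x') \<le> u * V x + v * V x'"
      unfolding V_def yy by (simp add: algebra_simps)
  qed
  have V_bdd: "bdd_below (V ` S)"
    unfolding bdd_below_def using bdd by (intro exI[of _ "b + (ln (F 0 t) - ln s)"]) (auto simp: V_def S_def)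
  have sandwich: "exp (- V x) / exp B \<le> ?f x" "?f x \<le> exp B * exp (- V x)" if x: "x \<in> S" for x
  proof -
    have "\<bar>q (y x)\<bar> \<le> B" using x by (intro q) (simp add: S_def)
    then have "exp (- B) \<le> exp (q (y x))" "exp (q (y x)) \<le> exp B" by auto
    then have "exp (- V x) * exp (- B) \<le> exp (- V x) * exp (q (y x))" "exp (- V x) * exp (q (y x)) \<le> exp (- V x) * exp B"
      by (intro mult_left_mono; simp)+
    then show "exp (- V x) / exp B \<le> ?f x" "?f x \<le> exp B * exp (- V x)"
      unfolding f_eq[OF x] by (simp_all add: exp_minus field_simps)
  qed
  have "1 \<le> exp B" using B by simp
  from log_concave_up_to_factor_envelope[OF this normalized_density_measurable normalized_density_moments(1,2)
      normalized_density_nonneg f_off V V_bdd sandwich]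
  obtain x0 D where env: "0 < D" "\<And>x. ?f x \<le> (2 * (exp B)\<^sup>2 * exp 3) / D * exp (- (\<bar>x - x0\<bar> / D))"
    by blast
  note std = standardized_density_if_laplace_envelope[OF normalized_density_measurable normalized_density_nonneg env
      normalized_density_moments(1-4)]
  show ?thesis
    by unfold_locales
      (auto intro: std normalized_density_nonneg simp: normalized_density_moments)
qed

end

theorem theorem6:
  fixes M :: "'a measure" and X :: "'a \<Rightarrow> real"
    and g q :: "real \<Rightarrow> real" and a :: "nat \<Rightarrow> real"
  defines "t \<equiv> \<lambda>n. tilt_param M X (a n)"
  defines "s \<equiv> \<lambda>n. tilt_sd M X (t n)"
  defines "\<mu>3 \<equiv> \<lambda>n. tilt_mu3 M X (t n)"
  defines "\<rho> \<equiv> \<lambda>n. normalized_sum_density M X (light_density g q) (a n) n"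
  assumes "prob_space M"
    and "distributed M lborel X (\<lambda>x. ennreal (light_density g q x))"
    and "\<forall>x\<ge>0. g x > 0"
    and "convex_on {0..} g"
    and "\<forall>k<4. \<forall>x>0. (deriv ^^ k) g differentiable (at x)"
    and "filterlim (\<lambda>x. g x / x) at_top at_top"
    and "bounded (q ` {0..})"
    and "regular_case (deriv g) q \<or> rapid_case (deriv g) q"
    and "filterlim a at_top sequentially"
  shows "uniform_limit UNIV
           (\<lambda>n x. sqrt (real n) *
              (\<rho> n x - std_normal_density x *
                 (1 + \<mu>3 n / (6 * sqrt (real n) * s n ^ 3) * (x ^ 3 - 3 * x))))
           (\<lambda>x. 0) sequentially"
proof -
  let ?p = "light_density g q"
  obtain B where B: "\<And>x. 0 \<le> x \<Longrightarrow> \<bar>q x\<bar> \<le> B"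
    using \<open>bounded (q ` {0..})\<close> unfolding bounded_iff by auto
  have p_nonneg: "0 \<le> ?p x" for x by (simp add: light_density_def)
  have p_measurable [measurable]: "?p \<in> borel_measurable borel"
    using distributed_real_measurable[OF _ assms(6)] p_nonneg by simp
  \<comment> \<open>Superlinear growth of \<open>g\<close> dominates each tilt.\<close>
  have lower: "\<exists>b. \<forall>x\<ge>0. b \<le> g x - r * x" for r
  proof -
    obtain Y where Y: "\<And>x. Y \<le> x \<Longrightarrow> \<bar>r\<bar> \<le> g x / x"
      using \<open>filterlim (\<lambda>x. g x / x) at_top at_top\<close> unfolding filterlim_at_top eventually_at_top_linorder by meson
    have "- \<bar>r\<bar> * max 1 Y \<le> g x - r * x" if x: "0 \<le> x" for x
    proof (cases "max 1 Y \<le> x")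
      case True
      then have "\<bar>r\<bar> * x \<le> g x" using Y[of x] by (simp add: pos_le_divide_eq)
      moreover have "r * x \<le> \<bar>r\<bar> * x" using x by (intro mult_right_mono) auto
      moreover have "0 \<le> \<bar>r\<bar> * max 1 Y" by simp
      ultimately show ?thesis unfolding mult_minus_left by linarith
    next
      case False
      have "r * x \<le> \<bar>r\<bar> * x" using x by (intro mult_right_mono) auto
      also have "\<dots> \<le> \<bar>r\<bar> * max 1 Y" using False by (intro mult_left_mono) auto
      finally have "r * x \<le> \<bar>r\<bar> * max 1 Y" .
      moreover have "0 < g x" using \<open>\<forall>x\<ge>0. g x > 0\<close> x by blast
      ultimately show ?thesis unfolding mult_minus_left by linarith
    qed
    then show ?thesis by blast
  qed
  interpret E: exponential_family ?p
  proof
    show "?p x = 0" if "x < 0" for x using that by (simp add: light_density_def)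
    show "0 < ?p x" if "0 \<le> x" for x using that by (simp add: light_density_def)
    show "integrable lborel (\<lambda>x. exp (r * x) * ?p x)" for r
    proof -
      \<comment> \<open>The tilt \<open>r + 1\<close> instead of \<open>r\<close> leaves an integrable factor \<open>exp (- x)\<close>.\<close>
      obtain b where b: "\<And>x. 0 \<le> x \<Longrightarrow> b \<le> g x - (r + 1) * x" using lower by blast
      show ?thesis
      proof (rule Bochner_Integration.integrable_bound)
        show "integrable lborel (\<lambda>x::real. exp (B - b) * (\<bar>x\<bar> ^ 0 * exp (- \<bar>x\<bar>)))"
          by (intro integrable_mult_right integrable_laplace_moment)
        show "AE x in lborel. norm (exp (r * x) * ?p x) \<le> norm (exp (B - b) * (\<bar>x\<bar> ^ 0 * exp (- \<bar>x\<bar>)))"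
        proof (rule AE_I2)
          fix x :: real
          show "norm (exp (r * x) * ?p x) \<le> norm (exp (B - b) * (\<bar>x\<bar> ^ 0 * exp (- \<bar>x\<bar>)))"
          proof (cases "0 \<le> x")
            case True
            then have "r * x - (g x - q x) \<le> B - b - x" using b[of x] B[of x] by (simp add: algebra_simps)
            then show ?thesis using True by (simp add: light_density_def flip: exp_add)
          qed (simp add: light_density_def)
        qed
      qed measurable
    qed
  qed measurable
  have mgf: "mgf M X = E.F 0"
  proof
    fix r
    have "(\<integral>x. ?p x * exp (r * x) \<partial>lborel) = (\<integral>\<omega>. exp (r * X \<omega>) \<partial>M)"
      by (rule distributed_integral[OF assms(6)]) (auto simp: p_nonneg)
    then show "mgf M X r = E.F 0 r" by (simp add: mgf_def E.F_def mult.commute)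
  qed
  have mean: "tilt_mean M X = E.mean"
    unfolding tilt_mean_def mgf by (rule ext) (rule DERIV_imp_deriv[OF E.log_F_has_derivative])
  have var: "deriv E.mean = E.var"
    by (rule ext) (rule DERIV_imp_deriv[OF E.mean_has_derivative])
  have third: "deriv E.var = E.third"
    by (rule ext) (rule DERIV_imp_deriv[OF E.var_has_derivative])
  have sd: "tilt_sd M X r = sqrt (E.var r)" for r
    unfolding tilt_sd_def mean var ..
  have mu3: "tilt_mu3 M X = E.third"
    unfolding tilt_mu3_def using mean var third by (simp add: tilt_mean_def numeral_3_eq_3)
  define C where "C = envelope_bound (2 * (exp B)\<^sup>2 * exp 3)"
  define bound where "bound = (\<lambda>n. C ^ 3 * (\<integral>u. edgeworth_majorant u \<partial>lborel) / sqrt (real n)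
      + C * (real n * sqrt (1 - char_gap C) ^ (n - 2)))"
  have std: "standardized_density (E.normalized_density r) C" for r
  proof -
    obtain b where "\<And>x. 0 \<le> x \<Longrightarrow> b \<le> g x - r * x" using lower by blast
    then show ?thesis
      unfolding C_def using \<open>convex_on {0..} g\<close> B
      by (intro E.standardized_normalized_density) (auto simp: light_density_def)
  qed
  have key: "\<bar>sqrt (real n) * (\<rho> n x - std_normal_density x *
       (1 + \<mu>3 n / (6 * sqrt (real n) * s n ^ 3) * (x ^ 3 - 3 * x)))\<bar> \<le> bound n"
    if n: "n \<ge> 3" and an: "E.mean 0 \<le> a n" for n x
  proof -
    have tn: "E.mean (t n) = a n"
    proof -
      obtain r where r: "E.mean r = a n" using E.mean_attains[OF an] .
      have "t n = r"
        unfolding t_def tilt_param_def mean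
      proof (rule the_equality)
        show "E.mean r = a n" by (rule r)
        show "u = r" if "E.mean u = a n" for u
          using E.mean_strict_mono[of u r] E.mean_strict_mono[of r u] that r
          by (metis less_irrefl linorder_neqE_linordered_idom)
      qed
      then show ?thesis using r by simp
    qed
    have tp: "tilt_param M X (a n) = t n" by (simp add: t_def)
    have dens: "normalized_tilted_density M X ?p (a n) = E.normalized_density (t n)"
      unfolding normalized_tilted_density_def Let_def tilted_density_def E.normalized_density_def
        sd mgf tp tn by (rule ext) simp
    interpret S: standardized_density "E.normalized_density (t n)" C by (rule std)
    have skew: "S.skewness = \<mu>3 n / s n ^ 3"
      unfolding S.skewness_def E.normalized_density_moments(5) \<mu>3_def s_def mu3 sd ..
    have sn: "0 < sqrt (real n)" using n by simp
    have "\<bar>\<rho> n x - std_normal_density x * (1 + \<mu>3 n / (6 * sqrt (real n) * s n ^ 3) * (x ^ 3 - 3 * x))\<bar>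
        \<le> C ^ 3 / n * (\<integral>u. edgeworth_majorant u \<partial>lborel) + sqrt n * C * sqrt (1 - char_gap C) ^ (n - 2)"
      using S.edgeworth_expansion[OF n, of x]
      unfolding \<rho>_def normalized_sum_density_def dens skew by (simp add: mult.commute)
    from mult_left_mono[OF this, of "sqrt n"]
    have "sqrt n * \<bar>\<rho> n x - std_normal_density x * (1 + \<mu>3 n / (6 * sqrt (real n) * s n ^ 3) * (x ^ 3 - 3 * x))\<bar>
        \<le> sqrt n * (C ^ 3 / n * (\<integral>u. edgeworth_majorant u \<partial>lborel) + sqrt n * C * sqrt (1 - char_gap C) ^ (n - 2))"
      by simp
    also have "\<dots> = bound n"
    proof -
      have "r * (K / (r * r) * J + r * C * T) = K * J / r + C * (r * r * T)" if "0 < r" for r K J T :: real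
        using that by (simp add: field_simps)
      from this[OF sn] show ?thesis unfolding bound_def by simp
    qed
    finally show ?thesis by (simp add: abs_mult)
  qed
  have lim: "bound \<longlonglongrightarrow> 0"
  proof -
    interpret S: standardized_density "E.normalized_density 0" C by (rule std)
    define \<theta> where "\<theta> = sqrt (1 - char_gap C)"
    have \<theta>: "\<bar>\<theta>\<bar> < 1"
    proof -
      have "(cmod (S.\<phi> (1 / C)))\<^sup>2 \<le> 1 - char_gap C"
        using S.bound_pos by (intro S.char_square_away_from_zero) simp
      then have "0 \<le> 1 - char_gap C" by (rule order_trans[rotated]) simp
      then show ?thesis using S.char_gap_pos by (simp add: \<theta>_def)
    qed
    \<comment> \<open>Geometric decay, after the index shift \<open>n = m + 2\<close>.\<close>
    have "(\<lambda>m. real m * \<theta> ^ m + 2 * \<theta> ^ m) \<longlonglongrightarrow> 0 + 2 * 0"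
      using \<theta> by (intro tendsto_intros powser_times_n_limit_0 LIMSEQ_power_zero) auto
    then have "(\<lambda>m. real (m + 2) * \<theta> ^ (m + 2 - 2)) \<longlonglongrightarrow> 0" by (simp add: algebra_simps)
    then have A: "(\<lambda>n. real n * \<theta> ^ (n - 2)) \<longlonglongrightarrow> 0"
      by (rule LIMSEQ_offset)
    have "(\<lambda>n. C ^ 3 * (\<integral>u. edgeworth_majorant u \<partial>lborel) / sqrt (real n)) \<longlonglongrightarrow> 0"
      by (intro real_tendsto_divide_at_top[OF tendsto_const] filterlim_compose[OF sqrt_at_top filterlim_real_sequentially])
    from tendsto_add[OF this tendsto_mult[OF tendsto_const[of C] A]]
    show ?thesis unfolding bound_def \<theta>_def by simp
  qed
  show ?thesis
    unfolding uniform_limit_iff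
  proof (intro allI impI)
    fix e :: real assume "0 < e"
    have "\<forall>\<^sub>F n in sequentially. bound n < e" by (rule order_tendstoD(2)[OF lim \<open>0 < e\<close>])
    moreover have "\<forall>\<^sub>F n in sequentially. E.mean 0 \<le> a n"
      using \<open>filterlim a at_top sequentially\<close> unfolding filterlim_at_top by blast
    moreover have "\<forall>\<^sub>F n in sequentially. 3 \<le> n" by (rule eventually_ge_at_top)
    ultimately show "\<forall>\<^sub>F n in sequentially. \<forall>x\<in>UNIV. dist (sqrt (real n) * (\<rho> n x - std_normal_density x *
         (1 + \<mu>3 n / (6 * sqrt (real n) * s n ^ 3) * (x ^ 3 - 3 * x)))) 0 < e"
    proof eventually_elim
      case (elim n)
      then show ?case using key[of n] by (auto simp: dist_real_def intro: le_less_trans)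
    qed
  qed
qed

end
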